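(* Let $\Delta_{16}=\sum_{n>0}a_n(\Delta_{16})q^n$ be the unique (normalized) cusp form of level $1$ and weight $16$. Then for every prime $p\neq 31$: (1) if $\left(\frac{p}{31}\right)=-1$, then $a_p(\Delta_{16})\equiv 0 \pmod{31}$; (2) if $p=u^2+31v^2$ for some integers $u\neq 0$ and $v$, then $a_p(\Delta_{16})\equiv 2\pmod{31}$; (3) for all other primes $p\ne 31$, $a_p(\Delta_{16})\equiv -1\pmod{31}$.
   Context: Here $q=e^{2\pi i z}$ and $\left(\frac{\cdot}{\cdot}\right)$ is the Legendre symbol. The space $S_{16}(SL_2(\mathbb{Z}))$ of cusp forms of weight $16$ for $SL_2(\mathbb{Z})$ is one-dimensional, and $\Delta_{16}$ denotes its unique element normalized by $a_1(\Delta_{16})=1$; its Fourier coefficients are integers. *)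

theory Defs
  imports "HOL-Complex_Analysis.Complex_Analysis" "HOL-Number_Theory.Number_Theory"
begin

definition upper_half_plane :: "complex set" where
  "upper_half_plane = {z. Im z > 0}"

definition has_q_expansion :: "(complex \<Rightarrow> complex) \<Rightarrow> (nat \<Rightarrow> complex) \<Rightarrow> bool" where
  "has_q_expansion f a \<longleftrightarrow>
     (\<forall>z\<in>upper_half_plane. (\<lambda>n. a n * exp (2 * of_real pi * \<i> * z) ^ n) sums f z)"

(* The coefficients are unique when an expansion exists, since z \<mapsto> q maps the upper
   half-plane onto the punctured open unit disc. *)
definition fourier_coeff :: "(complex \<Rightarrow> complex) \<Rightarrow> nat \<Rightarrow> complex" where
  "fourier_coeff f = (THE a. has_q_expansion f a)"

(* Level 1, weight k.  Holomorphy at the cusp is the existence of a q-expansion without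
   negative powers.  A function on the upper half-plane is represented by its extension by 0
   to all complex numbers, so that equality of functions is equality of modular forms. *)
definition modular_forms :: "int \<Rightarrow> (complex \<Rightarrow> complex) set" where
  "modular_forms k =
     {f. f holomorphic_on upper_half_plane \<and>
         (\<forall>a b c d :: int. a * d - b * c = 1 \<longrightarrow>
            (\<forall>z\<in>upper_half_plane.
               f ((of_int a * z + of_int b) / (of_int c * z + of_int d)) =
                 (of_int c * z + of_int d) powi k * f z)) \<and>
         (\<exists>a. has_q_expansion f a) \<and>
         (\<forall>z. z \<notin> upper_half_plane \<longrightarrow> f z = 0)}"

definition cusp_forms :: "int \<Rightarrow> (complex \<Rightarrow> complex) set" where
  "cusp_forms k = {f \<in> modular_forms k. fourier_coeff f 0 = 0}"

definition Delta16 :: "complex \<Rightarrow> complex" where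
  "Delta16 = (THE f. f \<in> cusp_forms 16 \<and> fourier_coeff f 1 = 1)"

end

theory Submission
  imports Defs "HOL-Real_Asymp.Real_Asymp"
begin

text \<open>
  Put \<open>x = \<Sum> q^(n\<^sup>2)\<close> and \<open>y = \<Sum> q^((n + 1/2)\<^sup>2)\<close>. Under \<open>z \<mapsto> -1/z\<close> the pair \<open>(x, y)\<close> becomes
  \<open>(x + y, x - y)\<close> up to a factor \<open>\<surd>(-i z / 2)\<close>, and under \<open>z \<mapsto> z + 1\<close> it becomes \<open>(x, i y)\<close>. Hence
  \<open>(x\<^sup>8 + 14 x\<^sup>4 y\<^sup>4 + y\<^sup>8) x\<^sup>4 y\<^sup>4 (x\<^sup>4 - y\<^sup>4)\<^sup>4 / 16\<close> is a cusp form of level 1 and weight 16 with integral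
  coefficients and \<open>a\<^sub>1 = 1\<close>; it is the only one, because a form \<open>g\<close> of weight 16 that vanishes to order 2 at
  the cusp is zero, by the maximum principle applied to \<open>g / q\<^sup>2\<close> at a maximum of \<open>|g| (Im z)\<^sup>8\<close>.

  Modulo 31 the polynomial is congruent to a combination of 32nd powers of theta series, and
  \<open>\<theta>(q)\<^sup>3\<^sup>2 \<equiv> \<theta>(q) \<theta>(q\<^sup>3\<^sup>1)\<close>. This gives
  \<open>\<Delta>\<^sub>1\<^sub>6 \<equiv> (\<Sum> q^(a\<^sup>2 + a b + 8 b\<^sup>2) - \<Sum> q^(2 a\<^sup>2 + a b + 4 b\<^sup>2)) / 2\<close> modulo 31, and the primes represented
  by these forms of discriminant -31 are found by reduction theory.
\<close>

text \<open>The polynomial is a product of the invariants of degree 8 and 24 in Gleason's theorem on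
  self-dual codes; at the theta series these are E_4 and 16 Delta, so the form is E_4 Delta. The
  prime 31 fits weight 16 because 31 + 1 = 2 * 16: a theta series has weight 1/2, so the polynomial
  has degree 32, and f^32 = f * f^31 turns into a binary theta series. This only helps for 32nd
  powers of one-variable theta series. The terms (x y)^16 and (x^2 +- y^2)^16 become such powers by
  duplication formulas, since x y and x^2 +- y^2 are, up to constants, squares of theta series at
  the arguments z/2 and 2z. These involve q^(1/8), so the formal identities are stated in X =
  q^(1/8). Denominators are avoided by computing with 16 times the form. Both
  \<open>fourier_coeff\<close> and \<open>Delta16\<close> are definite descriptions, so uniqueness
  of q-expansions and of the normalized cusp form has to be proved. The maximum principle suffices
  for the latter because |q|^2 y^8 peaks at y = 2/pi, below the height 3/4 that the reduction
  algorithm always reaches.\<close>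

unbundle no vec_syntax

section \<open>Binary quadratic forms of discriminant -31\<close>

text \<open>Gauss reduction: a translation of x brings the middle coefficient into [-a, a), and if
  then c' < a, swapping the variables yields a smaller leading coefficient. Otherwise the form is
  one of three reduced ones. The integers \<alpha>, ..., \<delta> are not recorded as unimodular, as
  only the value of the form at (1, 0) is read off later.\<close>

lemma form_disc_31_reduction:
  fixes a b c :: int
  assumes "a > 0" and "b^2 - 4*a*c = -31"
  shows "\<exists>\<alpha> \<beta> \<gamma> \<delta> :: int.
    (\<forall>x y. a*x^2 + b*x*y + c*y^2 = (\<alpha>*x + \<beta>*y)^2 + (\<alpha>*x + \<beta>*y)*(\<gamma>*x + \<delta>*y) + 8*(\<gamma>*x + \<delta>*y)^2) \<or>
    (\<forall>x y. a*x^2 + b*x*y + c*y^2 = 2*(\<alpha>*x + \<beta>*y)^2 + (\<alpha>*x + \<beta>*y)*(\<gamma>*x + \<delta>*y) + 4*(\<gamma>*x + \<delta>*y)^2)"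
    (is "?P a b c")
  using assms
proof (induction "nat a" arbitrary: a b c rule: less_induct)
  case less
  define k where "k = - ((b + a) div (2*a))"
  define b' where "b' = b + 2*a*k"
  define c' where "c' = a*k^2 + b*k + c"
  have disc: "b'^2 - 4*a*c' = -31"
    using less.prems(2) unfolding b'_def c'_def by (simp add: algebra_simps power2_eq_square)
  have b'_eq: "b' = (b + a) mod (2*a) - a"
    unfolding b'_def k_def by (simp add: minus_div_mult_eq_mod [symmetric] algebra_simps)
  have b'_bound: "-a \<le> b'" "b' < a"
    using less.prems(1) unfolding b'_eq by (auto simp: algebra_simps)
  have shift: "a*x^2 + b*x*y + c*y^2 = a*(x - k*y)^2 + b'*(x - k*y)*y + c'*y^2" for x y
    unfolding b'_def c'_def by (simp add: algebra_simps power2_eq_square)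
  have c'_pos: "c' > 0"
  proof -
    have "4*a*c' > 0" using disc by (smt (verit) zero_le_power2)
    thus ?thesis using less.prems(1) by (simp add: zero_less_mult_iff)
  qed
  have "?P a b' c'"
  proof (cases "c' < a")
    case True
    have "(-b')^2 - 4*c'*a = -31" using disc by (simp add: mult.commute mult.left_commute)
    from less.hyps [OF _ c'_pos this] True less.prems(1)
    obtain \<alpha> \<beta> \<gamma> \<delta> where *:
      "(\<forall>x y. c'*x^2 + (-b')*x*y + a*y^2 = (\<alpha>*x + \<beta>*y)^2 + (\<alpha>*x + \<beta>*y)*(\<gamma>*x + \<delta>*y) + 8*(\<gamma>*x + \<delta>*y)^2) \<or>
       (\<forall>x y. c'*x^2 + (-b')*x*y + a*y^2 = 2*(\<alpha>*x + \<beta>*y)^2 + (\<alpha>*x + \<beta>*y)*(\<gamma>*x + \<delta>*y) + 4*(\<gamma>*x + \<delta>*y)^2)"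
      by auto
    have sw: "a*x^2 + b'*x*y + c'*y^2 = c'*(-y)^2 + (-b')*(-y)*x + a*x^2" for x y
      by (simp add: algebra_simps)
    show ?thesis
      apply (rule exI[of _ \<beta>], rule exI[of _ "-\<alpha>"], rule exI[of _ \<delta>], rule exI[of _ "-\<gamma>"])
      apply (rule disj_forward [OF *])
       apply (intro allI, subst sw, drule_tac x = "-y" in spec, drule_tac x = x in spec, simp add: algebra_simps)
      apply (intro allI, subst sw, drule_tac x = "-y" in spec, drule_tac x = x in spec, simp add: algebra_simps)
      done
  next
    case False
    have "b'^2 \<le> a^2"
      using b'_bound by (intro power2_le_iff_abs_le [THEN iffD2]) auto
    moreover have "a*a \<le> a*c'" using False less.prems(1) by simp
    \<comment> \<open>31 = 4 a c' - b'^2 is at least 4 a^2 - a^2.\<close>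
    ultimately have "3*a^2 \<le> 31" using disc by (simp add: power2_eq_square)
    have a3: "a \<le> 3"
    proof (rule ccontr)
      assume "\<not> a \<le> 3"
      hence "4^2 \<le> a^2" by (intro power_mono) auto
      thus False using \<open>3*a^2 \<le> 31\<close> by simp
    qed
    \<comment> \<open>The discriminant makes b' odd, and a = 3 would require 12 to divide 32 or 40.
      The form (2, -1, 4) is the mirror image of (2, 1, 4), absorbed below by y -> -y.\<close>
    have "a = 1 \<and> b' = -1 \<and> c' = 8 \<or> a = 2 \<and> (b' = 1 \<or> b' = -1) \<and> c' = 4"
    proof -
      consider "a = 1" | "a = 2" | "a = 3" using a3 less.prems(1) by linarith
      thus ?thesis
      proof cases
        case 1
        hence "b' = 0 \<or> b' = -1" using b'_bound by linarith
        thus ?thesis using disc 1 by auto presburger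
      next
        case 2
        hence "b' = 0 \<or> b' = -1 \<or> b' = 1 \<or> b' = -2" using b'_bound by linarith
        thus ?thesis using disc 2 by auto presburger+
      next
        case 3
        hence "b' = 0 \<or> b' = -1 \<or> b' = 1 \<or> b' = -2 \<or> b' = 2 \<or> b' = -3" using b'_bound by linarith
        thus ?thesis using disc 3 by auto presburger+
      qed
    qed
    then consider "a = 1" "b' = -1" "c' = 8" | "a = 2" "b' = 1" "c' = 4" | "a = 2" "b' = -1" "c' = 4"
      by blast
    thus ?thesis
    proof cases
      case 1
      show ?thesis unfolding 1
        by (rule exI[of _ 1], rule exI[of _ 0], rule exI[of _ 0], rule exI[of _ "-1"]) simp
    next
      case 2
      show ?thesis unfolding 2
        by (rule exI[of _ 1], rule exI[of _ 0], rule exI[of _ 0], rule exI[of _ 1]) simp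
    next
      case 3
      show ?thesis unfolding 3
        by (rule exI[of _ 1], rule exI[of _ 0], rule exI[of _ 0], rule exI[of _ "-1"]) simp
    qed
  qed
  then obtain \<alpha> \<beta> \<gamma> \<delta> where *:
      "(\<forall>x y. a*x^2 + b'*x*y + c'*y^2 = (\<alpha>*x + \<beta>*y)^2 + (\<alpha>*x + \<beta>*y)*(\<gamma>*x + \<delta>*y) + 8*(\<gamma>*x + \<delta>*y)^2) \<or>
       (\<forall>x y. a*x^2 + b'*x*y + c'*y^2 = 2*(\<alpha>*x + \<beta>*y)^2 + (\<alpha>*x + \<beta>*y)*(\<gamma>*x + \<delta>*y) + 4*(\<gamma>*x + \<delta>*y)^2)"
    by auto
  show ?case
    apply (rule exI[of _ \<alpha>], rule exI[of _ "\<beta> - \<alpha>*k"], rule exI[of _ \<gamma>], rule exI[of _ "\<delta> - \<gamma>*k"])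
    apply (rule disj_forward [OF *])
     apply (intro allI, subst shift, drule_tac x = "x - k*y" in spec, drule_tac x = y in spec, simp add: algebra_simps)
    apply (intro allI, subst shift, drule_tac x = "x - k*y" in spec, drule_tac x = y in spec, simp add: algebra_simps)
    done
qed

section \<open>Primes represented by forms of discriminant -31\<close>

text \<open>Since 31 = 3 modulo 4, reciprocity gives (31/p) = (-1)^((p-1)/2) (p/31). Euler's
  criterion yields the same sign for (-1/p), and the two signs cancel in (-31/p).\<close>

lemma minus_31_square_mod_prime:
  fixes p :: nat
  assumes "prime p" "p \<noteq> 2" "Legendre (int p) 31 = 1"
  shows "\<exists>r::int. int p dvd r^2 + 31"
proof -
  have p2: "p > 2" using assms prime_ge_2_nat[of p] by linarith
  have "int p \<noteq> 31" using assms(3) by (auto simp: Legendre_def cong_def)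
  hence p31: "p \<noteq> 31" by auto
  have pr31: "prime (31::nat)" by simp
  have "Legendre (int p) (int 31) * Legendre (int 31) (int p) = (-1::int) ^ ((p - 1) div 2 * ((31 - 1) div 2))"
    by (rule Quadratic_Reciprocity) (use assms p2 p31 in auto)
  hence L: "Legendre 31 (int p) = (-1) ^ ((p - 1) div 2 * 15)" using assms(3) by simp
  have e1: "[Legendre (-31) (int p) = (-31) ^ ((p - 1) div 2)] (mod int p)"
    using euler_criterion[of p "-31"] assms(1) p2 by simp
  have e2: "[Legendre 31 (int p) = 31 ^ ((p - 1) div 2)] (mod int p)"
    using euler_criterion[of p "31"] assms(1) p2 by simp
  have "(-31::int) ^ ((p - 1) div 2) = (-1) ^ ((p - 1) div 2) * 31 ^ ((p - 1) div 2)"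
    by (simp add: power_mult_distrib[symmetric])
  with e1 e2 have "[Legendre (-31) (int p) = (-1) ^ ((p - 1) div 2) * Legendre 31 (int p)] (mod int p)"
    by (metis cong_scalar_left cong_sym cong_trans)
  also have "(-1) ^ ((p - 1) div 2) * Legendre 31 (int p) = (((-1) ^ ((p - 1) div 2))^16 :: int)"
    unfolding L by (simp add: power_mult power_mult_distrib flip: power_Suc)
  also have "\<dots> = 1" by (simp add: power_mult[symmetric])
  finally have c: "[Legendre (-31) (int p) = 1] (mod int p)" .
  have "QuadRes (int p) (-31)"
  proof (rule ccontr)
    assume "\<not> QuadRes (int p) (-31)"
    hence "Legendre (-31) (int p) = 0 \<or> Legendre (-31) (int p) = -1" by (auto simp: Legendre_def)
    with c have "int p dvd 1 \<or> int p dvd 2"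
      by (auto simp: cong_iff_dvd_diff)
    thus False using p2 by (auto dest: zdvd_imp_le)
  qed
  thus ?thesis unfolding QuadRes_def cong_iff_dvd_diff by auto
qed

text \<open>An odd square root s of -31 modulo p satisfies s^2 + 31 = 4 p c, so (p, s, c) is a form
  of discriminant -31 with value p at (1, 0); reduction carries this value over to a reduced
  form.\<close>

lemma prime_represented_disc_31:
  fixes p :: nat
  assumes "prime p" "p \<noteq> 2" "Legendre (int p) 31 = 1"
  shows "\<exists>x y :: int. int p = x^2 + x*y + 8*y^2 \<or> int p = 2*x^2 + x*y + 4*y^2"
proof -
  obtain r :: int where r: "int p dvd r^2 + 31" using minus_31_square_mod_prime[OF assms] by blast
  have oddp: "odd p" using assms prime_odd_nat by (metis prime_nat_iff two_is_prime_nat primes_dvd_imp_eq)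
  \<comment> \<open>Adding the odd number p changes the parity of r; an odd s makes 4 divide s^2 +
    31.\<close>
  define s where "s = (if odd r then r else r + int p)"
  have "odd s" using oddp by (auto simp: s_def)
  have "int p dvd s^2 + 31"
  proof -
    have "s^2 + 31 = (r^2 + 31) + int p * (if odd r then 0 else 2*r + int p)"
      by (auto simp: s_def power2_eq_square algebra_simps)
    thus ?thesis using r by (metis dvd_add dvd_triv_left)
  qed
  moreover have "4 dvd s^2 + 31"
  proof -
    obtain t where "s = 2 * t + 1" using \<open>odd s\<close> by (rule oddE)
    hence "s^2 + 31 = 4*(t^2 + t + 8)" by (simp add: power2_eq_square algebra_simps)
    thus ?thesis by simp
  qed
  moreover have "coprime 4 (int p)"
  proof -
    have "coprime (2^2) (int p)" using oddp by (simp only: coprime_power_left_iff) simp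
    thus ?thesis by simp
  qed
  ultimately have "4 * int p dvd s^2 + 31" by (intro divides_mult) auto
  then obtain c where c: "s^2 + 31 = 4 * int p * c" by (auto elim: dvdE)
  have "int p > 0" using assms(1) prime_gt_0_nat by simp
  from form_disc_31_reduction[OF this, of s c] c
  obtain \<alpha> \<beta> \<gamma> \<delta> where
    "(\<forall>x y. int p*x^2 + s*x*y + c*y^2 = (\<alpha>*x + \<beta>*y)^2 + (\<alpha>*x + \<beta>*y)*(\<gamma>*x + \<delta>*y) + 8*(\<gamma>*x + \<delta>*y)^2) \<or>
     (\<forall>x y. int p*x^2 + s*x*y + c*y^2 = 2*(\<alpha>*x + \<beta>*y)^2 + (\<alpha>*x + \<beta>*y)*(\<gamma>*x + \<delta>*y) + 4*(\<gamma>*x + \<delta>*y)^2)"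
    by auto
  thus ?thesis
    by (elim disjE; drule_tac x = 1 in spec; drule_tac x = 0 in spec) auto
qed

text \<open>Brahmagupta's identity gives (a c + 31 b d)^2 + 31 (a d - b c)^2 = m n p^2. With a d - b
  c = p e this yields 31 e^2 <= m n, so e = 0 if m n < 31. For m = n = 8 the remaining case e^2 = 1
  would make 33 p^2 a square, which the 11-adic valuation excludes.\<close>

lemma representations_proportional_aux:
  fixes a b c d m n p :: int
  assumes "p > 0" "a^2 + 31*b^2 = m*p" "c^2 + 31*d^2 = n*p" "p dvd a*d - b*c"
    and "m*n < 31 \<or> m = 8 \<and> n = 8"
  shows "a*d = b*c"
proof -
  obtain e where e: "a*d - b*c = p*e" using assms(4) by (elim dvdE)
  have "(a*c + 31*b*d)^2 + 31*(a*d - b*c)^2 = (a^2 + 31*b^2)*(c^2 + 31*d^2)"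
    by (simp add: power2_eq_square algebra_simps)
  also have "\<dots> = (m*n) * p^2" unfolding assms by (simp add: power2_eq_square)
  finally have *: "(a*c + 31*b*d)^2 = (m*n - 31*e^2) * p^2"
    unfolding e by (simp add: power2_eq_square algebra_simps)
  hence "0 \<le> (m*n - 31*e^2) * p^2" by (metis zero_le_power2)
  hence le: "31*e^2 \<le> m*n" using assms(1) by (simp add: zero_le_mult_iff)
  have "e = 0"
  proof (rule ccontr)
    assume "e \<noteq> 0"
    hence e1: "e^2 \<ge> 1" by (metis int_one_le_iff_zero_less zero_less_power2)
    with le assms(5) have mn: "m = 8" "n = 8" by auto
    have "e^2 < 2^2" using le mn by simp
    hence "\<bar>e\<bar> < 2" by (metis abs_numeral abs_square_less_1 linorder_not_le power2_le_iff_abs_le power2_less_imp_less power_mono abs_ge_zero power2_abs zero_le_numeral)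
    hence "e^2 = 1" using \<open>e \<noteq> 0\<close> by (auto simp: abs_if power2_eq_1_iff split: if_splits)
    hence sq: "(a*c + 31*b*d)^2 = 33 * p^2" using * mn by simp
    have pr: "prime (11::int)" by simp
    have "multiplicity 11 ((a*c + 31*b*d)^2) = 2 * multiplicity 11 (a*c + 31*b*d)"
      using pr by (intro prime_elem_multiplicity_power_distrib) (use sq assms(1) in auto)
    moreover have "multiplicity 11 (33 * p^2) = multiplicity 11 (33::int) + 2 * multiplicity 11 p"
      using assms(1) pr by (subst prime_elem_multiplicity_mult_distrib)
        (auto simp: prime_elem_multiplicity_power_distrib)
    moreover have "multiplicity 11 (33::int) = 1"
      by (intro multiplicity_eqI) auto
    ultimately have "2 * multiplicity 11 (a*c + 31*b*d) = 1 + 2 * multiplicity 11 p" using sq by simp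
    moreover have "2*A \<noteq> 1 + 2*B" for A B :: nat by presburger
    ultimately show False by blast
  qed
  thus ?thesis using e by simp
qed

text \<open>Uniqueness up to signs: p divides a^2 d^2 - b^2 c^2, hence one of a d - b c and a d + b
  c, and b -> -b exchanges the two cases. It is applied with (m, n) = (1, 4), (1, 8) and (8,
  8).\<close>

lemma representations_proportional:
  fixes a b c d m n p :: int
  assumes "prime p" "a^2 + 31*b^2 = m*p" "c^2 + 31*d^2 = n*p"
    and "m*n < 31 \<or> m = 8 \<and> n = 8"
  shows "n*a^2 = m*c^2" "n*b^2 = m*d^2"
proof -
  have p0: "p > 0" using assms(1) prime_gt_0_int by blast
  have "(a*d - b*c)*(a*d + b*c) = a^2*d^2 - c^2*b^2" by (simp add: power2_eq_square algebra_simps)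
  also have "a^2 = m*p - 31*b^2" using assms by simp
  also have "c^2 = n*p - 31*d^2" using assms by simp
  also have "(m*p - 31*b^2)*d^2 - (n*p - 31*d^2)*b^2 = p*(m*d^2 - n*b^2)" by (simp add: algebra_simps)
  finally have "p dvd (a*d - b*c)*(a*d + b*c)" by simp
  hence "p dvd a*d - b*c \<or> p dvd a*d + b*c" using assms(1) by (simp add: prime_dvd_mult_iff)
  hence "a*d = b*c \<or> a*d = (-b)*c"
    using representations_proportional_aux[OF p0 assms(2,3) _ assms(4)]
      representations_proportional_aux[OF p0 _ assms(3) _ assms(4), of a "-b"] assms(2) by auto
  hence sq: "a^2*d^2 = b^2*c^2" by (auto simp: power_mult_distrib[symmetric])
  have "p * (n*a^2) = a^2 * (c^2 + 31*d^2)" using assms(3) by simp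
  also have "\<dots> = c^2 * (a^2 + 31*b^2)" using sq by (simp add: algebra_simps)
  also have "\<dots> = p * (m*c^2)" using assms(2) by simp
  finally show "n*a^2 = m*c^2" using p0 by simp
  have "p * (n*b^2) = b^2 * (c^2 + 31*d^2)" using assms(3) by simp
  also have "\<dots> = d^2 * (a^2 + 31*b^2)" using sq by (simp add: algebra_simps)
  also have "\<dots> = p * (m*d^2)" using assms(2) by simp
  finally show "n*b^2 = m*d^2" using p0 by simp
qed

lemma odd_square_mod_8:
  fixes a :: int
  assumes "odd a"
  shows "8 dvd a^2 - 1"
proof -
  obtain t where t: "a = 2 * t + 1" using assms by (rule oddE)
  have "even (t*(t + 1))" by auto
  then obtain s where "t*(t + 1) = 2 * s" by (elim evenE)
  hence "a^2 - 1 = 8 * s" unfolding t by (simp add: power2_eq_square algebra_simps)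
  thus ?thesis by simp
qed

lemma odd_odd_dvd_8:
  fixes a b :: int
  assumes "odd a" "odd b"
  shows "8 dvd a^2 + 31*b^2"
proof -
  have "a^2 + 31*b^2 = (a^2 - 1) + 31*(b^2 - 1) + 8*4" by simp
  thus ?thesis using odd_square_mod_8[OF assms(1)] odd_square_mod_8[OF assms(2)]
    by (metis dvd_add dvd_mult dvd_triv_left)
qed

lemma not_square_times_prime:
  fixes p :: int
  assumes "prime p"
  shows "a^2 \<noteq> p * b^2 \<or> b = 0"
proof (rule ccontr)
  assume "\<not> ?thesis"
  hence eq: "a^2 = p*b^2" "b \<noteq> 0" by auto
  hence "a \<noteq> 0" using assms by auto
  have "multiplicity p (a^2) = 2 * multiplicity p a"
    using assms \<open>a \<noteq> 0\<close> by (intro prime_elem_multiplicity_power_distrib) auto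
  moreover have "multiplicity p (p*b^2) = 1 + 2 * multiplicity p b"
    using assms eq(2) by (subst prime_elem_multiplicity_mult_distrib)
      (auto simp: prime_elem_multiplicity_power_distrib)
  ultimately have "2 * multiplicity p a = 1 + 2 * multiplicity p b" using eq(1) by simp
  moreover have "2*A \<noteq> 1 + 2*B" for A B :: nat by presburger
  ultimately show False by blast
qed

section \<open>Counting representations of a prime\<close>

text \<open>Completing the square: n = x^2 + x y + 8 y^2 means 4 n = a^2 + 31 b^2 with a = 2 x + y
  and b = y, so the pairs correspond to the representations of n by the principal form.\<close>

definition principal_reps :: "nat \<Rightarrow> (int \<times> int) set" where
  "principal_reps n = {(a, b). (even a \<longleftrightarrow> even b) \<and> a^2 + 31*b^2 = 4 * int n}"

text \<open>For n = 2 x^2 + x y + 4 y^2 one has 8 n = a^2 + 31 b^2 with a = 4 x + y and b = y, that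
  is, a = b modulo 4. Of two odd pairs (a, b) and (a, -b) exactly one satisfies this, so
  \<open>odd_reps\<close> counts each such representation twice and \<open>even_reps\<close> counts
  the others once. Hence the combination \<open>card (odd_reps n) + 2 * card (even_reps n)\<close>
  below.\<close>

definition odd_reps :: "nat \<Rightarrow> (int \<times> int) set" where
  "odd_reps n = {(a, b). odd a \<and> odd b \<and> a^2 + 31*b^2 = 8 * int n}"

definition even_reps :: "nat \<Rightarrow> (int \<times> int) set" where
  "even_reps n = {(a, b). even a \<and> even b \<and> 4 dvd a - b \<and> a^2 + 31*b^2 = 8 * int n}"

lemma sign_choices_card:
  fixes a b :: int
  assumes "a \<noteq> 0" "b \<noteq> 0"
  shows "card {(c, d). (c = a \<or> c = -a) \<and> (d = b \<or> d = -b)} = 4"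
proof -
  have "{(c, d). (c = a \<or> c = -a) \<and> (d = b \<or> d = -b)} = {a, -a} \<times> {b, -b}" by auto
  thus ?thesis using assms by (simp add: card_cartesian_product)
qed

text \<open>Modulo 31, 4^2 * 2 = 32 = 1, so multiplying a by 4^j cancels the factor 2^j and exhibits
  p as a square.\<close>

lemma rep_imp_QuadRes:
  fixes p :: nat and a b :: int
  assumes "prime p" "p \<noteq> 31" "a^2 + 31*b^2 = 2^j * int p"
  shows "Legendre (int p) 31 = 1"
proof -
  have "[(4^j * a)^2 = int p] (mod 31)"
  proof -
    have "(4^j * a)^2 = 16^j * a^2" by (simp add: power_mult_distrib power2_eq_square flip: power_mult_distrib)
    also have "a^2 = 2^j * int p - 31 * b^2" using assms(3) by simp
    also have "16^j * (2^j * int p - 31 * b^2) = 32^j * int p - 31 * (16^j * b^2)"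
      by (simp add: algebra_simps flip: power_mult_distrib)
    also have "[32^j * int p - 31 * (16^j * b^2) = 1^j * int p - 0] (mod 31)"
      by (intro cong_diff cong_mult cong_pow cong_refl) (auto simp: cong_def)
    finally show ?thesis by simp
  qed
  hence "QuadRes 31 (int p)" unfolding QuadRes_def by blast
  moreover have "\<not> [int p = 0] (mod 31)"
  proof
    assume "[int p = 0] (mod 31)"
    hence "31 dvd p" by (metis cong_0_iff int_dvd_int_iff of_nat_numeral)
    thus False using assms(1) assms(2)[symmetric] primes_dvd_imp_eq[of 31 p] by simp
  qed
  ultimately show ?thesis by (simp add: Legendre_def)
qed

lemma reps_nonresidue:
  assumes "prime p" "p \<noteq> 31" "Legendre (int p) 31 = -1"
  shows "principal_reps p = {}" "odd_reps p = {}" "even_reps p = {}"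
  using rep_imp_QuadRes[of p _ _ 2] rep_imp_QuadRes[of p _ _ 3] assms
  by (auto simp: principal_reps_def odd_reps_def even_reps_def)

lemma reps_principal:
  fixes u v :: int and p :: nat
  assumes "prime p" "p \<noteq> 31" "u \<noteq> 0" "int p = u^2 + 31 * v^2"
  shows "card (principal_reps p) = 4" "odd_reps p = {}" "even_reps p = {}"
proof -
  have pp: "prime (int p)" using assms(1) by simp
  have v0: "v \<noteq> 0"
  proof
    assume "v = 0"
    hence "int p = u^2" using assms by simp
    thus False using not_square_times_prime[OF pp, of u 1] by simp
  qed
  have eq1: "u^2 + 31 * v^2 = 1 * int p" using assms by simp
  \<comment> \<open>Proportionality to the representation by (u, v) would give a^2 = 2 (2 u)^2,
    against the irrationality of sqrt 2.\<close>
  have 8: False if "a^2 + 31*b^2 = 8 * int p" for a b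
  proof -
    have "8*u^2 = 1*a^2" using representations_proportional[OF pp eq1 that] by simp
    hence "a^2 = 2 * (2*u)^2" by simp
    thus False using not_square_times_prime[of 2 a "2*u"] assms(3) by simp
  qed
  show "odd_reps p = {}" "even_reps p = {}" using 8 by (auto simp: odd_reps_def even_reps_def)
  have "principal_reps p = {(c, d). (c = 2*u \<or> c = -(2*u)) \<and> (d = 2 * v \<or> d = -(2 * v))}" (is "_ = ?R")
  proof (intro Set.set_eqI iffI)
    fix x assume "x \<in> principal_reps p"
    then obtain c d where x: "x = (c, d)" "c^2 + 31*d^2 = 4 * int p" by (auto simp: principal_reps_def)
    have "4*u^2 = 1*c^2" "4 * v^2 = 1*d^2" using representations_proportional[OF pp eq1 x(2)] by simp_all
    hence "c^2 = (2*u)^2" "d^2 = (2 * v)^2" by simp_all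
    thus "x \<in> ?R" unfolding x power2_eq_iff by simp
  next
    fix x assume "x \<in> ?R"
    thus "x \<in> principal_reps p" using assms(4) by (auto simp: principal_reps_def power_mult_distrib)
  qed
  thus "card (principal_reps p) = 4" using sign_choices_card[of "2*u" "2 * v"] assms(3) v0 by simp
qed

text \<open>A 2-adic argument: odd a and b make 8 divide k p, and even a and b make 4 divide it,
  while p is odd.\<close>

lemma same_parity_representation:
  fixes a b :: int
  assumes "prime p" "p \<noteq> 2" "odd a \<longleftrightarrow> odd b" "a^2 + 31*b^2 = k * int p" "k = 2 \<or> k = 4"
  shows "k = 4 \<and> even a \<and> even b"
proof -
  have oddp: "odd p" using assms prime_odd_nat by (metis prime_nat_iff two_is_prime_nat primes_dvd_imp_eq)
  have "even a" 
  proof (rule ccontr)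
    assume "odd a"
    hence "8 dvd k * int p" using odd_odd_dvd_8[of a b] assms by simp
    hence "8 dvd 2 * int p \<or> 8 dvd 4 * int p" using assms(5) by auto
    thus False using oddp by (elim disjE; presburger)
  qed
  moreover have "k \<noteq> 2"
  proof
    assume k: "k = 2"
    obtain s where "a = 2 * s" using \<open>even a\<close> by (rule evenE)
    moreover obtain t where "b = 2 * t" using \<open>even a\<close> assms(3) by (meson evenE)
    ultimately have "int p = 2*(s^2 + 31 * t^2)" using assms(4) k by (simp add: power_mult_distrib)
    hence "even (int p)" by simp
    thus False using oddp by simp
  qed
  ultimately show ?thesis using assms by auto
qed

lemma reps_nonprincipal:
  assumes "prime p" "p \<noteq> 31" "Legendre (int p) 31 = 1" 
    and no: "\<not> (\<exists>u v :: int. u \<noteq> 0 \<and> int p = u^2 + 31 * v^2)"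
  shows "principal_reps p = {}" "card (odd_reps p) + 2 * card (even_reps p) = 4"
proof -
  have pp: "prime (int p)" using assms(1) by simp
  have no': "int p \<noteq> u^2 + 31 * v^2" for u v
  proof
    assume *: "int p = u^2 + 31 * v^2"
    with no have "u = 0" by blast
    hence "31 dvd int p" using * by simp
    hence "31 dvd p" by (metis int_dvd_int_iff of_nat_numeral)
    thus False using assms(1) assms(2)[symmetric] primes_dvd_imp_eq[of 31 p] by simp
  qed
  have "principal_reps p = {} \<and> card (odd_reps p) + 2 * card (even_reps p) = 4"
  \<comment> \<open>The parity arguments need odd p. For p = 2 the only solutions are (4, 0) and
    (-4, 0), two even pairs of weight 2; for odd p there are four odd pairs of weight 1.\<close>
  proof (cases "p = 2")
    case True
    have b0: "b = 0" if "a^2 + 31*b^2 \<le> 16" for a b :: int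
    proof (rule ccontr)
      assume "b \<noteq> 0"
      hence "b^2 \<ge> 1" by (metis int_one_le_iff_zero_less zero_less_power2)
      thus False using that zero_le_power2[of a] by linarith
    qed
    have ev: "even_reps p = {(4, 0), (-4, 0)}"
    proof -
      have "b = 0 \<and> (a = 4 \<or> a = -4)" if "a^2 + 31*b^2 = 16" for a b :: int
        using that b0[of a b] power2_eq_iff[of a 4] by simp
      thus ?thesis using True by (auto simp: even_reps_def)
    qed
    have od: "odd_reps p = {}"
    proof -
      have False if "odd b" "a^2 + 31*b^2 = 16" for a b :: int
        using that b0[of a b] by simp
      thus ?thesis using True unfolding odd_reps_def by auto
    qed
    have pr: "principal_reps p = {}"
    proof -
      have False if "a^2 + 31*b^2 = 8" for a b :: int
        using that b0[of a b] not_square_times_prime[of 2 a 2] by simp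
      thus ?thesis using True unfolding principal_reps_def by auto
    qed
    show ?thesis by (simp add: ev od pr)
  next
    case False
    have pr: "principal_reps p = {}"
    proof (rule ccontr)
      assume "principal_reps p \<noteq> {}"
      then obtain a b where ab: "odd a \<longleftrightarrow> odd b" "a^2 + 31*b^2 = 4 * int p" by (auto simp: principal_reps_def)
      have "even a" "even b" using same_parity_representation[OF assms(1) False ab] by simp_all
      then obtain s t where "a = 2 * s" "b = 2 * t" by (meson evenE)
      thus False using ab(2) no'[of s t] by (simp add: power_mult_distrib)
    qed
    obtain a b where ab: "a^2 + 31*b^2 = 8 * int p"
    proof -
      obtain x y where "int p = x^2 + x*y + 8*y^2 \<or> int p = 2*x^2 + x*y + 4*y^2"
        using prime_represented_disc_31[OF assms(1) False assms(3)] by blast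
      thus ?thesis
      proof
        assume "int p = x^2 + x*y + 8*y^2"
        hence "(2*x + y)^2 + 31*y^2 = 4 * int p" by (simp add: power2_eq_square algebra_simps)
        hence "(2*x + y, y) \<in> principal_reps p" by (simp add: principal_reps_def)
        thus ?thesis using pr by simp
      next
        assume "int p = 2*x^2 + x*y + 4*y^2"
        hence "(4*x + y)^2 + 31*y^2 = 8 * int p" by (simp add: power2_eq_square algebra_simps)
        thus ?thesis by (rule that)
      qed
    qed
    have par: "odd c \<and> odd d" if cd: "c^2 + 31*d^2 = 8 * int p" for c d
    proof -
      have "even (c^2 + 31*d^2)" unfolding cd by simp
      hence eo: "odd c \<longleftrightarrow> odd d" by simp
      have False if "even c"
      proof -
        obtain s t where st: "c = 2 * s" "d = 2 * t" using \<open>even c\<close> eo by (meson evenE)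
        hence st2: "s^2 + 31 * t^2 = 2 * int p" using cd by (simp add: power_mult_distrib)
        hence "even (s^2 + 31 * t^2)" by simp
        hence "odd s \<longleftrightarrow> odd t" by simp
        from same_parity_representation[OF assms(1) False this st2] show False by simp
      qed
      thus ?thesis using eo by blast
    qed
    have ev: "even_reps p = {}" using par by (force simp: even_reps_def)
    have od: "odd_reps p = {(c, d). (c = a \<or> c = -a) \<and> (d = b \<or> d = -b)}" (is "_ = ?R")
    proof (intro Set.set_eqI iffI)
      fix x assume "x \<in> odd_reps p"
      then obtain c d where x: "x = (c, d)" "c^2 + 31*d^2 = 8 * int p" by (auto simp: odd_reps_def)
      have "c^2 = a^2" "d^2 = b^2" using representations_proportional[OF pp ab x(2)] by simp_all
      thus "x \<in> ?R" unfolding x power2_eq_iff by simp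
    next
      fix x assume "x \<in> ?R"
      thus "x \<in> odd_reps p" using ab par[OF ab] by (auto simp: odd_reps_def)
    qed
    have "a \<noteq> 0" "b \<noteq> 0" using par[OF ab] by auto
    hence "card (odd_reps p) = 4" unfolding od by (rule sign_choices_card)
    thus ?thesis using pr ev by simp
  qed
  thus "principal_reps p = {}" "card (odd_reps p) + 2 * card (even_reps p) = 4" by auto
qed

section \<open>Theta series modulo 31\<close>

lemma fps_nth_compose_X_pow:
  fixes f :: "'a::idom fps"
  assumes "k > 0"
  shows "(f oo fps_X ^ k) $ n = (if k dvd n then f $ (n div k) else 0)"
proof -
  have "(f oo fps_X ^ k) $ n = (\<Sum>i=0..n. if n = k * i then f $ i else 0)"
    unfolding fps_compose_nth power_mult[symmetric] by (intro sum.cong) auto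
  also have "\<dots> = (\<Sum>i=0..n. if i = n div k \<and> k dvd n then f $ i else 0)"
    using assms by (intro sum.cong) auto
  also have "\<dots> = (if k dvd n then f $ (n div k) else 0)"
    using assms by (cases "k dvd n") (auto simp: sum.delta)
  finally show ?thesis .
qed

definition fps_cong :: "int \<Rightarrow> int fps \<Rightarrow> int fps \<Rightarrow> bool" where
  "fps_cong m f g \<longleftrightarrow> (\<forall>n. [f $ n = g $ n] (mod m))"

lemma fps_cong_refl [simp]: "fps_cong m f f"
  by (simp add: fps_cong_def)

lemma fps_cong_trans [trans]: "fps_cong m f g \<Longrightarrow> fps_cong m g h \<Longrightarrow> fps_cong m f h"
  unfolding fps_cong_def by (blast intro: cong_trans)

lemma fps_cong_add: "fps_cong m f g \<Longrightarrow> fps_cong m f' g' \<Longrightarrow> fps_cong m (f + f') (g + g')"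
  by (simp add: fps_cong_def cong_add)

lemma fps_cong_diff: "fps_cong m f g \<Longrightarrow> fps_cong m f' g' \<Longrightarrow> fps_cong m (f - f') (g - g')"
  by (simp add: fps_cong_def cong_diff)

lemma fps_cong_mult: "fps_cong m f g \<Longrightarrow> fps_cong m f' g' \<Longrightarrow> fps_cong m (f * f') (g * g')"
  by (simp add: fps_cong_def fps_mult_nth cong_sum cong_mult)

lemma fps_cong_const_mult: "fps_cong m (f + fps_const m * g) f"
  by (simp add: fps_cong_def cong_def)

lemma fps_cong_freshman:
  fixes f g :: "int fps"
  assumes "prime p"
  shows "fps_cong (int p) ((f + g) ^ p) (f ^ p + g ^ p)"
proof -
  have p0: "p > 0" using assms prime_gt_0_nat by blast
  have "(f + g) ^ p = (\<Sum>k\<le>p. of_nat (p choose k) * f ^ k * g ^ (p - k))"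
    by (rule binomial_ring)
  also have "{..p} = insert 0 (insert p {1..<p})" using p0 by auto
  also have "(\<Sum>k\<in>insert 0 (insert p {1..<p}). of_nat (p choose k) * f ^ k * g ^ (p - k)) =
      f ^ p + g ^ p + (\<Sum>k\<in>{1..<p}. of_nat (p choose k) * f ^ k * g ^ (p - k))"
    using p0 by (simp add: algebra_simps)
  also have "(\<Sum>k\<in>{1..<p}. of_nat (p choose k) * f ^ k * g ^ (p - k)) =
      fps_const (int p) * (\<Sum>k\<in>{1..<p}. of_nat ((p choose k) div p) * f ^ k * g ^ (p - k))"
    unfolding sum_distrib_left
  proof (intro sum.cong refl)
    fix k assume k: "k \<in> {1..<p}"
    hence "p dvd (p choose k)" using assms by (intro dvd_choose_prime) auto
    then obtain c where c: "p choose k = p * c" by (elim dvdE)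
    have "of_nat (p choose k) = fps_const (int p) * (of_nat ((p choose k) div p) :: int fps)"
      using p0 unfolding c by (simp add: fps_of_nat[symmetric])
    thus "of_nat (p choose k) * f ^ k * g ^ (p - k) =
        fps_const (int p) * (of_nat ((p choose k) div p) * f ^ k * g ^ (p - k))"
      by (simp add: mult.assoc)
  qed
  finally show ?thesis by (simp only: fps_cong_const_mult)
qed

lemma int_power_prime_cong:
  fixes c :: int
  assumes "prime p"
  shows "[c ^ p = c] (mod int p)"
proof -
  have p0: "p > 0" using assms prime_gt_0_nat by blast
  define n where "n = nat (c mod int p)"
  have cn: "[c = int n] (mod int p)" using p0 by (simp add: n_def cong_def)
  have "[n ^ p = n] (mod p)"
  proof (cases "p dvd n")
    case True
    moreover have "n dvd n ^ p" using p0 by (intro dvd_power) auto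
    ultimately have "p dvd n ^ p" by (metis dvd_trans)
    thus ?thesis using True by (simp add: cong_def)
  next
    case False
    have "[n ^ (p - 1) * n = 1 * n] (mod p)"
      by (intro cong_mult fermat_theorem assms False cong_refl)
    thus ?thesis using power_minus_mult[OF p0, of n] by simp
  qed
  hence "[int n ^ p = int n] (mod int p)"
    by (metis cong_int_iff of_nat_power)
  thus ?thesis using cn by (meson cong_pow cong_sym cong_trans)
qed

text \<open>Induction on the number of terms settles polynomials, by
  \<open>fps_cong_freshman\<close> and Fermat's theorem for the coefficients. For a series,
  coefficient n of f^p depends only on the truncation after X^n: the tail contributes a p-th power
  of a multiple of X^(n+1).\<close>

lemma fps_cong_frobenius:
  fixes f :: "int fps"
  assumes "prime p"
  shows "fps_cong (int p) (f ^ p) (f oo fps_X ^ p)"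
proof -
  have p0: "p > 0" using assms prime_gt_0_nat by blast
  have trunc: "fps_cong (int p) ((\<Sum>i<N. fps_const (f $ i) * fps_X ^ i) ^ p)
      (\<Sum>i<N. fps_const (f $ i) * fps_X ^ (p * i))" for N
  proof (induction N)
    case 0
    show ?case using p0 by (simp add: zero_power)
  next
    case (Suc N)
    have "fps_cong (int p) ((fps_const (f $ N) * fps_X ^ N) ^ p) (fps_const (f $ N) * fps_X ^ (p * N))"
      using int_power_prime_cong[OF assms, of "f $ N"]
      by (auto simp: fps_cong_def power_mult_distrib fps_const_power power_mult[symmetric] mult.commute)
    from fps_cong_trans [OF fps_cong_freshman[OF assms] fps_cong_add[OF Suc.IH this]]
    show ?case by simp
  qed
  show ?thesis unfolding fps_cong_def
  proof
    fix n
    define g where "g = (\<Sum>i<Suc n. fps_const (f $ i) * fps_X ^ i)"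
    define h where "h = fps_shift (Suc n) f"
    have g_nth: "g $ i = (if i \<le> n then f $ i else 0)" for i
    proof -
      have "g $ i = (\<Sum>j<Suc n. if j = i then f $ j else 0)"
        unfolding g_def fps_sum_nth by (intro sum.cong) auto
      thus ?thesis by (simp add: sum.delta less_Suc_eq_le del: sum.lessThan_Suc)
    qed
    have f_eq: "f = g + fps_X ^ Suc n * h"
    proof (rule fps_ext)
      fix i
      have "(fps_X ^ Suc n * h) $ i = (if i < Suc n then 0 else h $ (i - Suc n))"
        by (rule fps_X_power_mult_nth)
      thus "f $ i = (g + fps_X ^ Suc n * h) $ i"
        by (simp add: g_nth h_def less_Suc_eq_le del: power_Suc)
    qed
    have "fps_cong (int p) (f ^ p) (g ^ p + (fps_X ^ Suc n * h) ^ p)"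
      using fps_cong_freshman[OF assms, of g "fps_X ^ Suc n * h"] f_eq by simp
    moreover have "((fps_X ^ Suc n * h) ^ p) $ n = 0"
    proof -
      have "(fps_X ^ Suc n * h) ^ p = fps_X ^ (Suc n * p) * h ^ p"
        by (simp only: power_mult_distrib power_mult)
      moreover have "n < Suc n * p" using p0 by (metis le_add1 less_Suc_eq_le mult.commute mult_le_mono2 mult.right_neutral One_nat_def Suc_leI less_le_trans lessI)
      ultimately show ?thesis by (simp add: fps_X_power_mult_nth)
    qed
    ultimately have "[(f ^ p) $ n = (g ^ p) $ n] (mod int p)"
      unfolding fps_cong_def by (metis add.right_neutral fps_add_nth)
    also have "[(g ^ p) $ n = (\<Sum>i<Suc n. fps_const (f $ i) * fps_X ^ (p * i)) $ n] (mod int p)"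
      using trunc[of "Suc n"] unfolding g_def fps_cong_def by blast
    also have "(\<Sum>i<Suc n. fps_const (f $ i) * fps_X ^ (p * i)) $ n =
        (\<Sum>i<Suc n. if i = n div p \<and> p dvd n then f $ i else 0)"
      unfolding fps_sum_nth using p0 by (intro sum.cong) auto
    also have "\<dots> = (f oo fps_X ^ p) $ n"
      using p0 by (cases "p dvd n")
        (auto simp: fps_nth_compose_X_pow sum.delta less_Suc_eq_le simp del: sum.lessThan_Suc)
    finally show "[(f ^ p) $ n = (f oo fps_X ^ p) $ n] (mod int p)" .
  qed
qed

section \<open>Theta series with residue conditions and their duplication formulas\<close>

text \<open>Read in the variable X = q^(1/8). Then \<open>theta_fps evens 2\<close> is x and
  \<open>theta_fps odds 2\<close> is y, as 2 (2n)^2 / 8 = n^2 and 2 (2n+1)^2 / 8 = (n+1/2)^2, and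
  \<open>theta_fps odds 1\<close>, \<open>theta_fps evens0 1\<close>,
  \<open>theta_fps evens2 1\<close> are y at z/2, x at 2z and y at 2z.\<close>

definition theta_fps :: "int set \<Rightarrow> nat \<Rightarrow> int fps" where
  "theta_fps A c = Abs_fps (\<lambda>n. int (card {a\<in>A. int c * a^2 = int n}))"

lemma abs_le_square_int: "\<bar>a\<bar> \<le> (a::int)^2"
proof -
  have "a = 0 \<or> 1 \<le> \<bar>a\<bar>" by linarith
  hence "\<bar>a\<bar> * 1 \<le> \<bar>a\<bar> * \<bar>a\<bar>" by (metis abs_ge_zero mult_left_mono abs_zero mult_zero_left order_refl)
  thus ?thesis by (simp add: power2_eq_square)
qed

lemma finite_square_eq:
  assumes "c > 0"
  shows "finite {a :: int. int c * a^2 = int n}"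
proof (rule finite_subset)
  show "{a :: int. int c * a^2 = int n} \<subseteq> {-int n..int n}"
  proof
    fix a :: int assume "a \<in> {a. int c * a^2 = int n}"
    hence eq: "int c * a^2 = int n" by simp
    have "\<bar>a\<bar> \<le> a^2" by (rule abs_le_square_int)
    also have "a^2 \<le> int c * a^2" using assms mult_right_mono[of 1 "int c" "a^2"] by simp
    finally show "a \<in> {-int n..int n}" using eq by auto
  qed
qed simp

lemma theta_fps_mult_nth:
  assumes "c > 0" "d > 0"
  shows "(theta_fps A c * theta_fps B d) $ n =
    int (card {(a, b). a \<in> A \<and> b \<in> B \<and> int c * a^2 + int d * b^2 = int n})"
proof -
  define S where "S = (\<lambda>A c i. {a\<in>A. int c * a^2 = int i})"
  have fin: "finite (S A' c' i)" if "c' > 0" for A' c' i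
    by (rule finite_subset[OF _ finite_square_eq[OF that, of i]]) (auto simp: S_def)
  have "(theta_fps A c * theta_fps B d) $ n = (\<Sum>i=0..n. int (card (S A c i \<times> S B d (n - i))))"
    by (simp add: theta_fps_def fps_mult_nth S_def card_cartesian_product)
  also have "\<dots> = int (card (\<Union>i\<in>{0..n}. S A c i \<times> S B d (n - i)))"
    using assms by (subst card_UN_disjoint) (auto simp: fin, auto simp: S_def)
  also have "(\<Union>i\<in>{0..n}. S A c i \<times> S B d (n - i)) =
      {(a, b). a \<in> A \<and> b \<in> B \<and> int c * a^2 + int d * b^2 = int n}"
  proof (intro Set.set_eqI iffI)
    fix x assume "x \<in> {(a, b). a \<in> A \<and> b \<in> B \<and> int c * a^2 + int d * b^2 = int n}"
    then obtain a b where x: "x = (a, b)" "a \<in> A" "b \<in> B" "int c * a^2 + int d * b^2 = int n" by auto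
    define i where "i = nat (int c * a^2)"
    have i: "int i = int c * a^2" by (simp add: i_def)
    have "0 \<le> int d * b^2" by simp
    hence "int i \<le> int n" using x(4) i by linarith
    hence "i \<le> n" by simp
    moreover have "x \<in> S A c i \<times> S B d (n - i)" using x i \<open>i \<le> n\<close> by (auto simp: S_def of_nat_diff)
    ultimately show "x \<in> (\<Union>i\<in>{0..n}. S A c i \<times> S B d (n - i))" by auto
  qed (auto simp: S_def of_nat_diff)
  finally show ?thesis .
qed

lemma theta_fps_compose:
  assumes "k > 0"
  shows "theta_fps A c oo fps_X ^ k = theta_fps A (k * c)"
proof (rule fps_ext)
  fix n
  have *: "int (k * c) * a^2 = int n \<longleftrightarrow> k dvd n \<and> int c * a^2 = int (n div k)" for a :: int
  proof
    assume eq: "int (k * c) * a^2 = int n"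
    hence "int k * (int c * a^2) = int n" by (simp add: mult.assoc)
    hence "int k dvd int n" by (metis dvd_triv_left)
    hence "k dvd n" by simp
    then obtain m where "n = k * m" by (elim dvdE)
    thus "k dvd n \<and> int c * a^2 = int (n div k)" using eq assms by simp
  qed (use assms in \<open>auto simp: mult.assoc\<close>)
  show "(theta_fps A c oo fps_X ^ k) $ n = theta_fps A (k * c) $ n"
    unfolding fps_nth_compose_X_pow[OF assms] theta_fps_def fps_nth_Abs_fps * by simp
qed

abbreviation "evens \<equiv> {a::int. even a}"
abbreviation "odds \<equiv> {a::int. odd a}"
abbreviation "evens0 \<equiv> {a::int. 4 dvd a}"
abbreviation "evens2 \<equiv> {a::int. even a \<and> \<not> 4 dvd a}"

lemma finite_pairs:
  assumes "c > 0" "d > 0"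
  shows "finite {(a, b :: int). P a b \<and> int c * a^2 + int d * b^2 = int n}"
proof (rule finite_subset)
  have bound: "\<bar>a\<bar> \<le> int n" if "c > 0" "int c * a^2 + int d * b^2 = int n" for a b :: int and c d :: nat
  proof -
    have "\<bar>a\<bar> \<le> a^2" by (rule abs_le_square_int)
    also have "a^2 \<le> int c * a^2" using that mult_right_mono[of 1 "int c" "a^2"] by simp
    also have "0 \<le> int d * b^2" by simp
    hence "int c * a^2 \<le> int n" using that(2) by linarith
    finally show ?thesis .
  qed
  have "a \<in> {-int n..int n} \<and> b \<in> {-int n..int n}" if "int c * a^2 + int d * b^2 = int n" for a b :: int
  proof -
    have "\<bar>a\<bar> \<le> int n" "\<bar>b\<bar> \<le> int n"
      using bound[OF assms(1) that] bound[of d b c a] assms(2) that by (simp_all add: add.commute)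
    thus ?thesis by auto
  qed
  thus "{(a, b :: int). P a b \<and> int c * a^2 + int d * b^2 = int n} \<subseteq> {-int n..int n} \<times> {-int n..int n}"
    by blast
qed simp

lemma theta_fps_mult_add_nth:
  assumes "c > 0" "d > 0" "A \<inter> A' = {} \<or> B \<inter> B' = {}"
  shows "(theta_fps A c * theta_fps B d) $ n + (theta_fps A' c * theta_fps B' d) $ n =
    int (card {(a, b). (a \<in> A \<and> b \<in> B \<or> a \<in> A' \<and> b \<in> B') \<and> int c * a^2 + int d * b^2 = int n})"
proof -
  let ?S = "{(a, b). (a \<in> A \<and> b \<in> B) \<and> int c * a^2 + int d * b^2 = int n}"
  let ?S' = "{(a, b). (a \<in> A' \<and> b \<in> B') \<and> int c * a^2 + int d * b^2 = int n}"
  have "{(a, b). (a \<in> A \<and> b \<in> B \<or> a \<in> A' \<and> b \<in> B') \<and> int c * a^2 + int d * b^2 = int n} = ?S \<union> ?S'"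
    by auto
  moreover have "card (?S \<union> ?S') = card ?S + card ?S'"
    by (rule card_Un_disjoint[OF finite_pairs[OF assms(1,2)] finite_pairs[OF assms(1,2)]]) (use assms(3) in auto)
  ultimately show ?thesis
    by (simp add: theta_fps_mult_nth[OF assms(1,2)] conj_assoc)
qed

text \<open>The map (u, v) -> (u + v, u - v) doubles u^2 + v^2 and is a bijection onto the pairs
  with even sum. Each duplication formula below is an instance with its own residue
  conditions.\<close>

lemma card_sum_two_squares_double:
  assumes "\<And>a b. P a b \<Longrightarrow> even (a + b)"
    and "\<And>u v :: int. P (u + v) (u - v) \<longleftrightarrow> Q u v"
  shows "card {(a, b). P a b \<and> int 1 * a^2 + int 1 * b^2 = int n} =
    card {(u, v). Q u v \<and> int 2 * u^2 + int 2 * v^2 = int n}" (is "card ?A = card ?B")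
proof -
  have norm: "2 * u^2 + 2 * v^2 = (u + v)^2 + (u - v)^2" for u v :: int
    by (simp add: power2_eq_square algebra_simps)
  have "?A = (\<lambda>(u, v). (u + v, u - v)) ` ?B"
  proof (intro equalityI subsetI)
    fix x assume x: "x \<in> ?A"
    then obtain a b where ab: "x = (a, b)" "P a b" "a^2 + b^2 = int n" by auto
    from assms(1)[OF ab(2)] obtain k where "a + b = 2 * k" by (elim evenE)
    hence eq: "a = k + (k - b)" "b = k - (k - b)" by simp_all
    have "(k, k - b) \<in> ?B"
      using ab assms(2)[of k "k - b"] norm[of k "k - b"] eq by simp
    thus "x \<in> (\<lambda>(u, v). (u + v, u - v)) ` ?B"
      using ab(1) eq by (intro image_eqI[of _ _ "(k, k - b)"]) simp_all
  qed (auto simp: assms(2) norm)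
  moreover have "inj_on (\<lambda>(u, v). (u + v, u - v)) ?B" by (auto simp: inj_on_def)
  ultimately show ?thesis by (simp add: card_image)
qed

text \<open>Of the half-sum and the half-difference of two odd integers one is even and the other
  odd. In effect x y is half the square of a theta series.\<close>

lemma theta_odd_square: "theta_fps odds 1 ^ 2 = 2 * theta_fps evens 2 * theta_fps odds 2"
proof (rule fps_ext)
  fix n
  have "(theta_fps odds 1 ^ 2) $ n =
      int (card {(a, b). (a \<in> odds \<and> b \<in> odds) \<and> int 1 * a^2 + int 1 * b^2 = int n})"
    unfolding power2_eq_square[of "theta_fps odds 1"] by (subst theta_fps_mult_nth) (auto simp: conj_assoc)
  also have "card {(a, b). (a \<in> odds \<and> b \<in> odds) \<and> int 1 * a^2 + int 1 * b^2 = int n} =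
      card {(u, v). (u \<in> evens \<and> v \<in> odds \<or> u \<in> odds \<and> v \<in> evens) \<and> int 2 * u^2 + int 2 * v^2 = int n}"
    by (rule card_sum_two_squares_double) auto
  also have "int \<dots> = (theta_fps evens 2 * theta_fps odds 2) $ n + (theta_fps odds 2 * theta_fps evens 2) $ n"
    by (rule theta_fps_mult_add_nth[symmetric]) auto
  also have "\<dots> = (2 * theta_fps evens 2 * theta_fps odds 2) $ n"
    unfolding fps_add_nth[symmetric] by (rule arg_cong[of _ _ "\<lambda>f. f $ n"]) (simp only: mult_2 ring_distribs mult.commute)
  finally show "(theta_fps odds 1 ^ 2) $ n = (2 * theta_fps evens 2 * theta_fps odds 2) $ n" .
qed

text \<open>Combined with \<open>theta_even_product\<close>, this makes x^2 + y^2 and x^2 - y^2 the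
  squares of the sum and the difference of \<open>theta_fps evens0 1\<close> and
  \<open>theta_fps evens2 1\<close>.\<close>

lemma theta_even_square_sum:
  "theta_fps evens0 1 ^ 2 + theta_fps evens2 1 ^ 2 = theta_fps evens 2 ^ 2"
proof (rule fps_ext)
  fix n
  have "(theta_fps evens0 1 ^ 2 + theta_fps evens2 1 ^ 2) $ n =
      (theta_fps evens0 1 * theta_fps evens0 1) $ n + (theta_fps evens2 1 * theta_fps evens2 1) $ n"
    by (simp add: power2_eq_square)
  also have "\<dots> = int (card {(a, b). (a \<in> evens0 \<and> b \<in> evens0 \<or> a \<in> evens2 \<and> b \<in> evens2) \<and>
      int 1 * a^2 + int 1 * b^2 = int n})"
    by (rule theta_fps_mult_add_nth) auto
  also have "card {(a, b). (a \<in> evens0 \<and> b \<in> evens0 \<or> a \<in> evens2 \<and> b \<in> evens2) \<and> int 1 * a^2 + int 1 * b^2 = int n} =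
      card {(u, v). (u \<in> evens \<and> v \<in> evens) \<and> int 2 * u^2 + int 2 * v^2 = int n}"
    by (rule card_sum_two_squares_double; simp; presburger)
  also have "int \<dots> = (theta_fps evens 2 ^ 2) $ n"
    unfolding power2_eq_square[of "theta_fps evens 2"] by (subst theta_fps_mult_nth) (auto simp: conj_assoc)
  finally show "(theta_fps evens0 1 ^ 2 + theta_fps evens2 1 ^ 2) $ n = (theta_fps evens 2 ^ 2) $ n" .
qed

lemma theta_even_product:
  "2 * theta_fps evens0 1 * theta_fps evens2 1 = theta_fps odds 2 ^ 2"
proof (rule fps_ext)
  fix n
  have "(2 * theta_fps evens0 1 * theta_fps evens2 1) $ n =
      (theta_fps evens0 1 * theta_fps evens2 1) $ n + (theta_fps evens2 1 * theta_fps evens0 1) $ n"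
    unfolding fps_add_nth[symmetric] by (rule arg_cong[of _ _ "\<lambda>f. f $ n"]) (simp only: mult_2 ring_distribs mult.commute)
  also have "\<dots> = int (card {(a, b). (a \<in> evens0 \<and> b \<in> evens2 \<or> a \<in> evens2 \<and> b \<in> evens0) \<and>
      int 1 * a^2 + int 1 * b^2 = int n})"
    by (rule theta_fps_mult_add_nth) auto
  also have "card {(a, b). (a \<in> evens0 \<and> b \<in> evens2 \<or> a \<in> evens2 \<and> b \<in> evens0) \<and> int 1 * a^2 + int 1 * b^2 = int n} =
      card {(u, v). (u \<in> odds \<and> v \<in> odds) \<and> int 2 * u^2 + int 2 * v^2 = int n}"
    by (rule card_sum_two_squares_double; simp; presburger)
  also have "int \<dots> = (theta_fps odds 2 ^ 2) $ n"
    unfolding power2_eq_square[of "theta_fps odds 2"] by (subst theta_fps_mult_nth) (auto simp: conj_assoc)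
  finally show "(2 * theta_fps evens0 1 * theta_fps evens2 1) $ n = (theta_fps odds 2 ^ 2) $ n" .
qed

text \<open>\<open>delta16_fps\<close> is \<open>(s\<^sup>2 + 14 s t + t\<^sup>2) s t (s - t)\<^sup>4 / 16\<close> for \<open>s = x\<^sup>4\<close> and
  \<open>t = y\<^sup>4 = 16 q R\<^sup>4\<close>, where \<open>x = \<Sum> q^(n\<^sup>2)\<close> and \<open>y = \<Sum> q^((n + 1/2)\<^sup>2) = 2 q^(1/4) R\<close>.\<close>

definition theta_x_fps :: "int fps" where
  "theta_x_fps = Abs_fps (\<lambda>n. int (card {a::int. a^2 = int n}))"

definition theta_y_fps :: "int fps" where
  "theta_y_fps = Abs_fps (\<lambda>n. int (card {a::nat. a^2 + a = n}))"

definition delta16_fps :: "int fps" where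
  "delta16_fps = (let s = theta_x_fps ^ 4; r = fps_X * theta_y_fps ^ 4
     in (s^2 + 224 * s * r + 256 * r^2) * s * r * (s - 16 * r) ^ 4)"

lemma theta_x_fps_compose: "theta_x_fps oo fps_X ^ 8 = theta_fps evens 2"
proof (rule fps_ext)
  fix n
  have "card {a\<in>evens. int 2 * a^2 = int n} = (if 8 dvd n then card {a::int. a^2 = int (n div 8)} else 0)"
  proof (cases "8 dvd n")
    case True
    then obtain m where n: "n = 8 * m" by (elim dvdE)
    have "{a\<in>evens. int 2 * a^2 = int n} = (\<lambda>a. 2 * a) ` {a::int. a^2 = int m}"
      unfolding n by (auto simp: power_mult_distrib elim!: evenE)
    hence "card {a\<in>evens. int 2 * a^2 = int n} = card {a::int. a^2 = int m}"
      by (simp add: card_image inj_on_def)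
    thus ?thesis by (simp add: n)
  next
    case False
    have "{a\<in>evens. int 2 * a^2 = int n} = {}"
    proof -
      have "8 dvd n" if "even a" "int 2 * a^2 = int n" for a :: int
      proof -
        from that obtain k where "a = 2 * k" by (elim evenE)
        hence "int n = 8 * k^2" using that by (simp add: power_mult_distrib)
        hence "int 8 dvd int n" by simp
        thus ?thesis by (simp only: int_dvd_int_iff)
      qed
      thus ?thesis using False by auto
    qed
    thus ?thesis using False by (simp only: card.empty if_False)
  qed
  thus "(theta_x_fps oo fps_X ^ 8) $ n = theta_fps evens 2 $ n"
    by (subst fps_nth_compose_X_pow) (auto simp: theta_x_fps_def theta_fps_def)
qed

text \<open>Every odd integer is 2k+1 or -(2k+1) for exactly one natural k, and 2 (2k+1)^2 = 8 (k^2
  + k) + 2; hence the factor 2 X^2.\<close>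

lemma theta_y_fps_compose: "2 * fps_X ^ 2 * (theta_y_fps oo fps_X ^ 8) = theta_fps odds 2"
proof (rule fps_ext)
  fix n
  have odd_form: "\<exists>k::nat. a = 2 * int k + 1 \<or> a = - (2 * int k + 1)" if "odd a" for a :: int
  proof -
    obtain k where k: "a = 2 * k + 1" using \<open>odd a\<close> by (rule oddE)
    show ?thesis
    proof (cases "k \<ge> 0")
      case True
      thus ?thesis using k by (intro exI[of _ "nat k"]) auto
    next
      case False
      thus ?thesis using k by (intro exI[of _ "nat (- k - 1)"]) auto
    qed
  qed
  define K where "K = {k::nat. 2 * (2 * int k + 1)^2 = int n}"
  have K_eq: "K = {k. 2 \<le> n \<and> 8 dvd (n - 2) \<and> k^2 + k = (n - 2) div 8}"
  proof -
    have "2 * (2 * int k + 1)^2 = int (8 * (k^2 + k) + 2)" for k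
      by (simp add: power2_eq_square algebra_simps)
    hence "2 * (2 * int k + 1)^2 = int n \<longleftrightarrow> 8 * (k^2 + k) + 2 = n" for k
      by (metis of_nat_eq_iff)
    moreover have "8 * m + 2 = n \<longleftrightarrow> 2 \<le> n \<and> 8 dvd (n - 2) \<and> m = (n - 2) div 8" for m
    proof
      assume asm: "2 \<le> n \<and> 8 dvd (n - 2) \<and> m = (n - 2) div 8"
      then obtain j where "n - 2 = 8 * j" by (elim conjE dvdE)
      moreover from this have "m = j" using asm by simp
      ultimately show "8 * m + 2 = n" using asm by linarith
    qed auto
    ultimately show ?thesis unfolding K_def by blast
  qed
  have finK: "finite K"
  proof (rule finite_subset)
    show "K \<subseteq> {..n}"
    proof
      fix k assume "k \<in> K"
      hence "k \<le> (n - 2) div 8" unfolding K_eq by (metis (mono_tags, lifting) le_add2 mem_Collect_eq)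
      thus "k \<in> {..n}" by simp
    qed
  qed simp
  have "{a\<in>odds. int 2 * a^2 = int n} = (\<lambda>k. 2 * int k + 1) ` K \<union> (\<lambda>k. - (2 * int k + 1)) ` K"
    (is "?L = ?M \<union> ?N")
  proof (intro equalityI subsetI)
    fix a assume a: "a \<in> ?L"
    then obtain k where k: "a = 2 * int k + 1 \<or> a = - (2 * int k + 1)" using odd_form[of a] by auto
    hence "a^2 = (2 * int k + 1)^2" using power2_eq_iff by blast
    hence "k \<in> K" using a by (simp add: K_def)
    thus "a \<in> ?M \<union> ?N" using k by auto
  next
    fix a assume "a \<in> ?M \<union> ?N"
    then obtain k where k: "a = 2 * int k + 1 \<or> a = - (2 * int k + 1)" "k \<in> K" by auto
    hence "a^2 = (2 * int k + 1)^2" using power2_eq_iff by blast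
    thus "a \<in> ?L" using k by (auto simp: K_def)
  qed
  moreover have "card (?M \<union> ?N) = card ?M + card ?N"
  proof (intro card_Un_disjoint)
    have "2 * int k + 1 \<noteq> - (2 * int k' + 1)" for k k' by linarith
    thus "?M \<inter> ?N = {}" by blast
  qed (use finK in auto)
  moreover have "card ?M = card K" "card ?N = card K" by (intro card_image; simp add: inj_on_def)+
  ultimately have "theta_fps odds 2 $ n = 2 * int (card K)" by (simp add: theta_fps_def)
  also have "\<dots> = (2 * fps_X ^ 2 * (theta_y_fps oo fps_X ^ 8)) $ n"
  proof -
    have "(2 * fps_X ^ 2 * (theta_y_fps oo fps_X ^ 8)) $ n = 2 * (fps_X ^ 2 * (theta_y_fps oo fps_X ^ 8)) $ n"
      by (simp add: mult.assoc numeral_fps_const)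
    also have "(fps_X ^ 2 * (theta_y_fps oo fps_X ^ 8)) $ n = int (card K)"
      by (auto simp: fps_X_power_mult_nth fps_nth_compose_X_pow theta_y_fps_def K_eq)
    finally show ?thesis by simp
  qed
  finally show "(2 * fps_X ^ 2 * (theta_y_fps oo fps_X ^ 8)) $ n = theta_fps odds 2 $ n" by simp
qed

lemma delta16_fps_compose:
  "16 * (delta16_fps oo fps_X ^ 8) =
    (let s = theta_fps evens 2 ^ 4; t = theta_fps odds 2 ^ 4
     in (s^2 + 14 * s * t + t^2) * s * t * (s - t) ^ 4)"
proof -
  have c0: "(fps_X ^ 8 :: int fps) $ 0 = 0" by simp
  define s r where "s = theta_x_fps ^ 4" and "r = fps_X * theta_y_fps ^ 4"
  have s: "s oo fps_X ^ 8 = theta_fps evens 2 ^ 4"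
    by (simp add: s_def fps_compose_power[OF c0, symmetric] theta_x_fps_compose)
  have t: "16 * (r oo fps_X ^ 8) = theta_fps odds 2 ^ 4"
    by (simp add: r_def fps_compose_power[OF c0, symmetric] theta_y_fps_compose[symmetric]
        fps_compose_mult_distrib[OF c0] power_mult_distrib fps_X_fps_compose_startby0[OF c0] power_mult[symmetric] algebra_simps)
  have num: "(numeral k :: int fps) oo fps_X ^ 8 = numeral k" for k
    by (simp add: numeral_fps_const)
  have "delta16_fps oo fps_X ^ 8 = (let s = s oo fps_X ^ 8; r = r oo fps_X ^ 8
     in (s^2 + 224 * s * r + 256 * r^2) * s * r * (s - 16 * r) ^ 4)"
    unfolding delta16_fps_def s_def[symmetric] r_def[symmetric] Let_def
    by (simp add: fps_compose_mult_distrib[OF c0] fps_compose_add_distrib fps_compose_sub_distrib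
        fps_compose_power[OF c0, symmetric] num)
  thus ?thesis unfolding Let_def s[symmetric] t[symmetric]
    by (simp add: algebra_simps power2_eq_square)
qed

section \<open>Reduction of the invariant polynomial to 32nd powers modulo 31\<close>

lemma sum_power_8:
  fixes A B :: "'a::comm_ring_1"
  shows "(A + B)^8 + (A - B)^8 = 2 * (A^8 + 28 * A^6 * B^2 + 70 * A^4 * B^4 + 28 * A^2 * B^6 + B^8)"
  by (simp add: eval_nat_numeral algebra_simps)

lemma delta16_poly_identity_aux:
  fixes s t :: "'a::comm_ring_1"
  shows "(s^2 + 14 * s * t + t^2) * s * t * (s - t)^4 =
    8 * (s^8 + t^8) - 8 * (s * t)^4
    - 8 * ((s+t)^8 + 28 * (s+t)^6 * (4 * s * t) + 70 * (s+t)^4 * (4 * s * t)^2 + 28 * (s+t)^2 * (4 * s * t)^3 + (4 * s * t)^4)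
    + 31 * (31 * s^7 * t + 470 * s^6 * t^2 + 2065 * s^5 * t^3 + 3324 * s^4 * t^4 + 2065 * s^3 * t^5 + 470 * s^2 * t^6 + 31 * s * t^7)"
  by (simp add: eval_nat_numeral algebra_simps)

text \<open>Modulo 31, both x^32 + y^32 and 2 (x y)^16 + (x^2 + y^2)^16 + (x^2 - y^2)^16 are
  multiplied by 2 = 2^16 under (x, y) -> (x + y, x - y), as the left-hand side is; for the first,
  use (x +- y)^31 = x^31 +- y^31. The weights 8 and -4 cancel x^32, and -8 * 120 = 1 - 31^2 gives
  x^28 y^4 the coefficient 1 modulo 31.\<close>

lemma delta16_poly_identity:
  fixes x y :: "'a::comm_ring_1"
  defines "s \<equiv> x^4" and "t \<equiv> y^4"
  shows "(s^2 + 14 * s * t + t^2) * s * t * (s - t)^4 =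
    8 * (x^32 + y^32) - 8 * (x*y)^16 - 4 * ((x^2 + y^2)^16 + (x^2 - y^2)^16)
    + 31 * (31 * s^7 * t + 470 * s^6 * t^2 + 2065 * s^5 * t^3 + 3324 * s^4 * t^4 + 2065 * s^3 * t^5 + 470 * s^2 * t^6 + 31 * s * t^7)"
proof -
  \<comment> \<open>Then (x^2 +- y^2)^2 = A +- B, odd powers of B cancel in the sum, and B^2 = 4 s
    t. What is left to expand has degree 8 in s and t instead of 32 in x and y.\<close>
  define A B where "A = s + t" and "B = 2 * (x * y)^2"
  have B2: "B^2 = 4 * s * t" by (simp add: B_def s_def t_def power_mult_distrib flip: power_mult)
  have "(x^2 + y^2)^16 + (x^2 - y^2)^16 = ((x^2 + y^2)^2)^8 + ((x^2 - y^2)^2)^8"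
    by (simp flip: power_mult)
  also have "(x^2 + y^2)^2 = A + B"
    by (simp add: A_def B_def s_def t_def power2_sum power_mult_distrib flip: power_mult)
  also have "(x^2 - y^2)^2 = A - B"
    by (simp add: A_def B_def s_def t_def power2_diff power_mult_distrib flip: power_mult)
  also have "(A + B)^8 + (A - B)^8 = 2 * (A^8 + 28 * A^6 * B^2 + 70 * A^4 * (B^2)^2 + 28 * A^2 * (B^2)^3 + (B^2)^4)"
    unfolding sum_power_8 by (simp flip: power_mult)
  finally have E: "(x^2 + y^2)^16 + (x^2 - y^2)^16 = \<dots>" .
  have p: "x^32 = s^8" "y^32 = t^8" "(x * y)^16 = (s * t)^4"
    by (simp_all add: s_def t_def power_mult_distrib flip: power_mult)
  show ?thesis unfolding E B2 p A_def using delta16_poly_identity_aux[of s t] by simp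
qed

lemma fps_cong_power_32:
  assumes "fps_cong 31 (f ^ 31) f'"
  shows "fps_cong 31 (f ^ 32) (f * f')"
proof -
  have "f ^ 32 = f * f ^ 31" by (simp flip: power_Suc)
  thus ?thesis using assms by (metis fps_cong_mult fps_cong_refl)
qed

lemma theta_fps_frobenius: "fps_cong 31 (theta_fps A c ^ 31) (theta_fps A (31 * c))"
  using fps_cong_frobenius[of 31 "theta_fps A c"] theta_fps_compose[of 31 A c] by simp

lemma numeral_fps_mult_nth: "(numeral k * f :: 'a::comm_ring_1 fps) $ n = numeral k * f $ n"
  by (simp add: numeral_fps_const)

theorem delta16_fps_mod_31:
  "[16 * delta16_fps $ p = 8 * int (card (principal_reps p))
     - 4 * int (card (odd_reps p) + 2 * card (even_reps p))] (mod 31)"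
proof -
  define x y e0 e2 w where "x = theta_fps evens 2" and "y = theta_fps odds 2"
    and "e0 = theta_fps evens0 1" and "e2 = theta_fps evens2 1" and "w = theta_fps odds 1"
  define x' y' e0' e2' w' where "x' = theta_fps evens 62" and "y' = theta_fps odds 62"
    and "e0' = theta_fps evens0 31" and "e2' = theta_fps evens2 31" and "w' = theta_fps odds 31"
  note defs = x_def y_def e0_def e2_def w_def x'_def y'_def e0'_def e2'_def w'_def
  define s t where "s = x ^ 4" and "t = y ^ 4"
  define K where "K = 31 * s^7 * t + 470 * s^6 * t^2 + 2065 * s^5 * t^3 + 3324 * s^4 * t^4
    + 2065 * s^3 * t^5 + 470 * s^2 * t^6 + 31 * s * t^7"
  have xx: "fps_cong 31 (x ^ 32) (x * x')" and yy: "fps_cong 31 (y ^ 32) (y * y')"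
    and ww: "fps_cong 31 (w ^ 32) (w * w')"
    using fps_cong_power_32[OF theta_fps_frobenius[of evens 2]] fps_cong_power_32[OF theta_fps_frobenius[of odds 2]]
      fps_cong_power_32[OF theta_fps_frobenius[of odds 1]] by (simp_all add: defs)
  have e0_31: "fps_cong 31 (e0 ^ 31) e0'" and e2_31: "fps_cong 31 (e2 ^ 31) e2'"
    using theta_fps_frobenius[of evens0 1] theta_fps_frobenius[of evens2 1] by (simp_all add: defs)
  have "fps_cong 31 ((e0 + e2) ^ 31) (e0' + e2')"
    using fps_cong_trans[OF fps_cong_freshman[of 31 e0 e2] fps_cong_add] e0_31 e2_31 by simp
  hence plus: "fps_cong 31 ((e0 + e2) ^ 32) ((e0 + e2) * (e0' + e2'))"
    by (rule fps_cong_power_32)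
  have "fps_cong 31 ((e0 - e2) ^ 31) (e0 ^ 31 - e2 ^ 31)"
    using fps_cong_freshman[of 31 e0 "- e2"] by simp
  also have "fps_cong 31 (e0 ^ 31 - e2 ^ 31) (e0' - e2')"
    by (intro fps_cong_diff e0_31 e2_31)
  finally have minus: "fps_cong 31 ((e0 - e2) ^ 32) ((e0 - e2) * (e0' - e2'))"
    by (rule fps_cong_power_32)
  have rel: "e0^2 + e2^2 = x^2" "2 * e0 * e2 = y^2" "w^2 = 2 * x * y"
    using theta_even_square_sum theta_even_product theta_odd_square by (simp_all add: defs)
  have sq: "x^2 + y^2 = (e0 + e2)^2" "x^2 - y^2 = (e0 - e2)^2"
    using rel by (simp_all add: power2_sum power2_diff)
  have xy: "w ^ 32 = 65536 * (x * y) ^ 16"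
  proof -
    have "w ^ 32 = (w^2) ^ 16" by (simp flip: power_mult)
    thus ?thesis by (simp add: rel power_mult_distrib)
  qed
  have "16 * (delta16_fps oo fps_X ^ 8) = (s^2 + 14 * s * t + t^2) * s * t * (s - t)^4"
    unfolding delta16_fps_compose Let_def s_def t_def x_def y_def ..
  also have "\<dots> = 8 * (x^32 + y^32) - 8 * (x * y)^16 - 4 * ((x^2 + y^2)^16 + (x^2 - y^2)^16) + 31 * K"
    unfolding K_def s_def t_def by (rule delta16_poly_identity)
  also have "(x^2 + y^2)^16 = (e0 + e2)^32" unfolding sq by (simp flip: power_mult)
  also have "(x^2 - y^2)^16 = (e0 - e2)^32" unfolding sq by (simp flip: power_mult)
  \<comment> \<open>Trading 8 (x y)^16 for 4 w^32 costs a multiple of 31: 4 * 2^16 - 8 = 31 *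
    8456.\<close>
  also have "8 * (x^32 + y^32) - 8 * (x * y)^16 - 4 * ((e0 + e2)^32 + (e0 - e2)^32) + 31 * K
     = 8 * (x^32 + y^32) - 4 * w^32 - 4 * ((e0 + e2)^32 + (e0 - e2)^32) + fps_const 31 * (K + 8456 * (x * y)^16)"
    unfolding xy by (simp add: numeral_fps_const[symmetric] algebra_simps)
  finally have "fps_cong 31 (16 * (delta16_fps oo fps_X ^ 8))
      (8 * (x^32 + y^32) - 4 * w^32 - 4 * ((e0 + e2)^32 + (e0 - e2)^32))"
    using fps_cong_const_mult by metis
  also have "fps_cong 31 \<dots>
      (8 * (x * x' + y * y') - 4 * (w * w') - 4 * ((e0 + e2) * (e0' + e2') + (e0 - e2) * (e0' - e2')))"
    by (intro fps_cong_diff fps_cong_mult fps_cong_add fps_cong_refl xx yy ww plus minus)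
  \<comment> \<open>The mixed products e0 e2' and e2 e0' cancel between the two terms.\<close>
  also have "\<dots> = 8 * (x * x' + y * y') - 4 * (w * w' + 2 * (e0 * e0' + e2 * e2'))"
    by (simp add: algebra_simps)
  \<comment> \<open>As X = q^(1/8), the coefficient of q^p sits at index 8 p.\<close>
  finally have "[(16 * (delta16_fps oo fps_X ^ 8)) $ (8 * p) =
      (8 * (x * x' + y * y') - 4 * (w * w' + 2 * (e0 * e0' + e2 * e2'))) $ (8 * p)] (mod 31)"
    unfolding fps_cong_def by blast
  also have "(16 * (delta16_fps oo fps_X ^ 8)) $ (8 * p) = 16 * delta16_fps $ p"
    by (simp add: numeral_fps_mult_nth fps_nth_compose_X_pow)
  also have "(8 * (x * x' + y * y') - 4 * (w * w' + 2 * (e0 * e0' + e2 * e2'))) $ (8 * p) =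
     8 * ((x * x') $ (8 * p) + (y * y') $ (8 * p))
     - 4 * ((w * w') $ (8 * p) + 2 * ((e0 * e0') $ (8 * p) + (e2 * e2') $ (8 * p)))"
    by (simp add: numeral_fps_mult_nth)
  also have "(x * x') $ (8 * p) + (y * y') $ (8 * p) = int (card (principal_reps p))"
    unfolding defs principal_reps_def
    by (subst theta_fps_mult_add_nth) (auto intro!: arg_cong[of _ _ card])
  also have "(w * w') $ (8 * p) = int (card (odd_reps p))"
    unfolding defs odd_reps_def
    by (subst theta_fps_mult_nth) (auto intro!: arg_cong[of _ _ card])
  also have "(e0 * e0') $ (8 * p) + (e2 * e2') $ (8 * p) = int (card (even_reps p))"
  proof -
    have "a \<in> evens0 \<and> b \<in> evens0 \<or> a \<in> evens2 \<and> b \<in> evens2 \<longleftrightarrow> even a \<and> even b \<and> 4 dvd a - b" for a b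
      by simp presburger
    hence "even_reps p = {(a, b). (a \<in> evens0 \<and> b \<in> evens0 \<or> a \<in> evens2 \<and> b \<in> evens2) \<and>
        int 1 * a^2 + int 31 * b^2 = int (8 * p)}"
      unfolding even_reps_def by simp
    moreover have "evens0 \<inter> evens2 = {}" by auto
    ultimately show ?thesis unfolding defs by (simp only: theta_fps_mult_add_nth zero_less_one zero_less_numeral simp_thms)
  qed
  finally show ?thesis by simp
qed

section \<open>Inversion of the theta function\<close>

text \<open>Polya's proof: sum \<open>(2 cos (\<pi> j / l))\<^sup>2\<^sup>m\<close> over \<open>j\<close> by the binomial theorem and let \<open>l\<close> and
  \<open>m \<approx> t l\<^sup>2\<close> tend to infinity.\<close>

lemma cos_power_even:
  "complex_of_real ((2 * cos \<theta>) ^ (2 * m)) =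
    (\<Sum>k\<le>2*m. of_nat ((2*m) choose k) * exp (2 * \<i> * of_real \<theta> * of_int (int k - int m)))"
proof -
  let ?w = "exp (\<i> * complex_of_real \<theta>)"
  have "complex_of_real (2 * cos \<theta>) = ?w + exp (- (\<i> * complex_of_real \<theta>))"
    by (simp add: cos_of_real[symmetric] cos_exp_eq)
  hence "complex_of_real ((2 * cos \<theta>) ^ (2 * m)) = (?w + exp (- (\<i> * complex_of_real \<theta>))) ^ (2 * m)"
    by (metis of_real_power)
  also have "\<dots> = (\<Sum>k\<le>2*m. of_nat ((2*m) choose k) * ?w ^ k * exp (- (\<i> * complex_of_real \<theta>)) ^ (2*m - k))"
    by (rule binomial_ring)
  also have "\<dots> = (\<Sum>k\<le>2*m. of_nat ((2*m) choose k) * exp (2 * \<i> * of_real \<theta> * of_int (int k - int m)))"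
  proof (intro sum.cong refl)
    fix k assume "k \<in> {..2*m}"
    hence k: "k \<le> 2*m" by simp
    have "?w ^ k * exp (- (\<i> * complex_of_real \<theta>)) ^ (2*m - k) =
        exp (of_nat k * (\<i> * complex_of_real \<theta>) + of_nat (2*m - k) * (- (\<i> * complex_of_real \<theta>)))"
      by (simp only: exp_of_nat_mult exp_add)
    also have "of_nat k * (\<i> * complex_of_real \<theta>) + of_nat (2*m - k) * (- (\<i> * complex_of_real \<theta>)) =
        2 * \<i> * of_real \<theta> * of_int (int k - int m)"
      using k by (simp add: of_nat_diff algebra_simps)
    finally show "of_nat ((2*m) choose k) * ?w ^ k * exp (- (\<i> * complex_of_real \<theta>)) ^ (2*m - k) =
        of_nat ((2*m) choose k) * exp (2 * \<i> * of_real \<theta> * of_int (int k - int m))"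
      by (simp add: mult.assoc)
  qed
  finally show ?thesis .
qed

lemma sum_roots_of_unity:
  fixes a :: int and l :: nat
  assumes "l > 0"
  shows "(\<Sum>j<l. exp (2 * \<i> * of_real (pi * real j / real l) * of_int a)) =
    (if int l dvd a then of_nat l else 0)"
proof -
  define w where "w = exp (2 * pi * \<i> * of_int a / of_nat l)"
  have "exp (2 * \<i> * of_real (pi * real j / real l) * of_int a) = w ^ j" for j
    unfolding w_def exp_of_nat_mult[symmetric] by (simp add: field_simps)
  hence eq: "(\<Sum>j<l. exp (2 * \<i> * of_real (pi * real j / real l) * of_int a)) = (\<Sum>j<l. w ^ j)"
    by simp
  have wl: "w ^ l = 1"
  proof -
    have "w ^ l = exp (of_int (2 * a) * (of_real pi * \<i>))"
      unfolding w_def exp_of_nat_mult[symmetric] using assms by (simp add: field_simps)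
    thus ?thesis using exp_eq_1 by (auto simp: exp_eq_1)
  qed
  have w1: "w = 1 \<longleftrightarrow> int l dvd a"
  proof
    assume "w = 1"
    then obtain n :: int where "2 * pi * of_int a / real l = of_int (2 * n) * pi"
      unfolding w_def exp_eq_1 by auto
    hence "real_of_int a = of_int (int l * n)" using assms by (simp add: field_simps)
    hence "a = int l * n" by (simp only: of_int_eq_iff)
    thus "int l dvd a" by simp
  next
    assume "int l dvd a"
    then obtain n where "a = int l * n" by (elim dvdE)
    thus "w = 1" using assms unfolding w_def exp_eq_1 by auto
  qed
  show ?thesis
  proof (cases "int l dvd a")
    case True
    thus ?thesis using eq w1 by simp
  next
    case False
    hence "w \<noteq> 1" using w1 by simp
    hence "(\<Sum>j<l. w ^ j) = 0" using geometric_sum[of w l] wl by simp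
    thus ?thesis using eq False by simp
  qed
qed

text \<open>Roots-of-unity filter: after binomial expansion, the sum over j keeps exactly the terms
  with k - m divisible by l.\<close>

lemma sum_cos_power_full:
  assumes "l > 0"
  shows "(\<Sum>j<l. (2 * cos (pi * real j / real l)) ^ (2*m)) =
    real l * (\<Sum>k | k \<le> 2*m \<and> int l dvd int k - int m. real ((2*m) choose k))"
proof -
  have "complex_of_real (\<Sum>j<l. (2 * cos (pi * real j / real l)) ^ (2*m)) =
    (\<Sum>j<l. \<Sum>k\<le>2*m. of_nat ((2*m) choose k) * exp (2 * \<i> * of_real (pi * real j / real l) * of_int (int k - int m)))"
    unfolding of_real_sum cos_power_even ..
  also have "\<dots> = (\<Sum>k\<le>2*m. of_nat ((2*m) choose k) *
      (\<Sum>j<l. exp (2 * \<i> * of_real (pi * real j / real l) * of_int (int k - int m))))"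
    by (subst sum.swap) (simp only: sum_distrib_left)
  also have "\<dots> = (\<Sum>k\<le>2*m. if int l dvd int k - int m then of_nat l * of_nat ((2*m) choose k) else 0)"
    unfolding sum_roots_of_unity[OF assms] by (intro sum.cong) auto
  also have "\<dots> = (\<Sum>k | k \<le> 2*m \<and> int l dvd int k - int m. of_nat l * of_nat ((2*m) choose k))"
    by (subst sum.inter_filter[symmetric]) (auto intro: sum.cong)
  also have "\<dots> = complex_of_real (real l * (\<Sum>k | k \<le> 2*m \<and> int l dvd int k - int m. real ((2*m) choose k)))"
    by (simp add: sum_distrib_left)
  finally show ?thesis by (simp only: of_real_eq_iff)
qed

text \<open>As l is odd, the nonzero j pair off under j -> l - j, and the binomial coefficients pair
  off around the central one. This leaves one term for each positive index of the two theta
  series.\<close>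

lemma polya_identity:
  fixes h m :: nat
  defines "l \<equiv> 2*h + 1"
  shows "4^m * (1 + 2 * (\<Sum>j<h. cos (pi * real (Suc j) / real l) ^ (2*m))) =
    real l * (real ((2*m) choose m) + 2 * (\<Sum>k | Suc k * l \<le> m. real ((2*m) choose (m + Suc k * l))))"
proof -
  define c where "c = (\<lambda>j. (2 * cos (pi * real j / real l)) ^ (2*m))"
  have l0: "l > 0" by (simp add: l_def)
  have "{..<l} = insert 0 ((\<lambda>j. Suc j) ` {..<h} \<union> (\<lambda>j. l - Suc j) ` {..<h})" (is "_ = insert 0 (?A \<union> ?B)")
  proof (intro equalityI subsetI)
    fix x assume x: "x \<in> {..<l}"
    consider "x = 0" | "x \<in> {1..h}" | "x \<in> {h+1..2*h}" using x by (force simp: l_def)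
    thus "x \<in> insert 0 (?A \<union> ?B)"
    proof cases
      case 2
      hence "x = Suc (x - 1)" "x - 1 \<in> {..<h}" by auto
      thus ?thesis by blast
    next
      case 3
      hence "x = l - Suc (l - Suc x)" "l - Suc x \<in> {..<h}" by (auto simp: l_def)
      thus ?thesis by blast
    qed simp
  next
    fix x assume "x \<in> insert 0 (?A \<union> ?B)"
    then consider "x = 0" | j where "j < h" "x = Suc j" | j where "j < h" "x = l - Suc j" by blast
    thus "x \<in> {..<l}" by cases (simp_all add: l_def)
  qed
  moreover have "?A \<inter> ?B = {}"
  proof -
    have "Suc j \<noteq> l - Suc j'" if "j < h" "j' < h" for j j' using that unfolding l_def by linarith
    thus ?thesis by blast
  qed
  moreover have "0 \<notin> ?A \<union> ?B"
  proof -
    have "l - Suc j > 0" if "j < h" for j using that by (simp add: l_def)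
    thus ?thesis by fastforce
  qed
  ultimately have "(\<Sum>j<l. c j) = c 0 + (sum c ?A + sum c ?B)"
    by (simp only: sum.insert finite_UnI finite_imageI finite_lessThan sum.union_disjoint simp_thms)
  also have "sum c ?A = (\<Sum>j<h. c (Suc j))" by (subst sum.reindex) auto
  also have "sum c ?B = (\<Sum>j<h. c (l - Suc j))"
    by (subst sum.reindex) (auto simp: inj_on_def l_def)
  also have "\<dots> = (\<Sum>j<h. c (Suc j))"
  proof (intro sum.cong refl)
    fix j assume "j \<in> {..<h}"
    hence "Suc j \<le> l" by (simp add: l_def)
    hence "pi * real (l - Suc j) / real l = pi - pi * real (Suc j) / real l"
      using l0 by (simp add: of_nat_diff field_simps)
    thus "c (l - Suc j) = c (Suc j)" unfolding c_def by (simp add: power_mult)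
  qed
  also have "c 0 + ((\<Sum>j<h. c (Suc j)) + (\<Sum>j<h. c (Suc j))) =
      4^m * (1 + 2 * (\<Sum>j<h. cos (pi * real (Suc j) / real l) ^ (2*m)))"
  proof -
    have "c j = 4^m * cos (pi * real j / real l) ^ (2*m)" for j
      using power_mult[of "2::real" 2 m] by (simp add: c_def power_mult_distrib)
    thus ?thesis by (simp add: sum_distrib_left algebra_simps)
  qed
  finally have lhs: "(\<Sum>j<l. c j) = \<dots>" .
  define K where "K = {k. Suc k * l \<le> m}"
  have finK: "finite K"
  proof (rule finite_subset)
    show "K \<subseteq> {..m}"
    proof
      fix k assume "k \<in> K"
      hence "Suc k * l \<le> m" by (simp add: K_def)
      moreover have "Suc k * 1 \<le> Suc k * l" using l0 by (intro mult_le_mono2) auto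
      ultimately show "k \<in> {..m}" by simp
    qed
  qed simp
  have "{k. k \<le> 2*m \<and> int l dvd int k - int m} =
      insert m ((\<lambda>k. m + Suc k * l) ` K \<union> (\<lambda>k. m - Suc k * l) ` K)" (is "?L = insert m (?A \<union> ?B)")
  proof (intro equalityI subsetI)
    fix x assume x: "x \<in> ?L"
    then obtain n where n: "int x - int m = int l * n" by (auto elim: dvdE)
    consider "n = 0" | "n > 0" | "n < 0" by linarith
    thus "x \<in> insert m (?A \<union> ?B)"
    proof cases
      case 1
      thus ?thesis using n by simp
    next
      case 2
      define k where "k = nat (n - 1)"
      have ne: "n = int (Suc k)" using 2 by (simp add: k_def)
      have "int x = int (m + Suc k * l)" using n unfolding ne by (simp add: algebra_simps)
      hence xe: "x = m + Suc k * l" by (simp only: of_nat_eq_iff)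
      hence "k \<in> K" using x by (simp add: K_def)
      thus ?thesis using xe by blast
    next
      case 3
      define k where "k = nat (- n - 1)"
      have ne: "n = - int (Suc k)" using 3 by (simp add: k_def)
      have "int m = int (x + Suc k * l)" using n unfolding ne by (simp add: algebra_simps)
      hence xe: "m = x + Suc k * l" by (simp only: of_nat_eq_iff)
      hence "k \<in> K" by (simp add: K_def)
      moreover have "x = m - Suc k * l" using xe by simp
      ultimately show ?thesis by blast
    qed
  next
    fix x assume "x \<in> insert m (?A \<union> ?B)"
    then consider "x = m" | k where "k \<in> K" "x = m + Suc k * l" | k where "k \<in> K" "x = m - Suc k * l" by blast
    thus "x \<in> ?L"
    proof cases
      case 2
      hence "int x - int m = int l * int (Suc k)" by (simp add: algebra_simps)
      thus ?thesis using 2 by (simp add: K_def)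
    next
      case 3
      hence "int x - int m = int l * (- int (Suc k))" by (simp add: K_def of_nat_diff algebra_simps)
      thus ?thesis using 3 by (simp add: K_def)
    qed simp
  qed
  hence "(\<Sum>k\<in>?L. real ((2*m) choose k)) = real ((2*m) choose m) +
      ((\<Sum>k\<in>?A. real ((2*m) choose k)) + (\<Sum>k\<in>?B. real ((2*m) choose k)))"
  proof -
    have pos: "Suc k * l > 0" for k using l0 by simp
    have 1: "m \<notin> ?A \<union> ?B"
    proof
      assume "m \<in> ?A \<union> ?B"
      then obtain k where "k \<in> K" "m = m + Suc k * l \<or> m = m - Suc k * l" by blast
      thus False using pos[of k] unfolding K_def mem_Collect_eq by linarith
    qed
    have 2: "?A \<inter> ?B = {}"
    proof -
      have "m + Suc k * l \<noteq> m - Suc k' * l" for k k' using pos[of k] by linarith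
      thus ?thesis by blast
    qed
    assume "?L = insert m (?A \<union> ?B)"
    thus ?thesis using finK 1 2 by (simp only: sum.insert finite_UnI finite_imageI sum.union_disjoint simp_thms)
  qed
  also have "(\<Sum>k\<in>?A. real ((2*m) choose k)) = (\<Sum>k\<in>K. real ((2*m) choose (m + Suc k * l)))"
    using l0 by (subst sum.reindex) (auto simp: inj_on_def)
  also have "(\<Sum>k\<in>?B. real ((2*m) choose k)) = (\<Sum>k\<in>K. real ((2*m) choose (m - Suc k * l)))"
  proof (subst sum.reindex)
    show "inj_on (\<lambda>k. m - Suc k * l) K"
    proof (rule inj_onI)
      fix k k' assume "k \<in> K" "k' \<in> K" "m - Suc k * l = m - Suc k' * l"
      hence "Suc k * l = Suc k' * l" unfolding K_def mem_Collect_eq by linarith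
      thus "k = k'" using l0 by simp
    qed
  qed simp
  also have "\<dots> = (\<Sum>k\<in>K. real ((2*m) choose (m + Suc k * l)))"
  proof (intro sum.cong refl)
    fix k assume "k \<in> K"
    hence "Suc k * l \<le> m" by (simp add: K_def)
    thus "real ((2*m) choose (m - Suc k * l)) = real ((2*m) choose (m + Suc k * l))"
      by (subst binomial_symmetric) (simp_all del: mult_Suc add: algebra_simps)
  qed
  finally have rhs: "(\<Sum>k\<in>?L. real ((2*m) choose k)) =
     real ((2*m) choose m) + 2 * (\<Sum>k\<in>K. real ((2*m) choose (m + Suc k * l)))" by simp
  show ?thesis using sum_cos_power_full[OF l0, of m] lhs rhs unfolding c_def K_def by simp
qed

section \<open>Limits and majorants for the two sides\<close>

lemma tendsto_power_exp:
  fixes x :: "'b \<Rightarrow> real" and r :: "'b \<Rightarrow> nat"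
  assumes "(x \<longlongrightarrow> 0) F" "eventually (\<lambda>h. x h > 0) F" "((\<lambda>h. real (r h) * x h) \<longlongrightarrow> c) F"
  shows "((\<lambda>h. (1 - x h) ^ r h) \<longlongrightarrow> exp (- c)) F"
proof -
  have "((\<lambda>x::real. ln (1 - x) / x) \<longlongrightarrow> -1) (at_right 0)" by real_asymp
  moreover have "filterlim x (at_right 0) F"
    using assms(1,2) by (auto simp: filterlim_at elim!: eventually_mono)
  ultimately have "((\<lambda>h. ln (1 - x h) / x h) \<longlongrightarrow> -1) F" by (rule filterlim_compose)
  from tendsto_mult[OF assms(3) this]
  have "((\<lambda>h. exp (real (r h) * x h * (ln (1 - x h) / x h))) \<longlongrightarrow> exp (- c)) F"
    by (intro tendsto_exp) simp
  moreover have "eventually (\<lambda>h. x h < 1) F" using assms(1) by (rule order_tendstoD) simp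
  hence "eventually (\<lambda>h. exp (real (r h) * x h * (ln (1 - x h) / x h)) = (1 - x h) ^ r h) F"
    using assms(2)
  proof eventually_elim
    case (elim h)
    hence "exp (real (r h) * x h * (ln (1 - x h) / x h)) = exp (real (r h) * ln (1 - x h))" by simp
    also have "\<dots> = (1 - x h) ^ r h" using elim by (subst exp_of_nat_mult) simp
    finally show ?case .
  qed
  ultimately show ?thesis by (rule Lim_transform_eventually)
qed

lemma prod_descending_fact:
  "r \<le> n \<Longrightarrow> (\<Prod>i<r. real (n - i)) * fact (n - r) = fact n"
proof (induction r)
  case (Suc r)
  have "fact (n - r) = real (n - r) * fact (n - Suc r)"
    using Suc.prems by (simp add: fact_reduce Suc_diff_Suc flip: Suc_diff_Suc)
  thus ?case using Suc by (simp add: mult.assoc mult.left_commute)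
qed simp

text \<open>The quotient equals the product over i < r of 1 - r / (m + r - i), whose denominators
  lie between m and m + r. The two bounds have the same limit and the upper one also serves as
  majorant.\<close>

lemma central_binomial_ratio:
  assumes "r \<le> m" "m > 0"
  defines "\<rho> \<equiv> real ((2*m) choose (m + r)) / real ((2*m) choose m)"
  shows "(1 - real r / real m) ^ r \<le> \<rho>" "\<rho> \<le> (1 - real r / real (m + r)) ^ r"
proof -
  have "\<rho> = (fact m / fact (m - r)) / (fact (m + r) / fact m)"
    using assms by (simp add: \<rho>_def binomial_fact field_simps)
  also have "fact m / fact (m - r) = (\<Prod>i<r. real (m - i))"
    using prod_descending_fact[OF assms(1)] by (simp add: field_simps)
  also have "fact (m + r) / fact m = (\<Prod>i<r. real (m + r - i))"
    using prod_descending_fact[of r "m + r"] by (simp add: field_simps)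
  also have "(\<Prod>i<r. real (m - i)) / (\<Prod>i<r. real (m + r - i)) = (\<Prod>i<r. 1 - real r / real (m + r - i))"
    unfolding prod_dividef[symmetric] using assms
    by (intro prod.cong) (auto simp: field_simps of_nat_diff)
  finally have eq: "\<rho> = (\<Prod>i<r. 1 - real r / real (m + r - i))" .
  have mono: "real r / real (m + r) \<le> real r / real (m + r - i)" "real r / real (m + r - i) \<le> real r / real m"
    if "i < r" for i
  proof -
    have "m \<le> m + r - i" "m + r - i \<le> m + r" using that by linarith+
    hence "real m \<le> real (m + r - i)" "real (m + r - i) \<le> real (m + r)" by (simp_all only: of_nat_le_iff)
    moreover have "0 < real m" using assms(2) by simp
    ultimately show "real r / real (m + r) \<le> real r / real (m + r - i)"
      "real r / real (m + r - i) \<le> real r / real m"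
      by (intro divide_left_mono mult_pos_pos; linarith)+
  qed
  have le1: "real r / real m \<le> 1" using assms by simp
  have "(\<Prod>i<r. 1 - real r / real m) \<le> \<rho>" unfolding eq
  proof (intro prod_mono conjI)
    fix i assume i: "i \<in> {..<r}"
    show "1 - real r / real m \<le> 1 - real r / real (m + r - i)"
      by (rule diff_left_mono, rule mono) (use i in simp)
    show "0 \<le> 1 - real r / real m" using le1 by (simp only: diff_ge_0_iff_ge)
  qed
  thus "(1 - real r / real m) ^ r \<le> \<rho>" by (simp only: prod_constant card_lessThan)
  have "\<rho> \<le> (\<Prod>i<r. 1 - real r / real (m + r))" unfolding eq
  proof (intro prod_mono conjI)
    fix i assume i: "i \<in> {..<r}"
    show "1 - real r / real (m + r - i) \<le> 1 - real r / real (m + r)"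
      by (rule diff_left_mono, rule mono) (use i in simp)
    have "real r / real (m + r - i) \<le> real r / real m" by (rule mono) (use i in simp)
    also note le1
    finally show "0 \<le> 1 - real r / real (m + r - i)" by (simp only: diff_ge_0_iff_ge)
  qed
  thus "\<rho> \<le> (1 - real r / real (m + r)) ^ r" by (simp only: prod_constant card_lessThan)
qed

text \<open>The normalisation by 2 n + 1 instead of 2 n makes the square exactly the reciprocal of a
  partial Wallis product.\<close>

lemma central_binomial_asymp:
  "(\<lambda>n. real ((2*n) choose n) / 4^n * sqrt (2 * real n + 1)) \<longlonglongrightarrow> sqrt (2 / pi)"
proof -
  define c where "c = (\<lambda>n. real ((2*n) choose n) / 4^n)"
  have c_Suc: "c (Suc n) = c n * (2 * real n + 1) / (2 * real n + 2)" for n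
  proof -
    have "real ((2 * Suc n) choose Suc n) * real (Suc n) * real (Suc n) =
        real ((2 * n) choose n) * real (2 * n + 2) * real (2 * n + 1)"
    proof -
      have "2 * Suc n - Suc n = n + 1" "2 * Suc n = 2 * n + 2" "Suc n = n + 1" by simp_all
      hence "real ((2 * Suc n) choose Suc n) = fact (2 * n + 2) / (fact (n + 1) * fact (n + 1))"
        using binomial_fact[of "Suc n" "2 * Suc n", where ?'a = real] by (metis le_add2 mult_2)
      moreover have "real ((2 * n) choose n) = fact (2 * n) / (fact n * fact n)"
        by (simp add: binomial_fact)
      moreover have "fact (2 * n + 2) = (2 * real n + 2) * (2 * real n + 1) * fact (2 * n)"
        by (simp add: algebra_simps)
      moreover have "fact (n + 1) = (real n + 1) * fact n" by simp
      ultimately show ?thesis by (simp only:) (simp add: divide_simps, simp add: algebra_simps)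
    qed
    moreover have "X / (4 * P) = Y / P * (2 * real n + 1) / (2 * real n + 2)"
      if "X * real (Suc n) * real (Suc n) = Y * real (2 * n + 2) * real (2 * n + 1)" "P \<noteq> 0" for X Y P :: real
    proof -
      have "real (Suc n) * (X * real (Suc n)) = real (Suc n) * (2 * Y * (2 * real n + 1))"
        using that(1) by (simp add: algebra_simps)
      hence "X * real (Suc n) = 2 * Y * (2 * real n + 1)" by (subst (asm) mult_cancel_left) auto
      hence "X * (2 * real n + 2) = Y * (2 * real n + 1) * 4" by (simp add: algebra_simps)
      thus ?thesis using that(2) by (simp add: divide_simps)
    qed
    ultimately show ?thesis unfolding c_def power_Suc by simp
  qed
  have "c n ^ 2 * (2 * real n + 1) = inverse (\<Prod>k=1..n. (4*real k^2) / (4*real k^2 - 1))" for n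
  proof (induction n)
    case (Suc n)
    have "c (Suc n) ^ 2 * (2 * real (Suc n) + 1) =
        c n ^ 2 * (2 * real n + 1) * ((2 * real n + 1) * (2 * real n + 3) / (2 * real n + 2) ^ 2)"
      by (simp add: c_Suc power_mult_distrib power_divide) (simp add: power2_eq_square field_simps)
    also have "(2 * real n + 1) * (2 * real n + 3) / (2 * real n + 2) ^ 2 =
        inverse ((4*real (Suc n)^2) / (4*real (Suc n)^2 - 1))"
      by (simp add: power2_eq_square field_simps)
    finally have e: "c (Suc n) ^ 2 * (2 * real (Suc n) + 1) =
        c n ^ 2 * (2 * real n + 1) * inverse ((4*real (Suc n)^2) / (4*real (Suc n)^2 - 1))" .
    have P: "(\<Prod>k=1..Suc n. (4*real k^2) / (4*real k^2 - 1)) =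
        (\<Prod>k=1..n. (4*real k^2) / (4*real k^2 - 1)) * ((4*real (Suc n)^2) / (4*real (Suc n)^2 - 1))"
      by (simp add: mult.commute)
    show ?case unfolding e Suc.IH P by (rule inverse_mult_distrib[symmetric])
  qed (simp add: c_def)
  moreover have "(\<lambda>n. sqrt (inverse (\<Prod>k=1..n. (4*real k^2) / (4*real k^2 - 1)))) \<longlonglongrightarrow> sqrt (inverse (pi / 2))"
    by (intro tendsto_intros wallis) auto
  ultimately have "(\<lambda>n. sqrt (c n ^ 2 * (2 * real n + 1))) \<longlonglongrightarrow> sqrt (2 / pi)" by simp
  thus ?thesis by (simp add: real_sqrt_mult c_def)
qed

lemma x_cos_le_sin:
  assumes "0 \<le> x" "x \<le> pi"
  shows "x * cos x \<le> sin x"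
proof -
  have "sin 0 - 0 * cos 0 \<le> sin x - x * cos x"
  proof (rule DERIV_nonneg_imp_nondecreasing[OF assms(1)])
    fix y assume y: "0 \<le> y" "y \<le> x"
    have "((\<lambda>y. sin y - y * cos y) has_real_derivative y * sin y) (at y)"
      by (auto intro!: derivative_eq_intros)
    moreover have "0 \<le> y * sin y" using y assms by (intro mult_nonneg_nonneg sin_ge_zero) auto
    ultimately show "\<exists>D. ((\<lambda>y. sin y - y * cos y) has_real_derivative D) (at y) \<and> 0 \<le> D" by blast
  qed
  thus ?thesis by simp
qed

text \<open>exp(x^2/2) cos x has derivative exp(x^2/2) (x cos x - sin x) <= 0 and starts at 1. This
  yields a Gaussian majorant for powers of the cosine.\<close>

lemma cos_le_exp:
  assumes "0 \<le> x" "x \<le> pi"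
  shows "cos x \<le> exp (- (x\<^sup>2 / 2))"
proof -
  have "exp (x\<^sup>2 / 2) * cos x \<le> exp (0\<^sup>2 / 2) * cos 0"
  proof (rule DERIV_nonpos_imp_nonincreasing[OF assms(1)])
    fix y assume y: "0 \<le> y" "y \<le> x"
    have "((\<lambda>y. exp (y\<^sup>2 / 2) * cos y) has_real_derivative exp (y\<^sup>2 / 2) * (y * cos y - sin y)) (at y)"
      by (auto intro!: derivative_eq_intros simp: algebra_simps)
    moreover have "exp (y\<^sup>2 / 2) * (y * cos y - sin y) \<le> 0"
      using x_cos_le_sin[of y] y assms by (simp add: mult_nonneg_nonpos)
    ultimately show "\<exists>D. ((\<lambda>y. exp (y\<^sup>2 / 2) * cos y) has_real_derivative D) (at y) \<and> D \<le> 0" by blast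
  qed
  thus ?thesis by (simp add: exp_minus field_simps)
qed

lemma summable_exp_neg_linear:
  assumes "c > 0"
  shows "summable (\<lambda>k. exp (- (c * real (Suc k))))"
proof -
  have "summable (\<lambda>k. exp (- c) * exp (- c) ^ k)"
    using assms by (intro summable_mult summable_geometric) simp
  moreover have "exp (- c) * exp (- c) ^ k = exp (- (c * real (Suc k)))" for k
    by (simp add: exp_of_nat_mult[symmetric] exp_add[symmetric] algebra_simps)
  ultimately show ?thesis by simp
qed

lemma Suc_le_square: "real (Suc k) \<le> (real (Suc k))\<^sup>2"
  by (rule self_le_power) auto

theorem real_theta_inversion:
  fixes t :: real
  assumes "t > 0"
  shows "1 + 2 * (\<Sum>k. exp (- (pi\<^sup>2 * (real (Suc k))\<^sup>2 * t))) =
    1 / sqrt (pi * t) * (1 + 2 * (\<Sum>k. exp (- ((real (Suc k))\<^sup>2 / t))))"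
proof -
  define l where "l = (\<lambda>h::nat. 2 * h + 1)"
  \<comment> \<open>With m about t l^2, cos(pi j / l)^(2m) behaves like (1 - pi^2 j^2 / (2 l^2))^(2
    t l^2), and the quotient of the binomial coefficient at m + k l by the central one like exp(-k^2
    l^2 / m); both converge.\<close>
  define m where "m = (\<lambda>h. nat \<lfloor>t * (real (l h))\<^sup>2\<rfloor>)"
  have l0: "l h > 0" for h by (simp add: l_def)
  have l_ne [simp]: "l h \<noteq> 0" for h using l0[of h] by simp
  have m_le: "real (m h) \<le> t * (real (l h))\<^sup>2" for h
    using assms unfolding m_def by simp
  have m_ge: "t * (real (l h))\<^sup>2 - 1 \<le> real (m h)" for h
    unfolding m_def by linarith
  have lim_l: "filterlim (\<lambda>h. real (l h)) at_top sequentially"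
    unfolding l_def by real_asymp
  have lim_inv_l: "(\<lambda>h. 1 / real (l h)) \<longlonglongrightarrow> 0"
    unfolding l_def by real_asymp
  have lim_ml: "(\<lambda>h. real (m h) / (real (l h))\<^sup>2) \<longlonglongrightarrow> t"
  proof (rule tendsto_sandwich)
    show "(\<lambda>h. t - 1 / (real (l h))\<^sup>2) \<longlonglongrightarrow> t" unfolding l_def by real_asymp
    show "\<forall>\<^sub>F h in sequentially. t - 1 / (real (l h))\<^sup>2 \<le> real (m h) / (real (l h))\<^sup>2"
    proof (intro always_eventually allI)
      fix h
      have "(t * (real (l h))\<^sup>2 - 1) / (real (l h))\<^sup>2 \<le> real (m h) / (real (l h))\<^sup>2"
        using m_ge by (intro divide_right_mono) auto
      thus "t - 1 / (real (l h))\<^sup>2 \<le> real (m h) / (real (l h))\<^sup>2"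
        using l0[of h] by (simp add: diff_divide_distrib)
    qed
    show "\<forall>\<^sub>F h in sequentially. real (m h) / (real (l h))\<^sup>2 \<le> t"
      using m_le l0 by (intro always_eventually allI) (simp add: divide_le_eq)
  qed auto
  have ml_half: "\<forall>\<^sub>F h in sequentially. real (m h) / (real (l h))\<^sup>2 > t / 2"
    by (rule order_tendstoD(1)[OF lim_ml]) (use assms in simp)
  have lim_m: "filterlim m at_top sequentially"
  proof -
    have "filterlim (\<lambda>h. t * (real (l h))\<^sup>2 - 1) at_top sequentially"
      unfolding l_def using assms by real_asymp
    hence "filterlim (\<lambda>h. real (m h)) at_top sequentially"
      by (rule filterlim_at_top_mono) (use m_ge in auto)
    thus ?thesis by (simp add: filterlim_sequentially_iff_filterlim_real)
  qed

  define a where "a = (\<lambda>j h. if j < h then cos (pi * real (Suc j) / real (l h)) ^ (2 * m h) else 0)"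
  have lim_a: "(\<lambda>h. a j h) \<longlonglongrightarrow> exp (- (pi\<^sup>2 * (real (Suc j))\<^sup>2 * t))" for j
  proof -
    define c where "c = pi * real (Suc j)"
    have c: "c > 0" by (simp add: c_def)
    have "(\<lambda>h. (1 - (1 - cos (c / real (l h)))) ^ (2 * m h)) \<longlonglongrightarrow> exp (- (c\<^sup>2 * t))"
    proof (rule tendsto_power_exp)
      show "(\<lambda>h. 1 - cos (c / real (l h))) \<longlonglongrightarrow> 0" unfolding l_def using c by real_asymp
      show "\<forall>\<^sub>F h in sequentially. 1 - cos (c / real (l h)) > 0" unfolding l_def using c by real_asymp
      have "(\<lambda>h. 2 * (real (l h))\<^sup>2 * (1 - cos (c / real (l h)))) \<longlonglongrightarrow> c * c"
        unfolding l_def using c by real_asymp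
      hence "(\<lambda>h. 2 * (real (l h))\<^sup>2 * (1 - cos (c / real (l h)))) \<longlonglongrightarrow> c\<^sup>2"
        by (simp only: power2_eq_square)
      from tendsto_mult[OF this lim_ml]
      show "(\<lambda>h. real (2 * m h) * (1 - cos (c / real (l h)))) \<longlonglongrightarrow> c\<^sup>2 * t"
      proof -
        have "2 * (real (l h))\<^sup>2 * X * (real (m h) / (real (l h))\<^sup>2) = real (2 * m h) * X" for h X
          using l0[of h] by simp
        thus "(\<lambda>h. 2 * (real (l h))\<^sup>2 * (1 - cos (c / real (l h))) * (real (m h) / (real (l h))\<^sup>2)) \<longlonglongrightarrow> c\<^sup>2 * t \<Longrightarrow> ?thesis"
          by (simp only:)
      qed
    qed
    moreover have "\<forall>\<^sub>F h in sequentially. (1 - (1 - cos (c / real (l h)))) ^ (2 * m h) = a j h"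
      using eventually_gt_at_top[of j] by eventually_elim (simp add: a_def c_def)
    ultimately have "(\<lambda>h. a j h) \<longlonglongrightarrow> exp (- (c\<^sup>2 * t))" by (rule Lim_transform_eventually)
    thus ?thesis by (simp only: c_def power_mult_distrib)
  qed
  have "(\<lambda>h. \<Sum>j. a j h) \<longlonglongrightarrow> (\<Sum>j. exp (- (pi\<^sup>2 * (real (Suc j))\<^sup>2 * t)))"
  \<comment> \<open>Dominated convergence for series. Weakening the square of \<open>Suc j\<close>
    to \<open>Suc j\<close> in the Gaussian majorant leaves a geometric series.\<close>
  proof (rule tannerys_theorem[THEN conjunct2, THEN conjunct2])
    show "(\<lambda>h. a j h) \<longlonglongrightarrow> exp (- (pi\<^sup>2 * (real (Suc j))\<^sup>2 * t))" for j by (rule lim_a)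
    show "summable (\<lambda>j. exp (- (pi\<^sup>2 * (t / 2) * real (Suc j))))"
      using assms by (intro summable_exp_neg_linear) simp
    have bound: "norm (a j h) \<le> exp (- (pi\<^sup>2 * (t / 2) * real (Suc j)))" if h: "real (m h) / (real (l h))\<^sup>2 > t / 2" for j h
    proof (cases "j < h")
      case True
      define \<theta> where "\<theta> = pi * real (Suc j) / real (l h)"
      \<comment> \<open>Restricting to j < h keeps the angle below pi/2, so the cosine is
        nonnegative and its upper bound may be raised to a power.\<close>
      have "real (Suc j) / real (l h) \<le> 1 / 2" using True by (simp add: l_def field_simps)
      hence "pi * (real (Suc j) / real (l h)) \<le> pi * (1 / 2)" by (intro mult_left_mono) auto
      hence \<theta>: "0 \<le> \<theta>" "\<theta> \<le> pi / 2" by (auto simp: \<theta>_def)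
      hence c0: "cos \<theta> \<ge> 0" by (intro cos_ge_zero) auto
      have "norm (a j h) = cos \<theta> ^ (2 * m h)" using True c0 by (simp add: a_def \<theta>_def)
      also have "\<dots> \<le> exp (- (\<theta>\<^sup>2 / 2)) ^ (2 * m h)"
        using \<theta> c0 by (intro power_mono cos_le_exp) auto
      also have "\<dots> = exp (- (pi\<^sup>2 * (real (m h) / (real (l h))\<^sup>2) * (real (Suc j))\<^sup>2))"
        unfolding exp_of_nat_mult[symmetric]
        by (simp add: \<theta>_def power_mult_distrib power_divide field_simps del: of_nat_Suc)
      also have "\<dots> \<le> exp (- (pi\<^sup>2 * (t / 2) * real (Suc j)))"
      proof -
        have "pi\<^sup>2 * (t / 2) * real (Suc j) \<le> pi\<^sup>2 * (real (m h) / (real (l h))\<^sup>2) * (real (Suc j))\<^sup>2"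
          by (intro mult_mono Suc_le_square) (use h assms in auto)
        thus ?thesis by simp
      qed
      finally show ?thesis .
    qed (simp add: a_def)
    have "\<forall>\<^sub>F h in sequentially. \<forall>j. norm (a j h) \<le> exp (- (pi\<^sup>2 * (t / 2) * real (Suc j)))"
      by (rule eventually_mono[OF ml_half]) (use bound in blast)
    thus "\<forall>\<^sub>F (j, h) in at_top \<times>\<^sub>F sequentially. norm (a j h) \<le> exp (- (pi\<^sup>2 * (t / 2) * real (Suc j)))"
      unfolding eventually_prod_filter
      by (intro exI[of _ "\<lambda>_. True"] exI[of _ "\<lambda>h. \<forall>j. norm (a j h) \<le> exp (- (pi\<^sup>2 * (t / 2) * real (Suc j)))"])
         auto
  qed auto
  hence LHS: "(\<lambda>h. 1 + 2 * (\<Sum>j. a j h)) \<longlonglongrightarrow> 1 + 2 * (\<Sum>j. exp (- (pi\<^sup>2 * (real (Suc j))\<^sup>2 * t)))"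
    by (intro tendsto_intros)
  have sum_a: "(\<Sum>j. a j h) = (\<Sum>j<h. cos (pi * real (Suc j) / real (l h)) ^ (2 * m h))" for h
    by (subst suminf_finite[of "{..<h}"]) (auto simp: a_def)

  define b where "b = (\<lambda>k h. if Suc k * l h \<le> m h
    then real ((2 * m h) choose (m h + Suc k * l h)) / real ((2 * m h) choose m h) else 0)"
  have lim_lm: "(\<lambda>h. real (l h) / real (m h)) \<longlonglongrightarrow> 0"
  proof -
    have "(\<lambda>h. (1 / real (l h)) / (real (m h) / (real (l h))\<^sup>2)) \<longlonglongrightarrow> 0 / t"
      using assms by (intro tendsto_intros lim_ml lim_inv_l) auto
    thus ?thesis using l0 by (simp add: power2_eq_square field_simps)
  qed
  have ev_ok: "\<forall>\<^sub>F h in sequentially. Suc k * l h \<le> m h" for k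
  proof -
    have "\<forall>\<^sub>F h in sequentially. real (l h) / real (m h) < 1 / real (Suc k)"
      by (rule order_tendstoD(2)[OF lim_lm]) simp
    moreover have "\<forall>\<^sub>F h in sequentially. m h > 0"
      by (rule eventually_compose_filterlim[OF eventually_gt_at_top lim_m])
    ultimately show ?thesis
    proof eventually_elim
      case (elim h)
      hence "real (Suc k * l h) \<le> real (m h)" by (simp add: field_simps del: of_nat_Suc mult_Suc)
      thus ?case by (simp only: of_nat_le_iff)
    qed
  qed
  have lim_b: "(\<lambda>h. b k h) \<longlonglongrightarrow> exp (- ((real (Suc k))\<^sup>2 / t))" for k
  proof (rule tendsto_sandwich)
    define r where "r = (\<lambda>h. Suc k * l h)"
    have r0: "r h > 0" for h using l0 by (simp add: r_def)
    have m0: "\<forall>\<^sub>F h in sequentially. m h > 0"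
      by (rule eventually_compose_filterlim[OF eventually_gt_at_top lim_m])
    show "(\<lambda>h. (1 - real (r h) / real (m h)) ^ r h) \<longlonglongrightarrow> exp (- ((real (Suc k))\<^sup>2 / t))"
    proof (rule tendsto_power_exp)
      have "(\<lambda>h. real (Suc k) * (real (l h) / real (m h))) \<longlonglongrightarrow> real (Suc k) * 0"
        by (intro tendsto_intros lim_lm)
      thus "(\<lambda>h. real (r h) / real (m h)) \<longlonglongrightarrow> 0" by (simp add: r_def del: of_nat_Suc mult_Suc)
      show "\<forall>\<^sub>F h in sequentially. real (r h) / real (m h) > 0"
        using m0 by eventually_elim (use r0 in auto)
      have "(\<lambda>h. (real (Suc k))\<^sup>2 / (real (m h) / (real (l h))\<^sup>2)) \<longlonglongrightarrow> (real (Suc k))\<^sup>2 / t"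
        using assms by (intro tendsto_intros lim_ml) auto
      thus "(\<lambda>h. real (r h) * (real (r h) / real (m h))) \<longlonglongrightarrow> (real (Suc k))\<^sup>2 / t"
        by (simp add: r_def power2_eq_square algebra_simps del: of_nat_Suc mult_Suc)
    qed
    show "(\<lambda>h. (1 - real (r h) / real (m h + r h)) ^ r h) \<longlonglongrightarrow> exp (- ((real (Suc k))\<^sup>2 / t))"
    proof (rule tendsto_power_exp)
      have "(\<lambda>h. real (Suc k) * (1 / real (l h)) / (real (m h) / (real (l h))\<^sup>2 + real (Suc k) * (1 / real (l h))))
          \<longlonglongrightarrow> real (Suc k) * 0 / (t + real (Suc k) * 0)"
        using assms by (intro tendsto_intros lim_ml lim_inv_l) auto
      moreover have "real (Suc k) * (1 / real (l h)) / (real (m h) / (real (l h))\<^sup>2 + real (Suc k) * (1 / real (l h)))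
          = real (r h) / real (m h + r h)" for h
      proof -
        have "real (m h) / (real (l h))\<^sup>2 + real (Suc k) * (1 / real (l h)) = real (m h + r h) / (real (l h))\<^sup>2"
          using l0[of h] by (simp add: r_def power2_eq_square field_simps del: of_nat_Suc mult_Suc)
        moreover have "real (Suc k) * (1 / real (l h)) = real (r h) / (real (l h))\<^sup>2"
          using l0[of h] by (simp add: r_def power2_eq_square del: of_nat_Suc mult_Suc)
        ultimately show ?thesis using l0[of h] by simp
      qed
      ultimately show "(\<lambda>h. real (r h) / real (m h + r h)) \<longlonglongrightarrow> 0" by simp
      show "\<forall>\<^sub>F h in sequentially. real (r h) / real (m h + r h) > 0"
        using r0 by (intro always_eventually allI) (simp add: add_nonneg_pos)
      have "(\<lambda>h. (real (Suc k))\<^sup>2 / (real (m h) / (real (l h))\<^sup>2 + real (Suc k) * (1 / real (l h))))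
          \<longlonglongrightarrow> (real (Suc k))\<^sup>2 / (t + real (Suc k) * 0)"
        using assms by (intro tendsto_intros lim_ml lim_inv_l) auto
      moreover have "(real (Suc k))\<^sup>2 / (real (m h) / (real (l h))\<^sup>2 + real (Suc k) * (1 / real (l h)))
          = real (r h) * (real (r h) / real (m h + r h))" for h
      proof -
        have "real (m h) / (real (l h))\<^sup>2 + real (Suc k) * (1 / real (l h)) = real (m h + r h) / (real (l h))\<^sup>2"
          using l0[of h] by (simp add: r_def power2_eq_square field_simps del: of_nat_Suc mult_Suc)
        thus ?thesis by (simp add: r_def power2_eq_square algebra_simps del: of_nat_Suc mult_Suc)
      qed
      ultimately show "(\<lambda>h. real (r h) * (real (r h) / real (m h + r h))) \<longlonglongrightarrow> (real (Suc k))\<^sup>2 / t"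
        by simp
    qed
    show "\<forall>\<^sub>F h in sequentially. (1 - real (r h) / real (m h)) ^ r h \<le> b k h"
      using ev_ok[of k] m0 by eventually_elim (simp only: b_def r_def if_True central_binomial_ratio)
    show "\<forall>\<^sub>F h in sequentially. b k h \<le> (1 - real (r h) / real (m h + r h)) ^ r h"
      using ev_ok[of k] m0 by eventually_elim (simp only: b_def r_def if_True central_binomial_ratio)
  qed
  have "(\<lambda>h. \<Sum>k. b k h) \<longlonglongrightarrow> (\<Sum>k. exp (- ((real (Suc k))\<^sup>2 / t)))"
  proof (rule tannerys_theorem[THEN conjunct2, THEN conjunct2])
    show "(\<lambda>h. b k h) \<longlonglongrightarrow> exp (- ((real (Suc k))\<^sup>2 / t))" for k by (rule lim_b)
    show "summable (\<lambda>k. exp (- (1 / (2 * t) * real (Suc k))))"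
      using assms by (intro summable_exp_neg_linear) simp
    have "norm (b k h) \<le> exp (- (1 / (2 * t) * real (Suc k)))" for k h
    proof (cases "Suc k * l h \<le> m h")
      case True
      define r where "r = Suc k * l h"
      have r: "0 < r" "r \<le> m h" using True l0 by (simp_all add: r_def)
      hence m0: "m h > 0" by linarith
      have "norm (b k h) = real ((2 * m h) choose (m h + r)) / real ((2 * m h) choose m h)"
        using True by (simp add: b_def r_def)
      also have "\<dots> \<le> (1 - real r / real (m h + r)) ^ r"
        by (rule central_binomial_ratio) fact+
      also have "\<dots> \<le> exp (- (real r / real (m h + r))) ^ r"
        using r exp_ge_add_one_self[of "- (real r / real (m h + r))"] by (intro power_mono) (auto simp: field_simps)
      also have "\<dots> = exp (- (real r * real r / real (m h + r)))"
        unfolding exp_of_nat_mult[symmetric] by simp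
      also have "\<dots> \<le> exp (- (1 / (2 * t) * real (Suc k)))"
      proof -
        have "1 / (2 * t) * real (Suc k) \<le> 1 / (2 * t) * (real (Suc k))\<^sup>2"
          using assms Suc_le_square[of k] by (intro mult_left_mono) auto
        also have "\<dots> = real r * real r / (2 * (t * (real (l h))\<^sup>2))"
          using l0[of h] by (simp add: r_def power2_eq_square algebra_simps del: of_nat_Suc mult_Suc)
        \<comment> \<open>r <= m and m <= t l^2 bound the denominator m + r by 2 t l^2.\<close>
        also have "\<dots> \<le> real r * real r / real (m h + r)"
          using m_le[of h] r by (intro divide_left_mono) (auto intro!: mult_pos_pos assms simp: l0)
        finally show ?thesis by simp
      qed
      finally show ?thesis .
    qed (simp add: b_def)
    thus "\<forall>\<^sub>F (k, h) in at_top \<times>\<^sub>F sequentially. norm (b k h) \<le> exp (- (1 / (2 * t) * real (Suc k)))"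
      by (intro always_eventually) auto
  qed auto
  hence lim_B: "(\<lambda>h. 1 + 2 * (\<Sum>k. b k h)) \<longlonglongrightarrow> 1 + 2 * (\<Sum>k. exp (- ((real (Suc k))\<^sup>2 / t)))"
    by (intro tendsto_intros)
  define C where "C = (\<lambda>n. real ((2*n) choose n) / 4^n)"
  \<comment> \<open>C(m) is asymptotically 1 / sqrt (pi m), and m is about t l^2.\<close>
  have lim_C: "(\<lambda>h. real (l h) * C (m h)) \<longlonglongrightarrow> 1 / sqrt (pi * t)"
  proof -
    have "(\<lambda>h. C (m h) * sqrt (2 * real (m h) + 1)) \<longlonglongrightarrow> sqrt (2 / pi)"
      unfolding C_def by (rule filterlim_compose[OF central_binomial_asymp lim_m])
    moreover have "(\<lambda>h. sqrt (1 / (2 * (real (m h) / (real (l h))\<^sup>2) + (1 / real (l h)) * (1 / real (l h))))) \<longlonglongrightarrow> sqrt (1 / (2 * t + 0 * 0))"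
      using assms by (intro tendsto_intros lim_ml lim_inv_l) auto
    moreover have "sqrt (1 / (2 * (real (m h) / (real (l h))\<^sup>2) + (1 / real (l h)) * (1 / real (l h)))) =
        real (l h) / sqrt (2 * real (m h) + 1)" for h
    proof -
      have "2 * (real (m h) / (real (l h))\<^sup>2) + (1 / real (l h)) * (1 / real (l h)) = (2 * real (m h) + 1) / (real (l h))\<^sup>2"
        using l0[of h] by (simp add: power2_eq_square field_simps)
      thus ?thesis by (simp add: real_sqrt_divide)
    qed
    ultimately have "(\<lambda>h. (C (m h) * sqrt (2 * real (m h) + 1)) * (real (l h) / sqrt (2 * real (m h) + 1)))
        \<longlonglongrightarrow> sqrt (2 / pi) * sqrt (1 / (2 * t + 0 * 0))"
      by (intro tendsto_mult) simp_all
    moreover have "(C (m h) * sqrt (2 * real (m h) + 1)) * (real (l h) / sqrt (2 * real (m h) + 1)) = real (l h) * C (m h)" for h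
      by (simp add: add_nonneg_eq_0_iff)
    moreover have "sqrt (2 / pi) * sqrt (1 / (2 * t + 0 * 0)) = 1 / sqrt (pi * t)"
    proof -
      have "2 / pi * (1 / (2 * t + 0 * 0)) = 1 / (pi * t)" by simp
      thus ?thesis unfolding real_sqrt_mult[symmetric] by (simp only: real_sqrt_divide real_sqrt_one)
    qed
    ultimately show ?thesis by (simp add: mult.commute[of "C _"])
  qed
  have "1 + 2 * (\<Sum>j. a j h) = (real (l h) * C (m h)) * (1 + 2 * (\<Sum>k. b k h))" for h
  proof -
    define K where "K = {k. Suc k * l h \<le> m h}"
    have "K \<subseteq> {..m h}"
    proof
      fix k assume "k \<in> K"
      hence "Suc k * l h \<le> m h" by (simp add: K_def)
      moreover have "Suc k * 1 \<le> Suc k * l h" using l0[of h] by (intro mult_le_mono2) auto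
      ultimately show "k \<in> {..m h}" by simp
    qed
    hence finK: "finite K" by (rule finite_subset) simp
    have C0: "real ((2 * m h) choose m h) \<noteq> 0" by simp
    have "(\<Sum>k. b k h) = (\<Sum>k\<in>K. b k h)"
      by (rule suminf_finite[OF finK]) (simp add: K_def b_def)
    also have "\<dots> = (\<Sum>k\<in>K. real ((2 * m h) choose (m h + Suc k * l h))) / real ((2 * m h) choose m h)"
      unfolding sum_divide_distrib by (intro sum.cong) (auto simp: K_def b_def)
    finally have B: "(\<Sum>k\<in>K. real ((2 * m h) choose (m h + Suc k * l h))) = real ((2 * m h) choose m h) * (\<Sum>k. b k h)"
      using C0 by simp
    have "4 ^ m h * (1 + 2 * (\<Sum>j. a j h)) =
        real (l h) * (real ((2 * m h) choose m h) + 2 * (real ((2 * m h) choose m h) * (\<Sum>k. b k h)))"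
      using polya_identity[of "m h" h] unfolding sum_a B[symmetric] K_def l_def by simp
    thus ?thesis by (simp add: C_def field_simps)
  qed
  hence "(\<lambda>h. 1 + 2 * (\<Sum>j. a j h)) \<longlonglongrightarrow>
      1 / sqrt (pi * t) * (1 + 2 * (\<Sum>k. exp (- ((real (Suc k))\<^sup>2 / t))))"
    using tendsto_mult[OF lim_C lim_B] by simp
  thus ?thesis using LHS LIMSEQ_unique by blast
qed

section \<open>Uniqueness in weight 16\<close>

text \<open>1/2 = sin(pi/6) <= pi/6. The bound later places 2/pi below 3/4.\<close>

lemma pi_ge_3: "pi \<ge> 3"
  using sin_x_le_x[of "pi / 6"] sin_30 by simp

section \<open>Uniqueness of q-expansions\<close>

definition nome :: "complex \<Rightarrow> complex" where
  "nome z = exp (2 * of_real pi * \<i> * z)"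

lemma norm_nome: "norm (nome z) = exp (- 2 * pi * Im z)"
  by (simp add: nome_def)

lemma norm_nome_less_1: "z \<in> upper_half_plane \<Longrightarrow> norm (nome z) < 1"
  by (simp add: norm_nome upper_half_plane_def)

lemma nome_shift: "nome (z + of_int n) = nome z"
proof -
  have "nome (z + of_int n) = nome z * exp (of_int (2 * n) * of_real pi * \<i>)"
    by (simp add: nome_def exp_add[symmetric] algebra_simps)
  also have "exp (of_int (2 * n) * complex_of_real pi * \<i>) = 1"
    unfolding exp_eq_1 by (auto intro!: exI[of _ n])
  finally show ?thesis by simp
qed

lemma nome_surj:
  assumes "0 < norm w" "norm w < 1"
  obtains z where "z \<in> upper_half_plane" "nome z = w" "Im z = - ln (norm w) / (2 * pi)"
proof
  define z where "z = Ln w / (2 * of_real pi * \<i>)"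
  have w: "w \<noteq> 0" using assms by auto
  show nz: "nome z = w" using w by (simp add: nome_def z_def)
  have "norm w = exp (- 2 * pi * Im z)" using norm_nome[of z] nz by simp
  hence "ln (norm w) = - 2 * pi * Im z" by simp
  thus im: "Im z = - ln (norm w) / (2 * pi)" by (simp add: field_simps)
  have "ln (norm w) < 0" using assms by simp
  hence "0 < - ln (norm w) / (2 * pi)" by (intro divide_pos_pos) auto
  thus "z \<in> upper_half_plane" unfolding upper_half_plane_def mem_Collect_eq im .
qed

lemma has_q_expansion_nome:
  "has_q_expansion f a \<longleftrightarrow> (\<forall>z\<in>upper_half_plane. (\<lambda>n. a n * nome z ^ n) sums f z)"
  by (simp add: has_q_expansion_def nome_def)

lemma ball_subset_eball:
  assumes "r \<ge> 1"
  shows "ball x 1 \<subseteq> eball x r"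
proof
  fix y assume "y \<in> ball x 1"
  hence "ereal (dist x y) < 1" by (simp add: one_ereal_def)
  hence "ereal (dist x y) < r" using assms by (rule less_le_trans)
  thus "y \<in> eball x r" by (simp add: eball_def)
qed

lemma q_expansion_conv_radius:
  assumes "has_q_expansion f a"
  shows "fps_conv_radius (Abs_fps a) \<ge> 1"
proof -
  have "conv_radius a \<ge> ereal 1"
  proof (rule conv_radius_geI_ex')
    fix r :: real assume r: "0 < r" "ereal r < ereal 1"
    obtain z where z: "z \<in> upper_half_plane" "nome z = of_real r"
      by (rule nome_surj[of "of_real r"]) (use r in auto)
    thus "summable (\<lambda>n. a n * of_real r ^ n)"
      using assms unfolding has_q_expansion_nome by (metis sums_summable)
  qed
  thus ?thesis by (simp add: fps_conv_radius_def one_ereal_def)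
qed

lemma q_expansion_eval:
  assumes "has_q_expansion f a" "z \<in> upper_half_plane"
  shows "f z = eval_fps (Abs_fps a) (nome z)"
  using assms unfolding has_q_expansion_nome eval_fps_def by (auto simp: sums_iff)

text \<open>The nome maps onto the punctured unit disc, so the two power series agree there, and by
  continuity also at 0; a convergent power series is determined by its values near 0.\<close>

lemma q_expansion_unique:
  assumes "has_q_expansion f a" "has_q_expansion f b"
  shows "a = b"
proof -
  have "Abs_fps a = Abs_fps b"
  proof (rule eval_fps_eqD)
    show "fps_conv_radius (Abs_fps a) > 0" "fps_conv_radius (Abs_fps b) > 0"
      using q_expansion_conv_radius assms by (auto intro: less_le_trans[of 0 1])
    have away: "eval_fps (Abs_fps a) w = eval_fps (Abs_fps b) w" if w: "w \<noteq> 0" "norm w < 1" for w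
    proof -
      obtain z where "z \<in> upper_half_plane" "nome z = w" by (rule nome_surj[of w]) (use w in auto)
      thus ?thesis using q_expansion_eval assms by metis
    qed
    have cont: "continuous_on (ball 0 1) (eval_fps (Abs_fps c))" if "has_q_expansion f c" for c
      by (rule continuous_on_subset[OF continuous_on_eval_fps ball_subset_eball[OF q_expansion_conv_radius[OF that]]])
    have lim: "((\<lambda>w. eval_fps (Abs_fps c) w) \<longlongrightarrow> eval_fps (Abs_fps c) 0) (at 0)" if "has_q_expansion f c" for c
      using cont[OF that] by (simp add: continuous_on_eq_continuous_at isCont_def)
    have "eventually (\<lambda>w. w \<in> ball 0 1 - {0}) (at (0::complex))"
      by (rule eventually_at_in_open) auto
    hence "eventually (\<lambda>w. eval_fps (Abs_fps a) w = eval_fps (Abs_fps b) w) (at 0)"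
      by eventually_elim (use away in auto)
    hence "((\<lambda>w. eval_fps (Abs_fps b) w) \<longlongrightarrow> eval_fps (Abs_fps a) 0) (at 0)"
      using lim[OF assms(1)] by (rule Lim_transform_eventually[rotated])
    hence zero: "eval_fps (Abs_fps a) 0 = eval_fps (Abs_fps b) 0"
      using lim[OF assms(2)] by (rule tendsto_unique[rotated]) simp
    have "eventually (\<lambda>w. w \<in> ball 0 1) (nhds (0::complex))" by (rule eventually_nhds_in_open) auto
    thus "eventually (\<lambda>w. eval_fps (Abs_fps a) w = eval_fps (Abs_fps b) w) (nhds 0)"
    proof eventually_elim
      case (elim w)
      thus ?case using away[of w] zero by (cases "w = 0") auto
    qed
  qed
  thus ?thesis by (metis fps_nth_Abs_fps ext)
qed

lemma fourier_coeff_eqI: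
  assumes "has_q_expansion f a"
  shows "fourier_coeff f = a"
  unfolding fourier_coeff_def using assms q_expansion_unique by blast

section \<open>Reduction in the upper half-plane and the maximum principle\<close>

lemma Im_minus_inverse: "Im (- 1 / z) = Im z / (norm z)\<^sup>2"
  by (simp add: Im_divide cmod_power2)

lemma upper_half_plane_inversion:
  "z \<in> upper_half_plane \<Longrightarrow> - 1 / z \<in> upper_half_plane"
  unfolding upper_half_plane_def mem_Collect_eq Im_minus_inverse by (intro divide_pos_pos) auto

lemma upper_half_plane_shift:
  "z \<in> upper_half_plane \<Longrightarrow> z + of_int n \<in> upper_half_plane"
  by (simp add: upper_half_plane_def)

lemma q_expansion_periodic:
  assumes "has_q_expansion f a" "z \<in> upper_half_plane"
  shows "f (z + of_int n) = f z"
  using q_expansion_eval[OF assms(1)] assms(2) upper_half_plane_shift by (simp add: nome_shift)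

text \<open>Each step of the reduction algorithm multiplies the imaginary part by at least
  \<open>16/13\<close> as long as it is below \<open>3/4\<close>.\<close>

lemma reduce_to_large_Im:
  fixes \<phi> :: "complex \<Rightarrow> 'a"
  assumes shift: "\<And>z n. z \<in> upper_half_plane \<Longrightarrow> \<phi> (z + of_int n) = \<phi> z"
    and inv: "\<And>z. z \<in> upper_half_plane \<Longrightarrow> \<phi> (- 1 / z) = \<phi> z"
    and "z \<in> upper_half_plane"
  shows "\<exists>z'\<in>upper_half_plane. Im z' \<ge> 3/4 \<and> \<phi> z' = \<phi> z"
proof -
  have *: "\<exists>z'\<in>upper_half_plane. Im z' \<ge> 3/4 \<and> \<phi> z' = \<phi> z"
    if "z \<in> upper_half_plane" "Im z \<ge> (13/16)^n * (3/4)" for n z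
    using that
  proof (induction n arbitrary: z)
    case (Suc n)
    show ?case
    proof (cases "Im z \<ge> 3/4")
      case False
      define w where "w = z + of_int (- round (Re z))"
      have w: "w \<in> upper_half_plane" "Im w = Im z" "\<phi> w = \<phi> z"
        unfolding w_def using Suc.prems(1) by (rule upper_half_plane_shift, simp, rule shift)
      have "\<bar>Re w\<bar> \<le> 1 / 2"
        using of_int_round_abs_le[of "Re z"] by (simp add: w_def abs_minus_commute)
      hence "(Re w)\<^sup>2 \<le> (1/2)\<^sup>2" by (metis abs_le_square_iff abs_of_pos half_gt_zero_iff zero_less_one)
      moreover have "(Im w)\<^sup>2 \<le> (3/4)\<^sup>2"
        using False Suc.prems(1) w(2) by (intro power_mono) (auto simp: upper_half_plane_def)
      \<comment> \<open>13/16 = (1/2)^2 + (3/4)^2.\<close>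
      ultimately have nw: "(norm w)\<^sup>2 \<le> 13/16" unfolding cmod_power2 by (simp add: power_divide)
      have "w \<noteq> 0" using w(1) by (auto simp: upper_half_plane_def)
      have "(13/16)^n * (3/4) * (norm w)\<^sup>2 \<le> (13/16)^n * (3/4) * (13/16)"
        using nw by (intro mult_left_mono) auto
      also have "\<dots> \<le> Im w" using Suc.prems(2) w(2) by simp
      finally have "(13/16)^n * (3/4) \<le> Im (- 1 / w)"
        using \<open>w \<noteq> 0\<close> unfolding Im_minus_inverse by (simp add: pos_le_divide_eq)
      from Suc.IH[OF upper_half_plane_inversion[OF w(1)] this] show ?thesis
        using inv[OF w(1)] w(3) by simp
    qed (use Suc.prems in auto)
  qed auto
  have "Im z / (3/4) > 0" using assms(3) by (simp add: upper_half_plane_def)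
  hence "\<exists>n. (13/16 :: real)^n < Im z / (3/4)" by (intro real_arch_pow_inv) auto
  then obtain n where "(13/16 :: real)^n < Im z / (3/4)" by blast
  thus ?thesis by (intro *[OF assms(3), of n]) simp
qed

text \<open>Takes the place of the valence formula. Write g = q^2 h; the invariant function |g| y^8
  = |h| |q|^2 y^8 attains its maximum M at a point of height at least 3/4, whereas |q|^2 y^8 has its
  strict maximum at y = 2/pi. On the circle |q| = exp(-4) belonging to 2/pi one has |h| <= M /
  (|q|^2 y^8), so the maximum principle for h inside that circle is violated unless M = 0.\<close>

lemma weight_16_vanishing:
  fixes g :: "complex \<Rightarrow> complex"
  assumes q: "has_q_expansion g a" and a: "a 0 = 0" "a 1 = 0"
    and inv: "\<And>z. z \<in> upper_half_plane \<Longrightarrow> g (- 1 / z) = z ^ 16 * g z"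
    and z: "z \<in> upper_half_plane"
  shows "g z = 0"
proof -
  define F where "F = Abs_fps (\<lambda>n. a (n + 2))"
  define h where "h = eval_fps F"
  have F_shift: "F = fps_shift 2 (Abs_fps a)" by (simp add: F_def fps_eq_iff)
  have rad: "fps_conv_radius F \<ge> 1" unfolding F_shift using q_expansion_conv_radius[OF q] by simp
  have holh: "h holomorphic_on ball 0 1" unfolding h_def
    by (rule holomorphic_on_eval_fps[OF ball_subset_eball[OF rad]])
  have g_eq: "g z = nome z ^ 2 * h (nome z)" if "z \<in> upper_half_plane" for z
  proof -
    have a_eq: "Abs_fps a = fps_X ^ 2 * F"
    proof (rule fps_ext)
      fix n
      have "a n = (if n < 2 then 0 else a (n - 2 + 2))" using a by (cases n; cases "n - 1") auto
      thus "Abs_fps a $ n = (fps_X ^ 2 * F) $ n" by (simp add: fps_X_power_mult_nth F_def)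
    qed
    have "ereal (norm (nome z)) < 1" using norm_nome_less_1[OF that] by (simp add: one_ereal_def)
    hence "ereal (norm (nome z)) < fps_conv_radius F" using rad by (rule less_le_trans)
    thus ?thesis unfolding q_expansion_eval[OF q that] a_eq h_def by (subst eval_fps_mult) auto
  qed
  \<comment> \<open>This is |q|^2 y^8 in terms of r = |q|. The factor r^2 makes it continuous with
    value 0 at r = 0, so the cusp belongs to the compact disc on which the maximum is taken.\<close>
  define u where "u = (\<lambda>r::real. r\<^sup>2 * (- ln r / (2 * pi)) ^ 8)"
  have u_nome: "u (norm (nome z)) = norm (nome z) ^ 2 * Im z ^ 8" for z
    by (simp add: u_def norm_nome)
  define \<phi> where "\<phi> = (\<lambda>z. norm (g z) * Im z ^ 8)"
  have \<phi>_eq: "\<phi> z = norm (h (nome z)) * u (norm (nome z))" if "z \<in> upper_half_plane" for z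
    by (simp add: \<phi>_def g_eq[OF that] u_nome norm_mult norm_power)
  have \<phi>_shift: "\<phi> (z + of_int n) = \<phi> z" if "z \<in> upper_half_plane" for z n
    using q_expansion_periodic[OF q that] by (simp add: \<phi>_def)
  have \<phi>_inv: "\<phi> (- 1 / z) = \<phi> z" if "z \<in> upper_half_plane" for z
  proof -
    have "z \<noteq> 0" using that by (auto simp: upper_half_plane_def)
    thus ?thesis unfolding \<phi>_def inv[OF that] Im_minus_inverse
      by (simp add: norm_mult norm_power power_divide flip: power_mult)
  qed
  define \<rho> where "\<rho> = exp (- 2 * pi * (3/4))"
  have \<rho>: "0 < \<rho>" "\<rho> < 1" by (simp_all add: \<rho>_def)
  have cont_u: "continuous_on {0..} u"
  proof -
    have "continuous (at r within {0..}) u" if "r \<ge> 0" for r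
    proof (cases "r = 0")
      case True
      have "(u \<longlongrightarrow> 0) (at_right 0)" unfolding u_def by real_asymp
      thus ?thesis using True by (simp add: continuous_within at_within_Ici_at_right u_def)
    next
      case False
      hence "isCont u r" unfolding u_def using that by (intro continuous_intros) auto
      thus ?thesis by (rule continuous_at_imp_continuous_at_within)
    qed
    thus ?thesis by (simp add: continuous_on_eq_continuous_within)
  qed
  have "continuous_on (cball 0 \<rho>) (\<lambda>w. norm (h w) * u (norm w))"
  proof (intro continuous_intros)
    show "continuous_on (cball 0 \<rho>) h"
      by (rule continuous_on_subset[OF holomorphic_on_imp_continuous_on[OF holh]]) (use \<rho> in auto)
    show "continuous_on (cball 0 \<rho>) (\<lambda>w. u (norm w))"
      by (rule continuous_on_compose2[OF cont_u]) (auto intro!: continuous_intros)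
  qed
  then obtain w0 where w0: "w0 \<in> cball 0 \<rho>"
    and max: "\<And>w. w \<in> cball 0 \<rho> \<Longrightarrow> norm (h w) * u (norm w) \<le> norm (h w0) * u (norm w0)"
    using continuous_attains_sup[of "cball 0 \<rho>" "\<lambda>w. norm (h w) * u (norm w)"] \<rho> by auto
  define M where "M = norm (h w0) * u (norm w0)"
  have \<phi>_le: "\<phi> z \<le> M" if zH: "z \<in> upper_half_plane" for z
  proof -
    obtain z' where z': "z' \<in> upper_half_plane" "Im z' \<ge> 3/4" "\<phi> z' = \<phi> z"
      using reduce_to_large_Im[of \<phi>, OF \<phi>_shift \<phi>_inv zH] by blast
    have "norm (nome z') \<le> \<rho>" using z'(2) by (simp add: norm_nome \<rho>_def)
    hence "norm (h (nome z')) * u (norm (nome z')) \<le> M" unfolding M_def by (intro max) simp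
    thus ?thesis using z' \<phi>_eq by simp
  qed
  have "M = 0"
  proof (rule ccontr)
    assume "M \<noteq> 0"
    hence w0_ne: "w0 \<noteq> 0" by (auto simp: M_def u_def)
    obtain z0 where z0: "z0 \<in> upper_half_plane" "nome z0 = w0"
      by (rule nome_surj[of w0]) (use w0_ne w0 \<rho> in auto)
    define y0 where "y0 = Im z0"
    have "exp (- 2 * pi * y0) \<le> exp (- 2 * pi * (3/4))"
      using w0 norm_nome[of z0] unfolding z0 y0_def \<rho>_def by simp
    hence y0: "y0 \<ge> 3/4" by simp
    have M_pos: "M > 0" using \<open>M \<noteq> 0\<close> unfolding M_def u_def by (simp add: less_le zero_less_mult_iff)
    \<comment> \<open>The critical point of exp(-4 pi y) y^8, where -4 pi + 8 / y = 0.\<close>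
    define y1 where "y1 = 2 / pi"
    have y1: "0 < y1" "y1 < y0"
    proof -
      show "0 < y1" by (simp add: y1_def)
      have "2 / pi \<le> 2 / 3" using pi_ge_3 by (intro divide_left_mono) auto
      thus "y1 < y0" using y0 by (simp add: y1_def)
    qed
    define r1 where "r1 = exp (- 2 * pi * y1)"
    have r1: "0 < r1" "r1 < 1" using y1 by (simp_all add: r1_def)
    have r01: "norm w0 \<le> r1" using norm_nome[of z0] y1 unfolding z0 r1_def y0_def by simp
    have "norm (h w0) \<le> M / u r1"
    proof (rule maximum_modulus_frontier[of h "cball 0 r1"])
      show "h holomorphic_on interior (cball 0 r1)"
        by (rule holomorphic_on_subset[OF holh]) (use r1 in auto)
      show "continuous_on (closure (cball 0 r1)) h"
        by (rule continuous_on_subset[OF holomorphic_on_imp_continuous_on[OF holh]]) (use r1 in auto)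
      show "w0 \<in> cball 0 r1" using r01 by simp
      fix w :: complex assume "w \<in> frontier (cball 0 r1)"
      hence nw: "norm w = r1" using r1 by simp
      obtain z where z: "z \<in> upper_half_plane" "nome z = w"
        by (rule nome_surj[of w]) (use nw r1 in auto)
      have "u r1 > 0" using y1 by (simp add: u_def r1_def)
      thus "norm (h w) \<le> M / u r1"
        using \<phi>_le[OF z(1)] \<phi>_eq[OF z(1)] z(2) nw by (simp add: pos_le_divide_eq)
    qed auto
    moreover have u1: "u r1 > 0" using y1 by (simp add: u_def r1_def)
    ultimately have "norm (h w0) * u r1 \<le> norm (h w0) * u (norm w0)"
      unfolding M_def by (simp add: pos_le_divide_eq)
    moreover have "norm (h w0) > 0" using M_pos unfolding M_def by (auto intro: ccontr)
    ultimately have "u r1 \<le> u (norm w0)" by simp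
    hence le: "exp (- 2 * pi * y1) ^ 2 * y1 ^ 8 \<le> exp (- 2 * pi * y0) ^ 2 * y0 ^ 8"
      using u_nome[of z0] norm_nome[of z0] unfolding z0 y0_def by (simp add: u_def r1_def)
    define v where "v = y0 / y1"
    have v: "v > 1" using y1 by (simp add: v_def)
    have sq: "exp (- 2 * pi * y) ^ 2 = exp (- 4 * pi * y)" for y :: real
    proof -
      have "exp (- 2 * pi * y) ^ 2 = exp (- 2 * pi * y + - 2 * pi * y)"
        unfolding exp_add power2_eq_square ..
      thus ?thesis by simp
    qed
    have "exp (- 4 * pi * y1) = exp (- 4 * pi * y0) * exp (4 * pi * (y0 - y1))"
      unfolding exp_add[symmetric] by (simp add: algebra_simps)
    hence "exp (- 4 * pi * y0) * (exp (4 * pi * (y0 - y1)) * y1 ^ 8) \<le> exp (- 4 * pi * y0) * y0 ^ 8"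
      using le unfolding sq by (simp only: mult.assoc)
    hence "exp (4 * pi * (y0 - y1)) * y1 ^ 8 \<le> y0 ^ 8"
      by (subst (asm) mult_le_cancel_left_pos) simp_all
    hence "exp (4 * pi * (y0 - y1)) \<le> v ^ 8"
      using y1 by (simp add: v_def power_divide pos_le_divide_eq)
    \<comment> \<open>With y1 = 2/pi the inequality becomes exp(8 (v - 1)) <= v^8, that is v - 1 <=
      ln v, which holds only for v = 1.\<close>
    also have "4 * pi * (y0 - y1) = 8 * (v - 1)"
      by (simp add: v_def y1_def field_simps)
    finally have "ln (exp (8 * (v - 1))) \<le> ln (v ^ 8)" using v by (subst ln_le_cancel_iff) auto
    hence "v - 1 \<le> ln v" using v by (simp add: ln_realpow)
    moreover have "ln v \<le> v - 1" using v by (intro ln_le_minus_one) simp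
    ultimately show False using ln_eq_minus_one[of v] v by simp
  qed
  hence "\<phi> z \<le> 0" using \<phi>_le[OF z] by simp
  hence "norm (g z) * Im z ^ 8 \<le> 0" by (simp add: \<phi>_def)
  moreover have "Im z ^ 8 > 0" using z by (simp add: upper_half_plane_def)
  ultimately show ?thesis by (simp add: mult_le_0_iff)
qed

text \<open>Induction on \<open>\<bar>c\<bar>\<close>: writing \<open>d = kc + r\<close>, the matrix factors through \<open>z \<mapsto> -1/(z + k)\<close>.\<close>

lemma modular_of_generators:
  fixes f :: "complex \<Rightarrow> complex"
  assumes shift: "\<And>z n. z \<in> upper_half_plane \<Longrightarrow> f (z + of_int n) = f z"
    and inv: "\<And>z. z \<in> upper_half_plane \<Longrightarrow> f (- 1 / z) = z ^ 16 * f z"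
    and "a * d - b * c = 1" "z \<in> upper_half_plane"
  shows "f ((of_int a * z + of_int b) / (of_int c * z + of_int d)) =
    (of_int c * z + of_int d) ^ 16 * f z"
  using assms(3,4)
proof (induction "nat \<bar>c\<bar>" arbitrary: a b c d z rule: less_induct)
  case less
  show ?case
  proof (cases "c = 0")
    case True
    hence "a * d = 1" using less.prems by simp
    hence "a = 1 \<and> d = 1 \<or> a = -1 \<and> d = -1" by (simp add: zmult_eq_1_iff)
    thus ?thesis
    proof
      assume "a = 1 \<and> d = 1"
      thus ?thesis using True shift[OF less.prems(2), of b] by simp
    next
      assume "a = -1 \<and> d = -1"
      thus ?thesis using True shift[OF less.prems(2), of "-b"] by simp
    qed
  next
    case False
    define k r b' where "k = d div c" and "r = d mod c" and "b' = b - a * k"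
    define w where "w = z + of_int k"
    define v where "v = - 1 / w"
    have d: "d = c * k + r" by (simp add: k_def r_def)
    have w: "w \<in> upper_half_plane" unfolding w_def by (rule upper_half_plane_shift) fact
    hence w0: "w \<noteq> 0" by (auto simp: upper_half_plane_def)
    have v: "v \<in> upper_half_plane" unfolding v_def by (rule upper_half_plane_inversion) fact
    have r: "nat \<bar>r\<bar> < nat \<bar>c\<bar>" using False abs_mod_less[of c d] by (simp add: r_def)
    have "b' * (- c) - (- a) * r = 1"
      using less.prems(1) unfolding b'_def d by (simp add: algebra_simps)
    from less.hyps[OF r this v]
    have IH: "f ((of_int b' * v + of_int (- a)) / (of_int r * v + of_int (- c))) =
        (of_int r * v + of_int (- c)) ^ 16 * f v" .
    have num: "of_int b' * v + of_int (- a) = - (of_int a * z + of_int b) / w"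
      using w0 unfolding v_def b'_def by (simp add: field_simps w_def)
    have den: "of_int r * v + of_int (- c) = - (of_int c * z + of_int d) / w"
      using w0 unfolding v_def d by (simp add: field_simps w_def)
    have frac: "(- A / w) / (- B / w) = A / B" and fin: "(- B / w) ^ 16 * (w ^ 16 * x) = B ^ 16 * x" for A B x
      using w0 by (simp_all add: power_divide)
    have "f ((of_int a * z + of_int b) / (of_int c * z + of_int d)) =
        (- (of_int c * z + of_int d) / w) ^ 16 * f v"
      using IH unfolding num den frac .
    also have "f v = w ^ 16 * f w" unfolding v_def by (rule inv[OF w])
    also have "f w = f z" unfolding w_def by (rule shift) fact
    finally show ?thesis unfolding fin .
  qed
qed

section \<open>The cusp form\<close>

definition complex_fps :: "int fps \<Rightarrow> complex fps" where
  "complex_fps f = Abs_fps (\<lambda>n. of_int (f $ n))"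

lemma complex_fps_nth [simp]: "complex_fps f $ n = of_int (f $ n)"
  by (simp add: complex_fps_def)

lemma complex_fps_add: "complex_fps (f + g) = complex_fps f + complex_fps g"
  by (simp add: fps_eq_iff)

lemma complex_fps_diff: "complex_fps (f - g) = complex_fps f - complex_fps g"
  by (simp add: fps_eq_iff)

lemma complex_fps_mult: "complex_fps (f * g) = complex_fps f * complex_fps g"
  by (simp add: fps_eq_iff fps_mult_nth)

lemma complex_fps_numeral: "complex_fps (numeral k) = numeral k"
  by (rule fps_ext) (simp add: fps_numeral_nth)

lemma complex_fps_1: "complex_fps 1 = 1"
  by (rule fps_ext) simp

lemma complex_fps_X: "complex_fps fps_X = fps_X"
  by (rule fps_ext) simp

lemma complex_fps_power: "complex_fps (f ^ k) = complex_fps f ^ k"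
  by (induction k) (simp_all add: complex_fps_1 complex_fps_mult)

definition converges_on_disc :: "int fps \<Rightarrow> bool" where
  "converges_on_disc f \<longleftrightarrow> fps_conv_radius (complex_fps f) \<ge> 1"

definition eval_int_fps :: "int fps \<Rightarrow> complex \<Rightarrow> complex" where
  "eval_int_fps f = eval_fps (complex_fps f)"

lemma converges_on_disc_bounded:
  fixes f :: "int fps"
  assumes "\<And>n. \<bar>f $ n\<bar> \<le> B"
  shows "converges_on_disc f"
proof -
  have "conv_radius (fps_nth (complex_fps f)) \<ge> ereal 1"
  proof (rule conv_radius_geI_ex')
    fix r :: real assume r: "0 < r" "ereal r < ereal 1"
    show "summable (\<lambda>n. complex_fps f $ n * complex_of_real r ^ n)"
    proof (rule summable_comparison_test')
      show "summable (\<lambda>n. real_of_int B * r ^ n)" using r by (intro summable_mult summable_geometric) auto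
      fix n :: nat
      have "norm (complex_fps f $ n * complex_of_real r ^ n) = real_of_int \<bar>f $ n\<bar> * r ^ n"
        using r by (simp add: norm_mult norm_power)
      also have "\<dots> \<le> real_of_int B * r ^ n"
        using r assms[of n] by (intro mult_right_mono) auto
      finally show "norm (complex_fps f $ n * complex_of_real r ^ n) \<le> real_of_int B * r ^ n" .
    qed
  qed
  thus ?thesis by (simp add: converges_on_disc_def fps_conv_radius_def one_ereal_def)
qed

lemma converges_on_disc_add: "converges_on_disc f \<Longrightarrow> converges_on_disc g \<Longrightarrow> converges_on_disc (f + g)"
  unfolding converges_on_disc_def complex_fps_add
  by (rule order_trans[OF _ fps_conv_radius_add]) simp

lemma converges_on_disc_diff: "converges_on_disc f \<Longrightarrow> converges_on_disc g \<Longrightarrow> converges_on_disc (f - g)"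
  unfolding converges_on_disc_def complex_fps_diff
  by (rule order_trans[OF _ fps_conv_radius_diff]) simp

lemma converges_on_disc_mult: "converges_on_disc f \<Longrightarrow> converges_on_disc g \<Longrightarrow> converges_on_disc (f * g)"
  unfolding converges_on_disc_def complex_fps_mult
  by (rule order_trans[OF _ fps_conv_radius_mult]) simp

lemma converges_on_disc_power: "converges_on_disc f \<Longrightarrow> converges_on_disc (f ^ k)"
  unfolding converges_on_disc_def complex_fps_power
  by (rule order_trans[OF _ fps_conv_radius_power]) simp

lemma converges_on_disc_numeral: "converges_on_disc (numeral k)"
  unfolding converges_on_disc_def complex_fps_numeral by simp

lemma converges_on_disc_X: "converges_on_disc fps_X"
  unfolding converges_on_disc_def complex_fps_X by simp

lemmas converges_on_disc_intros = converges_on_disc_add converges_on_disc_diff converges_on_disc_mult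
  converges_on_disc_power converges_on_disc_numeral converges_on_disc_X

lemma converges_on_discD:
  assumes "converges_on_disc f" "norm w < 1"
  shows "ereal (norm w) < fps_conv_radius (complex_fps f)"
proof -
  have "ereal (norm w) < 1" using assms(2) by (simp add: one_ereal_def)
  thus ?thesis using assms(1) unfolding converges_on_disc_def by (rule less_le_trans)
qed

lemma eval_int_fps_sums:
  assumes "converges_on_disc f" "norm w < 1"
  shows "(\<lambda>n. of_int (f $ n) * w ^ n) sums eval_int_fps f w"
  using sums_eval_fps[OF converges_on_discD[OF assms]] by (simp add: eval_int_fps_def)

lemma eval_int_fps_add:
  "converges_on_disc f \<Longrightarrow> converges_on_disc g \<Longrightarrow> norm w < 1 \<Longrightarrow>
    eval_int_fps (f + g) w = eval_int_fps f w + eval_int_fps g w"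
  by (simp add: eval_int_fps_def complex_fps_add eval_fps_add converges_on_discD)

lemma eval_int_fps_diff:
  "converges_on_disc f \<Longrightarrow> converges_on_disc g \<Longrightarrow> norm w < 1 \<Longrightarrow>
    eval_int_fps (f - g) w = eval_int_fps f w - eval_int_fps g w"
  by (simp add: eval_int_fps_def complex_fps_diff eval_fps_diff converges_on_discD)

lemma eval_int_fps_mult:
  "converges_on_disc f \<Longrightarrow> converges_on_disc g \<Longrightarrow> norm w < 1 \<Longrightarrow>
    eval_int_fps (f * g) w = eval_int_fps f w * eval_int_fps g w"
  by (simp add: eval_int_fps_def complex_fps_mult eval_fps_mult converges_on_discD)

lemma eval_int_fps_power:
  "converges_on_disc f \<Longrightarrow> norm w < 1 \<Longrightarrow> eval_int_fps (f ^ k) w = eval_int_fps f w ^ k"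
  by (simp add: eval_int_fps_def complex_fps_power eval_fps_power converges_on_discD)

lemma eval_int_fps_numeral: "eval_int_fps (numeral k) w = numeral k"
  by (simp add: eval_int_fps_def complex_fps_numeral)

lemma eval_int_fps_X: "eval_int_fps fps_X w = w"
  by (simp add: eval_int_fps_def complex_fps_X)

lemmas eval_int_fps_simps = eval_int_fps_add eval_int_fps_diff eval_int_fps_mult eval_int_fps_power
  eval_int_fps_numeral eval_int_fps_X converges_on_disc_intros

lemma eval_int_fps_compose:
  assumes "converges_on_disc f" "norm w < 1" "k > 0"
  shows "eval_int_fps (f oo fps_X ^ k) w = eval_int_fps f (w ^ k)"
proof -
  have "norm (w ^ k) < 1" using assms by (simp add: norm_power power_less_one_iff)
  hence "(\<lambda>n. of_int (f $ n) * (w ^ k) ^ n) sums eval_int_fps f (w ^ k)"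
    by (rule eval_int_fps_sums[OF assms(1)])
  moreover have "of_int (f $ n) * (w ^ k) ^ n = of_int ((f oo fps_X ^ k) $ (k * n)) * w ^ (k * n)" for n
    using assms(3) by (simp add: fps_nth_compose_X_pow power_mult)
  ultimately have "(\<lambda>n. of_int ((f oo fps_X ^ k) $ (k * n)) * w ^ (k * n)) sums eval_int_fps f (w ^ k)"
    by simp
  hence "(\<lambda>n. of_int ((f oo fps_X ^ k) $ n) * w ^ n) sums eval_int_fps f (w ^ k)"
  proof (subst (asm) sums_mono_reindex)
    show "strict_mono (\<lambda>n. k * n)" using assms(3) by (simp add: strict_mono_def)
    show "of_int ((f oo fps_X ^ k) $ n) * w ^ n = 0" if "n \<notin> range (\<lambda>n. k * n)" for n
    proof -
      have "\<not> k dvd n" using that by (auto elim!: dvdE)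
      thus ?thesis using assms(3) by (simp add: fps_nth_compose_X_pow)
    qed
  qed
  thus ?thesis unfolding eval_int_fps_def eval_fps_def by (simp add: sums_iff)
qed

lemma holomorphic_eval_int_fps:
  assumes "converges_on_disc f" "g holomorphic_on A" "\<And>z. z \<in> A \<Longrightarrow> norm (g z) < 1"
  shows "(\<lambda>z. eval_int_fps f (g z)) holomorphic_on A"
proof -
  have "eval_fps (complex_fps f) holomorphic_on ball 0 1"
    using assms(1) unfolding converges_on_disc_def by (intro holomorphic_on_eval_fps ball_subset_eball)
  moreover have "g ` A \<subseteq> ball 0 1" using assms(3) by auto
  ultimately have "(eval_fps (complex_fps f) \<circ> g) holomorphic_on A"
    by (rule holomorphic_on_compose_gen[OF assms(2)])
  thus ?thesis unfolding o_def eval_int_fps_def .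
qed

lemma card_square_root: "card {a::int. a^2 = int n} \<le> 2"
proof (cases "\<exists>b. b^2 = int n")
  case True
  then obtain b where "b^2 = int n" by blast
  hence "{a. a^2 = int n} \<subseteq> {b, -b}" using power2_eq_iff[of _ b] by auto
  hence "card {a. a^2 = int n} \<le> card {b, -b}" by (rule card_mono[rotated]) simp
  also have "\<dots> \<le> 2" by (simp add: card_insert_le_m1)
  finally show ?thesis .
next
  case False
  hence "{a. a^2 = int n} = {}" by auto
  thus ?thesis by (simp only: card.empty)
qed

lemma converges_theta_x: "converges_on_disc theta_x_fps"
  using card_square_root by (intro converges_on_disc_bounded[of _ 2]) (simp add: theta_x_fps_def)

lemma abs_theta_y_nth: "\<bar>theta_y_fps $ n\<bar> \<le> 1"
proof -
  have "a = b" if "a^2 + a = n" "b^2 + b = n" for a b :: nat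
  proof (rule ccontr)
    have less: "c^2 + c < d^2 + d" if "c < d" for c d :: nat
      using that power_strict_mono[of c d 2] by simp
    assume "a \<noteq> b"
    hence "a < b \<or> b < a" by linarith
    thus False using less[of a b] less[of b a] that by auto
  qed
  hence uniq: "\<forall>a\<in>{a. a^2 + a = n}. \<forall>b\<in>{a. a^2 + a = n}. a = b" by blast
  have "finite {a::nat. a^2 + a = n}" by (rule finite_subset[of _ "{..n}"]) auto
  hence "card {a::nat. a^2 + a = n} \<le> Suc 0" using card_le_Suc0_iff_eq uniq by blast
  thus ?thesis by (simp add: theta_y_fps_def)
qed

lemma converges_theta_y: "converges_on_disc theta_y_fps"
  by (rule converges_on_disc_bounded) (rule abs_theta_y_nth)

lemma converges_compose:
  fixes f :: "int fps"
  assumes "\<And>n. \<bar>f $ n\<bar> \<le> 2" "k > 0"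
  shows "converges_on_disc (f oo fps_X ^ k)"
  using assms by (intro converges_on_disc_bounded[of _ 2]) (simp add: fps_nth_compose_X_pow)

text \<open>Separates even and odd n in the sum of X^(n^2); this becomes
  \<open>theta_x_plus_theta_y\<close>. Index n is compared with index 2 n of the earlier series
  because those carry the factor 2 in the exponent.\<close>

lemma theta_parity_split: "theta_x_fps = (theta_x_fps oo fps_X ^ 4) + 2 * fps_X * (theta_y_fps oo fps_X ^ 4)"
proof (rule fps_ext)
  fix n
  have fin: "finite {a \<in> A. a^2 = int n}" for A
    by (rule finite_subset[OF _ finite_square_eq[of 1 n]]) auto
  have eq: "{a::int. a^2 = int n} = {a \<in> evens. a^2 = int n} \<union> {a \<in> odds. a^2 = int n}" by auto
  have "card {a::int. a^2 = int n} = card {a \<in> evens. a^2 = int n} + card {a \<in> odds. a^2 = int n}"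
    unfolding eq by (rule card_Un_disjoint[OF fin fin]) auto
  hence "theta_x_fps $ n = int (card {a \<in> evens. a^2 = int n}) + int (card {a \<in> odds. a^2 = int n})"
    unfolding theta_x_fps_def fps_nth_Abs_fps by simp
  also have "int (card {a \<in> evens. a^2 = int n}) = theta_fps evens 2 $ (2 * n)" by (simp add: theta_fps_def)
  also have "\<dots> = (theta_x_fps oo fps_X ^ 4) $ n"
  proof -
    have "8 dvd 2 * n \<longleftrightarrow> 4 dvd n" "2 * n div 8 = n div 4" by presburger+
    thus ?thesis unfolding theta_x_fps_compose[symmetric] by (simp add: fps_nth_compose_X_pow)
  qed
  also have "int (card {a \<in> odds. a^2 = int n}) = theta_fps odds 2 $ (2 * n)" by (simp add: theta_fps_def)
  also have "\<dots> = (2 * fps_X * (theta_y_fps oo fps_X ^ 4)) $ n"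
  proof (cases n)
    case 0
    thus ?thesis unfolding theta_y_fps_compose[symmetric]
      by (simp add: mult.assoc numeral_fps_mult_nth fps_X_power_mult_nth)
  next
    case (Suc m)
    have "8 dvd 2 * m \<longleftrightarrow> 4 dvd m" "2 * m div 8 = m div 4" by presburger+
    thus ?thesis unfolding theta_y_fps_compose[symmetric] Suc
      by (simp add: mult.assoc numeral_fps_mult_nth fps_X_power_mult_nth fps_nth_compose_X_pow)
  qed
  finally show "theta_x_fps $ n = ((theta_x_fps oo fps_X ^ 4) + 2 * fps_X * (theta_y_fps oo fps_X ^ 4)) $ n"
    by simp
qed

section \<open>Theta functions on the upper half-plane\<close>

text \<open>Jacobi's theta function, a power series in exp(pi i z) = q^(1/2): in this normalisation
  z -> -1/z carries it to itself up to a factor.\<close>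

definition theta3 :: "complex \<Rightarrow> complex" where
  "theta3 z = eval_int_fps theta_x_fps (exp (of_real pi * \<i> * z))"

lemma norm_exp_less_1: "z \<in> upper_half_plane \<Longrightarrow> c > 0 \<Longrightarrow> norm (exp (of_real (c * pi) * \<i> * z)) < 1"
  by (simp add: upper_half_plane_def)

lemma theta_x_real_sums:
  fixes r :: real
  assumes "0 < r" "r < 1"
  shows "eval_int_fps theta_x_fps (of_real r) = of_real (1 + 2 * (\<Sum>k. r ^ (Suc k)\<^sup>2))"
proof -
  let ?f = "\<lambda>n. of_int (theta_x_fps $ n) * complex_of_real r ^ n"
  have nr: "norm (complex_of_real r) < 1" using assms by simp
  have coeff: "theta_x_fps $ (k\<^sup>2) = (if k = 0 then 1 else 2)" for k
  proof -
    have "{a::int. a^2 = int (k\<^sup>2)} = {int k, - int k}" using power2_eq_iff[of _ "int k"] by auto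
    thus ?thesis by (simp add: theta_x_fps_def)
  qed
  have "(\<lambda>k. ?f (k\<^sup>2)) sums eval_int_fps theta_x_fps (of_real r)"
  proof (subst sums_mono_reindex)
    show "strict_mono (\<lambda>k::nat. k\<^sup>2)" by (simp add: strict_mono_def power_strict_mono)
    show "?f n = 0" if "n \<notin> range (\<lambda>k. k\<^sup>2)" for n
    proof -
      have "{a::int. a^2 = int n} = {}"
      proof -
        have False if "a^2 = int n" for a :: int
        proof -
          have "int ((nat \<bar>a\<bar>)\<^sup>2) = int n" using that by simp
          hence "n = (nat \<bar>a\<bar>)\<^sup>2" by (simp only: of_nat_eq_iff)
          thus False using \<open>n \<notin> range (\<lambda>k. k\<^sup>2)\<close> by blast
        qed
        thus ?thesis by auto
      qed
      thus ?thesis by (simp add: theta_x_fps_def)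
    qed
  qed (rule eval_int_fps_sums[OF converges_theta_x nr])
  hence "(\<lambda>k. ?f ((Suc k)\<^sup>2)) sums (eval_int_fps theta_x_fps (of_real r) - 1)"
    using coeff[of 0] by (subst sums_Suc_iff) simp
  hence "(\<lambda>k. (1 / 2) * ?f ((Suc k)\<^sup>2)) sums ((1 / 2) * (eval_int_fps theta_x_fps (of_real r) - 1))"
    by (rule sums_mult)
  hence "(\<lambda>k. complex_of_real (r ^ (Suc k)\<^sup>2)) sums ((1 / 2) * (eval_int_fps theta_x_fps (of_real r) - 1))"
    by (simp add: coeff del: power_Suc)
  moreover from this have "summable (\<lambda>k. r ^ (Suc k)\<^sup>2)"
    using summable_of_real_iff sums_summable by blast
  hence "(\<lambda>k. complex_of_real (r ^ (Suc k)\<^sup>2)) sums complex_of_real (\<Sum>k. r ^ (Suc k)\<^sup>2)"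
    by (intro sums_of_real summable_sums)
  ultimately have "(1 / 2) * (eval_int_fps theta_x_fps (of_real r) - 1) = complex_of_real (\<Sum>k. r ^ (Suc k)\<^sup>2)"
    by (rule sums_unique2)
  thus ?thesis by (simp add: field_simps)
qed

lemma theta3_imaginary:
  assumes "t > 0"
  shows "theta3 (\<i> * of_real t) = of_real (1 + 2 * (\<Sum>k. exp (- (pi * (real (Suc k))\<^sup>2 * t))))"
proof -
  have "exp (of_real pi * \<i> * (\<i> * of_real t)) = complex_of_real (exp (- (pi * t)))"
    by (simp add: exp_of_real[symmetric] algebra_simps)
  hence "theta3 (\<i> * of_real t) = of_real (1 + 2 * (\<Sum>k. exp (- (pi * t)) ^ (Suc k)\<^sup>2))"
    using theta_x_real_sums[of "exp (- (pi * t))"] assms by (simp add: theta3_def)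
  moreover have "exp (- (pi * t)) ^ (Suc k)\<^sup>2 = exp (- (pi * (real (Suc k))\<^sup>2 * t))" for k
    unfolding exp_of_nat_mult[symmetric] by (simp del: of_nat_Suc add: algebra_simps)
  ultimately show ?thesis by (simp only:)
qed

lemma theta3_inversion_imaginary:
  assumes "t > 0"
  shows "theta3 (\<i> * of_real (1 / t)) = of_real (sqrt t) * theta3 (\<i> * of_real t)"
proof -
  have "1 + 2 * (\<Sum>k. exp (- (pi\<^sup>2 * (real (Suc k))\<^sup>2 * (t / pi)))) =
      1 / sqrt (pi * (t / pi)) * (1 + 2 * (\<Sum>k. exp (- ((real (Suc k))\<^sup>2 / (t / pi)))))"
    using assms by (intro real_theta_inversion) simp
  moreover have "pi\<^sup>2 * (real (Suc k))\<^sup>2 * (t / pi) = pi * (real (Suc k))\<^sup>2 * t" for k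
    by (simp add: power2_eq_square)
  moreover have "(real (Suc k))\<^sup>2 / (t / pi) = pi * (real (Suc k))\<^sup>2 * (1 / t)" for k
    by simp
  ultimately have "1 + 2 * (\<Sum>k. exp (- (pi * (real (Suc k))\<^sup>2 * t))) =
      1 / sqrt t * (1 + 2 * (\<Sum>k. exp (- (pi * (real (Suc k))\<^sup>2 * (1 / t)))))"
    by (simp only:) simp
  hence "1 + 2 * (\<Sum>k. exp (- (pi * (real (Suc k))\<^sup>2 * (1 / t)))) =
      sqrt t * (1 + 2 * (\<Sum>k. exp (- (pi * (real (Suc k))\<^sup>2 * t))))"
    using assms by simp
  thus ?thesis using theta3_imaginary[of t] theta3_imaginary[of "1 / t"] assms by (simp only: of_real_mult[symmetric] zero_less_divide_1_iff)
qed

lemma theta3_holomorphic: "theta3 holomorphic_on upper_half_plane"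
  unfolding theta3_def
  by (intro holomorphic_eval_int_fps converges_theta_x holomorphic_intros)
    (use norm_exp_less_1[of _ 1] in simp)

lemma open_upper_half_plane: "open upper_half_plane"
  unfolding upper_half_plane_def by (rule open_halfspace_Im_gt)

lemma connected_upper_half_plane: "connected upper_half_plane"
  unfolding upper_half_plane_def by (intro convex_connected convex_halfspace_Im_gt)

lemma minus_ii_mult_not_nonpos:
  "z \<in> upper_half_plane \<Longrightarrow> - (\<i> * z) \<notin> \<real>\<^sub>\<le>\<^sub>0"
  by (auto simp: upper_half_plane_def complex_nonpos_Reals_iff)

text \<open>Identity theorem: the two sides agree on the imaginary axis, and the principal root is
  holomorphic because - \<i> * z has positive real part on the half-plane.\<close>

lemma theta3_inversion:
  assumes "z \<in> upper_half_plane"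
  shows "theta3 (- 1 / z) = csqrt (- (\<i> * z)) * theta3 z"
proof -
  define D where "D = (\<lambda>z. theta3 (- 1 / z) - csqrt (- (\<i> * z)) * theta3 z)"
  define U where "U = {z::complex. Re z = 0 \<and> Im z > 0}"
  have ne: "z \<noteq> 0" if "z \<in> upper_half_plane" for z using that by (auto simp: upper_half_plane_def)
  have "D z = 0"
  proof (rule analytic_continuation[of D upper_half_plane U \<i>])
    have "(\<lambda>z. - 1 / z) holomorphic_on upper_half_plane"
      using ne by (intro holomorphic_intros) auto
    from holomorphic_on_compose_gen[OF this theta3_holomorphic]
    have "(\<lambda>z. theta3 (- 1 / z)) holomorphic_on upper_half_plane"
      using upper_half_plane_inversion by (auto simp: o_def)
    moreover have "(\<lambda>z. csqrt (- (\<i> * z))) holomorphic_on upper_half_plane"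
      using minus_ii_mult_not_nonpos by (intro holomorphic_intros) auto
    ultimately show "D holomorphic_on upper_half_plane"
      unfolding D_def by (intro holomorphic_on_diff holomorphic_on_mult theta3_holomorphic)
    show "U \<subseteq> upper_half_plane" by (auto simp: U_def upper_half_plane_def)
    show "\<i> islimpt U" unfolding islimpt_approachable
    proof (intro allI impI)
      fix e :: real assume "e > 0"
      thus "\<exists>x'\<in>U. x' \<noteq> \<i> \<and> dist x' \<i> < e"
        by (intro bexI[of _ "Complex 0 (1 + e / 2)"])
          (auto simp: U_def complex_eq_iff dist_norm cmod_def)
    qed
    show "D w = 0" if "w \<in> U" for w
    proof -
      define t where "t = Im w"
      have t: "t > 0" "w = \<i> * of_real t" using that by (auto simp: t_def U_def complex_eq_iff)
      have "- 1 / w = \<i> * of_real (1 / t)" unfolding t(2) using t(1) by (simp add: field_simps)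
      moreover have "csqrt (- (\<i> * w)) = of_real (sqrt t)"
        unfolding t(2) using t(1) by (simp flip: mult.assoc)
      ultimately show ?thesis unfolding D_def using theta3_inversion_imaginary[OF t(1)] t(2) by simp
    qed
  qed (use assms open_upper_half_plane connected_upper_half_plane in \<open>auto simp: upper_half_plane_def\<close>)
  thus ?thesis by (simp add: D_def)
qed

definition theta_x :: "complex \<Rightarrow> complex" where
  "theta_x z = eval_int_fps theta_x_fps (nome z)"

definition theta_y :: "complex \<Rightarrow> complex" where
  "theta_y z = 2 * exp (of_real pi * \<i> * z / 2) * eval_int_fps theta_y_fps (nome z)"

lemma theta_x_eq: "theta_x z = theta3 (2 * z)"
  by (simp add: theta_x_def theta3_def nome_def mult_ac)

lemma theta_x_plus_theta_y:
  assumes "z \<in> upper_half_plane"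
  shows "theta_x z + theta_y z = theta3 (z / 2)"
proof -
  define w where "w = exp (of_real pi * \<i> * (z / 2))"
  have w: "norm w < 1" using norm_exp_less_1[OF assms, of "1/2"] by (simp add: w_def mult_ac)
  have w4: "w ^ 4 = nome z"
    unfolding w_def nome_def exp_of_nat_mult[symmetric] by (simp add: mult_ac)
  have bx: "\<bar>theta_x_fps $ n\<bar> \<le> 2" for n using card_square_root by (simp add: theta_x_fps_def)
  have x4: "converges_on_disc (theta_x_fps oo fps_X ^ 4)" by (rule converges_compose[OF bx]) simp
  have "\<bar>theta_y_fps $ n\<bar> \<le> 2" for n using abs_theta_y_nth[of n] by linarith
  hence y4: "converges_on_disc (theta_y_fps oo fps_X ^ 4)" by (rule converges_compose) simp
  have "theta3 (z / 2) = eval_int_fps theta_x_fps w" by (simp add: theta3_def w_def)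
  also have "\<dots> = eval_int_fps ((theta_x_fps oo fps_X ^ 4) + 2 * fps_X * (theta_y_fps oo fps_X ^ 4)) w"
    by (subst theta_parity_split) simp
  also have "\<dots> = eval_int_fps theta_x_fps (w ^ 4) + 2 * w * eval_int_fps theta_y_fps (w ^ 4)"
    using w x4 y4 by (simp add: eval_int_fps_simps eval_int_fps_compose converges_theta_x converges_theta_y)
  finally show ?thesis unfolding w4 by (simp add: theta_x_def theta_y_def w_def)
qed

text \<open>x is theta3 at 2z and x + y is theta3 at z/2. The inversion of theta3 at z/2 gives
  x(-1/z), the one at 2z gives (x + y)(-1/z) = 2 \<kappa> x(z), and subtraction yields
  y(-1/z).\<close>

lemma theta_xy_inversion:
  assumes "z \<in> upper_half_plane"
  defines "\<kappa> \<equiv> csqrt (- (\<i> * (z / 2)))"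
  shows "theta_x (- 1 / z) = \<kappa> * (theta_x z + theta_y z)"
    and "theta_y (- 1 / z) = \<kappa> * (theta_x z - theta_y z)"
proof -
  have H: "z / 2 \<in> upper_half_plane" "2 * z \<in> upper_half_plane" "- 1 / z \<in> upper_half_plane"
    using assms(1) upper_half_plane_inversion[OF assms(1)] by (auto simp: upper_half_plane_def)
  have "theta_x (- 1 / z) = theta3 (- 1 / (z / 2))" by (simp add: theta_x_eq)
  also have "\<dots> = \<kappa> * (theta_x z + theta_y z)"
    unfolding theta3_inversion[OF H(1)] theta_x_plus_theta_y[OF assms(1)] \<kappa>_def ..
  finally show 1: "theta_x (- 1 / z) = \<kappa> * (theta_x z + theta_y z)" .
  have "theta_x (- 1 / z) + theta_y (- 1 / z) = theta3 (- 1 / (2 * z))"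
    unfolding theta_x_plus_theta_y[OF H(3)] by (simp add: mult.commute)
  also have "\<dots> = csqrt (- (\<i> * (2 * z))) * theta_x z"
    unfolding theta3_inversion[OF H(2)] theta_x_eq ..
  \<comment> \<open>This factor 4 expresses the square root for 2z through \<kappa>, the one for
    z/2; the principal branch fixes the sign.\<close>
  also have "- (\<i> * (2 * z)) = of_real 4 * (- (\<i> * (z / 2)))" by simp
  also have "csqrt \<dots> = 2 * \<kappa>"
  proof (rule csqrt_unique)
    show "(2 * \<kappa>)\<^sup>2 = of_real 4 * (- (\<i> * (z / 2)))" by (simp add: \<kappa>_def power_mult_distrib)
    show "0 < Re (2 * \<kappa>) \<or> Re (2 * \<kappa>) = 0 \<and> 0 \<le> Im (2 * \<kappa>)"
      using csqrt_principal[of "- (\<i> * (z / 2))"] unfolding \<kappa>_def[symmetric] by simp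
  qed
  finally show "theta_y (- 1 / z) = \<kappa> * (theta_x z - theta_y z)" unfolding 1 by (simp add: algebra_simps)
qed

section \<open>The invariant polynomial and modularity\<close>

text \<open>The first factor is the weight enumerator of the extended Hamming code, which gives E_4;
  the rest is the fourth power of the octahedral form x y (x^4 - y^4), which gives 16 Delta.\<close>

definition theta_invariant :: "'a::comm_ring_1 \<Rightarrow> 'a \<Rightarrow> 'a" where
  "theta_invariant x y = (x^8 + 14 * x^4 * y^4 + y^8) * x^4 * y^4 * (x^4 - y^4)^4"

lemma theta_invariant_scale:
  fixes k x y :: "'a::comm_ring_1"
  shows "theta_invariant (k * x) (k * y) = k ^ 32 * theta_invariant x y"
proof -
  have "(K^2 * X^2 + 14 * (K * X) * (K * Y) + K^2 * Y^2) * (K * X) * (K * Y) * (K * X - K * Y)^4 =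
      K^8 * ((X^2 + 14 * X * Y + Y^2) * X * Y * (X - Y)^4)" for K X Y :: 'a
    by (simp add: eval_nat_numeral algebra_simps)
  from this[of "k^4" "x^4" "y^4"] show ?thesis
    by (simp add: theta_invariant_def power_mult_distrib flip: power_mult)
qed

text \<open>Up to constants, the substitution fixes the octic and x^2 + y^2 and swaps x y with x^2 -
  y^2. The constants multiply to 16 * 8^4 = 2^16.\<close>

lemma theta_invariant_plus_minus:
  fixes x y :: "'a::comm_ring_1"
  shows "theta_invariant (x + y) (x - y) = 2 ^ 16 * theta_invariant x y"
proof -
  have 1: "(x + y)^8 + 14 * (x + y)^4 * (x - y)^4 + (x - y)^8 = 16 * (x^8 + 14 * x^4 * y^4 + y^8)" by (simp add: eval_nat_numeral algebra_simps)
  have 2: "(x + y)^4 - (x - y)^4 = 8 * x * y * (x^2 + y^2)" by (simp add: eval_nat_numeral algebra_simps)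
  have 3: "(x + y)^4 * (x - y)^4 = (x^2 - y^2)^4" by (simp add: eval_nat_numeral algebra_simps)
  have 4: "x^4 - y^4 = (x^2 - y^2) * (x^2 + y^2)" by (simp add: eval_nat_numeral algebra_simps)
  have 5: "16 * A * B^4 * (8 * x * y * C)^4 = 2 ^ 16 * (A * x^4 * y^4 * (B * C)^4)" for A B C
    by (simp add: power_mult_distrib mult_ac)
  have "theta_invariant (x + y) (x - y) =
      16 * (x^8 + 14 * x^4 * y^4 + y^8) * ((x + y)^4 * (x - y)^4) * (8 * x * y * (x^2 + y^2))^4"
    unfolding theta_invariant_def 1 2 by (simp only: mult.assoc)
  thus ?thesis unfolding 3 5 theta_invariant_def 4 .
qed

definition delta16_form :: "complex \<Rightarrow> complex" where
  "delta16_form z = (if z \<in> upper_half_plane then eval_int_fps delta16_fps (nome z) else 0)"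

lemma converges_delta16: "converges_on_disc delta16_fps"
  unfolding delta16_fps_def Let_def
  by (intro converges_on_disc_intros converges_theta_x converges_theta_y)

lemma delta16_form_theta:
  assumes "z \<in> upper_half_plane"
  shows "16 * delta16_form z = theta_invariant (theta_x z) (theta_y z)"
proof -
  note conv = converges_theta_x converges_theta_y
  define s r where "s = theta_x z ^ 4" and "r = nome z * eval_int_fps theta_y_fps (nome z) ^ 4"
  have "exp (of_real pi * \<i> * z / 2) ^ 4 = nome z"
    unfolding nome_def exp_of_nat_mult[symmetric] by (simp add: mult_ac)
  hence y4: "theta_y z ^ 4 = 16 * r" by (simp add: theta_y_def r_def power_mult_distrib)
  have "delta16_form z = (s^2 + 224 * s * r + 256 * r^2) * s * r * (s - 16 * r) ^ 4"
    using assms norm_nome_less_1[OF assms] unfolding delta16_form_def delta16_fps_def Let_def s_def r_def theta_x_def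
    by (simp add: eval_int_fps_simps conv)
  moreover have "theta_invariant (theta_x z) (theta_y z) =
      (s^2 + 14 * s * (16 * r) + (16 * r)^2) * s * (16 * r) * (s - 16 * r)^4"
    unfolding theta_invariant_def y4[symmetric] s_def by (simp flip: power_mult)
  ultimately show ?thesis by (simp add: power_mult_distrib)
qed

lemma delta16_form_q_expansion: "has_q_expansion delta16_form (\<lambda>n. of_int (delta16_fps $ n))"
  unfolding has_q_expansion_nome
  using eval_int_fps_sums[OF converges_delta16] norm_nome_less_1 by (simp add: delta16_form_def)

text \<open>Degree 32 turns the factor \<kappa> into \<kappa>^32 = (z/2)^16, since \<i>^16 = 1; the
  2^16 of \<open>theta_invariant_plus_minus\<close> removes the denominator.\<close>

lemma delta16_form_inversion:
  assumes "z \<in> upper_half_plane"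
  shows "delta16_form (- 1 / z) = z ^ 16 * delta16_form z"
proof -
  define \<kappa> where "\<kappa> = csqrt (- (\<i> * (z / 2)))"
  have \<kappa>: "\<kappa> ^ 32 * 2 ^ 16 = z ^ 16"
  proof -
    have "\<kappa> ^ 32 = (\<kappa>\<^sup>2) ^ 16" by (simp flip: power_mult)
    also have "\<kappa>\<^sup>2 = - (\<i> * (z / 2))" by (simp add: \<kappa>_def)
    also have "(- (\<i> * (z / 2))) ^ 16 = z ^ 16 / 2 ^ 16"
    proof -
      have "\<i> ^ 16 = (1::complex)" using power_mult[of \<i> 4 4] by simp
      thus ?thesis by (simp add: power_mult_distrib power_divide)
    qed
    finally show ?thesis by simp
  qed
  have "16 * delta16_form (- 1 / z) =
      theta_invariant (\<kappa> * (theta_x z + theta_y z)) (\<kappa> * (theta_x z - theta_y z))"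
    using theta_xy_inversion[OF assms] upper_half_plane_inversion[OF assms]
    by (simp only: delta16_form_theta \<kappa>_def)
  also have "\<dots> = (\<kappa> ^ 32 * 2 ^ 16) * (16 * delta16_form z)"
    unfolding theta_invariant_scale theta_invariant_plus_minus delta16_form_theta[OF assms] by (simp only: mult.assoc)
  finally show ?thesis unfolding \<kappa> by simp
qed

text \<open>Invariance under translations comes from the expansion in integral powers of q, so only
  the inversion needs the theta functions.\<close>

lemma delta16_form_modular: "delta16_form \<in> modular_forms 16"
proof -
  have "delta16_form holomorphic_on upper_half_plane"
  proof (rule holomorphic_transform)
    show "(\<lambda>z. eval_int_fps delta16_fps (nome z)) holomorphic_on upper_half_plane"
      unfolding nome_def
      by (intro holomorphic_eval_int_fps converges_delta16 holomorphic_intros)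
        (use norm_nome_less_1 in \<open>simp add: nome_def\<close>)
  qed (simp add: delta16_form_def)
  moreover have "delta16_form ((of_int a * z + of_int b) / (of_int c * z + of_int d)) =
      (of_int c * z + of_int d) powi 16 * delta16_form z"
    if "a * d - b * c = 1" "z \<in> upper_half_plane" for a b c d z
    using modular_of_generators[OF q_expansion_periodic[OF delta16_form_q_expansion] delta16_form_inversion that]
    by simp
  ultimately show ?thesis unfolding modular_forms_def
    using delta16_form_q_expansion by (auto simp: delta16_form_def)
qed

section \<open>Identification of the cusp form and the congruences\<close>

lemma delta16_fps_low: "delta16_fps $ 0 = 0" "delta16_fps $ 1 = 1"
proof -
  have x0: "theta_x_fps $ 0 = 1" by (simp add: theta_x_fps_def)
  have y0: "theta_y_fps $ 0 = 1" by (simp add: theta_y_fps_def)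
  define s where "s = theta_x_fps ^ 4"
  define G where "G = (s^2 + 224 * s * (fps_X * theta_y_fps ^ 4) + 256 * (fps_X * theta_y_fps ^ 4)^2) * s
    * theta_y_fps ^ 4 * (s - 16 * (fps_X * theta_y_fps ^ 4)) ^ 4"
  have eq: "delta16_fps = fps_X * G"
    unfolding delta16_fps_def Let_def G_def s_def by (simp only: mult_ac)
  have G0: "G $ 0 = 1"
    by (simp add: G_def s_def x0 y0 fps_power_zeroth)
  show "delta16_fps $ 0 = 0" "delta16_fps $ 1 = 1" unfolding eq by (simp_all add: G0)
qed

lemma cusp_forms_16_unique:
  assumes "f \<in> cusp_forms 16" "g \<in> cusp_forms 16" "fourier_coeff f 1 = fourier_coeff g 1"
  shows "f = g"
proof
  fix z
  obtain a b where a: "has_q_expansion f a" and b: "has_q_expansion g b"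
    using assms(1,2) by (auto simp: cusp_forms_def modular_forms_def)
  show "f z = g z"
  proof (cases "z \<in> upper_half_plane")
    case True
    have inv: "h (- 1 / z) = z ^ 16 * h z" if "h \<in> cusp_forms 16" "z \<in> upper_half_plane" for h z
    proof -
      have "\<forall>a b c d :: int. a * d - b * c = 1 \<longrightarrow> (\<forall>z\<in>upper_half_plane.
          h ((of_int a * z + of_int b) / (of_int c * z + of_int d)) = (of_int c * z + of_int d) powi 16 * h z)"
        using that(1) by (simp add: cusp_forms_def modular_forms_def)
      \<comment> \<open>The variables occur in the order a, d, b, c in the determinant condition, so
        this is the matrix with a = d = 0, b = -1, c = 1.\<close>
      from this[rule_format, of 0 0 "-1" 1 z] that(2) show ?thesis by simp
    qed
    have "f z - g z = 0"
    proof (rule weight_16_vanishing[of "\<lambda>z. f z - g z" "\<lambda>n. a n - b n"])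
      show "has_q_expansion (\<lambda>z. f z - g z) (\<lambda>n. a n - b n)"
        using a b unfolding has_q_expansion_def by (auto simp: left_diff_distrib intro!: sums_diff)
      show "a 0 - b 0 = 0" "a 1 - b 1 = 0"
        using assms fourier_coeff_eqI[OF a] fourier_coeff_eqI[OF b] by (auto simp: cusp_forms_def)
    qed (use True inv assms(1,2) in \<open>auto simp: algebra_simps\<close>)
    thus ?thesis by simp
  next
    case False
    thus ?thesis using assms(1,2) by (simp add: cusp_forms_def modular_forms_def)
  qed
qed

lemma Delta16_eq: "Delta16 = delta16_form"
  unfolding Delta16_def
proof (rule the_equality)
  show *: "delta16_form \<in> cusp_forms 16 \<and> fourier_coeff delta16_form 1 = 1"
    using delta16_form_modular delta16_fps_low
    by (simp add: cusp_forms_def fourier_coeff_eqI[OF delta16_form_q_expansion])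
  show "f = delta16_form" if "f \<in> cusp_forms 16 \<and> fourier_coeff f 1 = 1" for f
    using that * by (intro cusp_forms_16_unique) auto
qed

lemma fourier_coeff_Delta16: "fourier_coeff Delta16 n = of_int (delta16_fps $ n)"
  unfolding Delta16_eq fourier_coeff_eqI[OF delta16_form_q_expansion] ..

text \<open>2 is the inverse of 16 modulo 31.\<close>

lemma cong_cancel_16:
  assumes "[16 * a = 16 * b] (mod 31)"
  shows "[a = b] (mod (31::int))"
proof -
  have unit: "[2 * (16 * c) = c] (mod 31)" for c :: int
    by (simp add: cong_iff_dvd_diff)
  have "[2 * (16 * a) = 2 * (16 * b)] (mod 31)" using assms by (rule cong_scalar_left)
  thus ?thesis using unit by (meson cong_sym cong_trans)
qed

theorem proposition4p1:
  fixes p :: nat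
  assumes "prime p" and "p \<noteq> 31"
  shows "\<exists>a :: int. fourier_coeff Delta16 p = of_int a \<and>
    (Legendre (int p) 31 = -1 \<longrightarrow> [a = 0] (mod 31)) \<and>
    ((\<exists>u v :: int. u \<noteq> 0 \<and> int p = u ^ 2 + 31 * v ^ 2) \<longrightarrow> [a = 2] (mod 31)) \<and>
    (Legendre (int p) 31 \<noteq> -1 \<and> \<not> (\<exists>u v :: int. u \<noteq> 0 \<and> int p = u ^ 2 + 31 * v ^ 2)
       \<longrightarrow> [a = -1] (mod 31))"
proof (intro exI[of _ "delta16_fps $ p"] conjI impI)
  note * = delta16_fps_mod_31[of p]
  show "fourier_coeff Delta16 p = of_int (delta16_fps $ p)" by (rule fourier_coeff_Delta16)
  show "[delta16_fps $ p = 0] (mod 31)" if "Legendre (int p) 31 = -1"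
    by (rule cong_cancel_16) (use * reps_nonresidue[OF assms that] in simp)
  show "[delta16_fps $ p = 2] (mod 31)"
    if ex: "\<exists>u v :: int. u \<noteq> 0 \<and> int p = u ^ 2 + 31 * v ^ 2"
  proof -
    from ex obtain u v :: int where "u \<noteq> 0" "int p = u ^ 2 + 31 * v ^ 2" by blast
    \<comment> \<open>The congruence reads 16 a = 8 * 4 = 16 * 2.\<close>
    from reps_principal[OF assms this] show ?thesis by - (rule cong_cancel_16, use * in simp)
  qed
  show "[delta16_fps $ p = -1] (mod 31)"
    if that: "Legendre (int p) 31 \<noteq> -1 \<and> \<not> (\<exists>u v :: int. u \<noteq> 0 \<and> int p = u ^ 2 + 31 * v ^ 2)"
  proof -
    have "\<not> [int p = 0] (mod 31)"
    proof
      assume "[int p = 0] (mod 31)"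
      hence "31 dvd p" by (metis cong_0_iff int_dvd_int_iff of_nat_numeral)
      thus False using assms(1) assms(2)[symmetric] primes_dvd_imp_eq[of 31 p] by simp
    qed
    hence "Legendre (int p) 31 = 1" using that by (auto simp: Legendre_def split: if_splits)
    \<comment> \<open>The congruence reads 16 a = -4 * 4 = 16 * (-1).\<close>
    from reps_nonprincipal[OF assms this] that show ?thesis by - (rule cong_cancel_16, use * in simp)
  qed
qed

end
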